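(* Let $M\subset\mathbb C^N$ be a smooth generic submanifold that is of finite type and finitely nondegenerate at $p_0\in M$. If $\widetilde M\subset\mathbb C^N$ is a smooth generic submanifold of the same dimension as $M$ and $H\colon(\mathbb C^N,p_0)\to\mathbb C^N$ is a germ of a finite holomorphic mapping with $H(M)\subset\widetilde M$, then $H$ is a local biholomorphism at $p_0$.
   Context: A real smooth submanifold $M\subset\mathbb C^N$ of codimension $d$ through $p_0$ is called generic (at $p_0$) if near $p_0$ it is given by $\rho=0$ for some smooth $\rho=(\rho_1,\dots,\rho_d)\colon(\mathbb C^N,p_0)\to\mathbb R^d$ with $\partial\rho_1\wedge\dots\wedge\partial\rho_d\neq0$ at $p_0$. Set $n:=N-d$ (the CR dimension), $T^{0,1}M:=\mathbb CTM\cap T^{0,1}\mathbb C^N$ (the CR bundle) and $T^{1,0}M:=\overline{T^{0,1}M}$. $(0,1)$ (resp. $(1,0)$) vector fields tangent to $M$ are sections of $T^{0,1}M$ (resp. $T^{1,0}M$). All statements are local (germs): $H(M)\subset\widetilde M$ means that $H$ maps a sufficiently small neighborhood of $p_0$ in $M$ into $\widetilde M$. $M$ is of finite type at $p_0$ if the complex Lie algebra $\mathfrak g_M$ generated by all smooth $(1,0)$ and $(0,1)$ vector fields tangent to $M$ (near $p_0$) satisfies $\mathfrak g_M(p_0)=\mathbb CT_{p_0}M$. $M$ is finitely nondegenerate at $p_0$ if $$\operatorname{span}_{\mathbb C}\Big\{L^\alpha\Big(\frac{\partial\rho_j}{\partial Z}\Big)(p_0)\colon j=1,\dots,d,\ \alpha\in\mathbb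 Z_{\ge0}^n\Big\}=\mathbb C^N,$$ where $\partial\rho_j/\partial Z=(\partial\rho_j/\partial Z_1,\dots,\partial\rho_j/\partial Z_N)$, $L_1,\dots,L_n$ is a basis for the smooth $(0,1)$ vector fields tangent to $M$ near $p_0$, and $L^\alpha:=L_1^{\alpha_1}\cdots L_n^{\alpha_n}$. A germ of a holomorphic mapping $H\colon(\mathbb C^N,p_0)\to\mathbb C^N$ is finite if the ideal generated by the components of $H(Z)-H(p_0)$ has finite codimension (as a complex vector space) in the ring of convergent (equivalently, formal) power series in $Z-p_0$. *)

theory Defs
  imports "HOL-Analysis.Analysis"
begin

text \<open>
  Complex Euclidean space is \<open>complex ^ 'N\<close>, with \<open>CARD('N)\<close> the dimension. Germs at a point
  are represented by total functions that are only constrained near that point. Families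
  indexed by \<open>1, \<dots>, d\<close> or \<open>1, \<dots>, n\<close> are indexed by \<open>j < d\<close>, \<open>i < n\<close> here, so that \<open>d\<close>
  and \<open>n\<close> may be 0.
\<close>

subsection \<open>Smooth functions and Wirtinger derivatives\<close>

primrec differentiable_upto ::
  "nat \<Rightarrow> 'a::real_normed_vector set \<Rightarrow> ('a \<Rightarrow> 'b::real_normed_vector) \<Rightarrow> bool" where
  "differentiable_upto 0 U f \<longleftrightarrow> continuous_on U f"
| "differentiable_upto (Suc k) U f \<longleftrightarrow>
     (\<forall>x\<in>U. f differentiable (at x)) \<and>
     (\<forall>v. differentiable_upto k U (\<lambda>x. frechet_derivative f (at x) v))"

text \<open>Only meaningful for open \<open>U\<close>, on which it says that \<open>f\<close> is infinitely differentiable.\<close>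

definition smooth_on ::
  "'a::real_normed_vector set \<Rightarrow> ('a \<Rightarrow> 'b::real_normed_vector) \<Rightarrow> bool" where
  "smooth_on U f \<longleftrightarrow> (\<forall>k. differentiable_upto k U f)"

definition smooth_near ::
  "'a::real_normed_vector \<Rightarrow> ('a \<Rightarrow> 'b::real_normed_vector) \<Rightarrow> bool" where
  "smooth_near p f \<longleftrightarrow> (\<exists>U. open U \<and> p \<in> U \<and> smooth_on U f)"

definition dZ :: "'N::finite \<Rightarrow> (complex^'N \<Rightarrow> complex) \<Rightarrow> complex^'N \<Rightarrow> complex" where
  "dZ k f p = (frechet_derivative f (at p) (axis k 1)
                 - \<i> * frechet_derivative f (at p) (axis k \<i>)) / 2"

definition dZbar :: "'N::finite \<Rightarrow> (complex^'N \<Rightarrow> complex) \<Rightarrow> complex^'N \<Rightarrow> complex" where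
  "dZbar k f p = (frechet_derivative f (at p) (axis k 1)
                    + \<i> * frechet_derivative f (at p) (axis k \<i>)) / 2"

definition grad_Z :: "(complex^'N::finite \<Rightarrow> real) \<Rightarrow> complex^'N \<Rightarrow> complex^'N" where
  "grad_Z r p = (\<chi> k. dZ k (\<lambda>z. complex_of_real (r z)) p)"


subsection \<open>Complex tangent vectors and vector fields\<close>

text \<open>
  The pair \<open>(a, b)\<close> stands for the complex tangent vector
  \<open>\<Sum>k. a\<^sub>k \<partial>/\<partial>Z\<^sub>k + b\<^sub>k \<partial>/\<partial>Zbar\<^sub>k\<close>. Consequently the vectors of type (1,0) are the pairs
  \<open>(a, 0)\<close>, those of type (0,1) are the pairs \<open>(0, b)\<close>, and complex conjugation also swaps the
  two components.
\<close>

type_synonym 'N cvector = "(complex^'N) \<times> (complex^'N)"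
type_synonym 'N cfield = "complex^'N \<Rightarrow> 'N cvector"

definition cscale :: "complex \<Rightarrow> 'N::finite cvector \<Rightarrow> 'N cvector" where
  "cscale c \<xi> = (c *s fst \<xi>, c *s snd \<xi>)"

definition cconj :: "'N::finite cvector \<Rightarrow> 'N cvector" where
  "cconj \<xi> = ((\<chi> k. cnj (snd \<xi> $ k)), (\<chi> k. cnj (fst \<xi> $ k)))"

definition vector_apply ::
  "'N::finite cvector \<Rightarrow> (complex^'N \<Rightarrow> complex) \<Rightarrow> complex^'N \<Rightarrow> complex" where
  "vector_apply \<xi> f p = (\<Sum>k\<in>UNIV. fst \<xi> $ k * dZ k f p + snd \<xi> $ k * dZbar k f p)"

definition field_apply ::
  "'N::finite cfield \<Rightarrow> (complex^'N \<Rightarrow> complex) \<Rightarrow> complex^'N \<Rightarrow> complex" where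
  "field_apply X f p = vector_apply (X p) f p"

definition field_apply_vec ::
  "'N::finite cfield \<Rightarrow> (complex^'N \<Rightarrow> complex^'N) \<Rightarrow> complex^'N \<Rightarrow> complex^'N" where
  "field_apply_vec X F p = (\<chi> k. field_apply X (\<lambda>z. F z $ k) p)"

definition lie_bracket :: "'N::finite cfield \<Rightarrow> 'N cfield \<Rightarrow> 'N cfield" where
  "lie_bracket X Y p =
     (field_apply_vec X (\<lambda>z. fst (Y z)) p - field_apply_vec Y (\<lambda>z. fst (X z)) p,
      field_apply_vec X (\<lambda>z. snd (Y z)) p - field_apply_vec Y (\<lambda>z. snd (X z)) p)"

inductive_set generated_lie_algebra :: "'N::finite cfield set \<Rightarrow> 'N cfield set"
  for G :: "'N cfield set" where
  generator: "X \<in> G \<Longrightarrow> X \<in> generated_lie_algebra G"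
| add: "X \<in> generated_lie_algebra G \<Longrightarrow> Y \<in> generated_lie_algebra G \<Longrightarrow>
    (\<lambda>p. X p + Y p) \<in> generated_lie_algebra G"
| scale: "X \<in> generated_lie_algebra G \<Longrightarrow> (\<lambda>p. cscale c (X p)) \<in> generated_lie_algebra G"
| bracket: "X \<in> generated_lie_algebra G \<Longrightarrow> Y \<in> generated_lie_algebra G \<Longrightarrow>
    lie_bracket X Y \<in> generated_lie_algebra G"


subsection \<open>Generic submanifolds\<close>

text \<open>The value of \<open>\<omega>\<^sub>0 \<and> \<dots> \<and> \<omega>\<^bsub>d-1\<^esub>\<close> on \<open>(v\<^sub>0, \<dots>, v\<^bsub>d-1\<^esub>)\<close>, for 1-forms \<open>\<omega>\<^sub>j\<close>.\<close>

definition wedge :: "nat \<Rightarrow> (nat \<Rightarrow> 'v \<Rightarrow> complex) \<Rightarrow> (nat \<Rightarrow> 'v) \<Rightarrow> complex" where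
  "wedge d \<omega> v =
     (\<Sum>\<pi> | \<pi> permutes {..<d}. of_int (sign \<pi>) * (\<Prod>j<d. \<omega> j (v (\<pi> j))))"

text \<open>The (1,0)-form \<open>\<partial>r = \<Sum>k. \<partial>r/\<partial>Z\<^sub>k dZ\<^sub>k\<close> at \<open>p\<close>.\<close>

definition del_form :: "(complex^'N::finite \<Rightarrow> real) \<Rightarrow> complex^'N \<Rightarrow> complex^'N \<Rightarrow> complex" where
  "del_form r p v = (\<Sum>k\<in>UNIV. grad_Z r p $ k * v $ k)"

definition generic_defining_function ::
  "nat \<Rightarrow> (nat \<Rightarrow> complex^'N::finite \<Rightarrow> real) \<Rightarrow> (complex^'N) set \<Rightarrow> complex^'N \<Rightarrow> bool" where
  "generic_defining_function d \<rho> M p0 \<longleftrightarrow>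
     p0 \<in> M \<and>
     (\<exists>U. open U \<and> p0 \<in> U \<and> (\<forall>j<d. smooth_on U (\<rho> j)) \<and>
          M \<inter> U = {p \<in> U. \<forall>j<d. \<rho> j p = 0}) \<and>
     wedge d (\<lambda>j. del_form (\<rho> j) p0) \<noteq> (\<lambda>v. 0)"

definition generic_submanifold_at :: "nat \<Rightarrow> (complex^'N::finite) set \<Rightarrow> complex^'N \<Rightarrow> bool" where
  "generic_submanifold_at d M p0 \<longleftrightarrow> (\<exists>\<rho>. generic_defining_function d \<rho> M p0)"

text \<open>
  In the following, \<open>\<rho>\<close> is a generic defining function of \<open>M\<close> near the base point \<open>p0\<close>; for
  \<open>p \<in> M\<close> near \<open>p0\<close> the tangent space of \<open>M\<close> at \<open>p\<close> is the common kernel of the differentials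
  of the \<open>\<rho> j\<close>, so that its complexification is given by \<open>\<xi> \<rho>\<^sub>j = 0\<close>. The resulting notions do
  not depend on the choice of \<open>\<rho>\<close>.
\<close>

definition complex_tangent_space ::
  "nat \<Rightarrow> (nat \<Rightarrow> complex^'N::finite \<Rightarrow> real) \<Rightarrow> complex^'N \<Rightarrow> 'N cvector set" where
  "complex_tangent_space d \<rho> p =
     {\<xi>. \<forall>j<d. vector_apply \<xi> (\<lambda>z. complex_of_real (\<rho> j z)) p = 0}"

definition T01 ::
  "nat \<Rightarrow> (nat \<Rightarrow> complex^'N::finite \<Rightarrow> real) \<Rightarrow> complex^'N \<Rightarrow> 'N cvector set" where
  "T01 d \<rho> p = complex_tangent_space d \<rho> p \<inter> {\<xi>. fst \<xi> = 0}"

definition T10 ::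
  "nat \<Rightarrow> (nat \<Rightarrow> complex^'N::finite \<Rightarrow> real) \<Rightarrow> complex^'N \<Rightarrow> 'N cvector set" where
  "T10 d \<rho> p = cconj ` T01 d \<rho> p"

text \<open>
  Germs at \<open>p0\<close> of smooth sections of a bundle \<open>E\<close> of complex tangent vectors over \<open>M\<close>. A
  section over \<open>M\<close> is represented by a smooth extension to a neighbourhood of \<open>p0\<close> in the ambient
  space; along \<open>M\<close>, brackets of fields tangent to \<open>M\<close> and their action on functions do not depend
  on the extension.
\<close>

definition smooth_sections ::
  "(complex^'N::finite) set \<Rightarrow> (complex^'N \<Rightarrow> 'N cvector set) \<Rightarrow> complex^'N \<Rightarrow> 'N cfield set" where
  "smooth_sections M E p0 = {X. smooth_near p0 X \<and> (\<forall>\<^sub>F p in nhds p0. p \<in> M \<longrightarrow> X p \<in> E p)}"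

definition finite_type_at ::
  "nat \<Rightarrow> (nat \<Rightarrow> complex^'N::finite \<Rightarrow> real) \<Rightarrow> (complex^'N) set \<Rightarrow> complex^'N \<Rightarrow> bool" where
  "finite_type_at d \<rho> M p0 \<longleftrightarrow>
     (\<lambda>X. X p0) ` generated_lie_algebra
         (smooth_sections M (T10 d \<rho>) p0 \<union> smooth_sections M (T01 d \<rho>) p0)
       = complex_tangent_space d \<rho> p0"

text \<open>
  \<open>L 0, \<dots>, L (n-1)\<close> is a basis of the module of germs of smooth sections of \<open>E\<close> over the ring of
  germs of smooth complex-valued functions on \<open>M\<close> (again represented by extensions).
\<close>

definition basis_of_sections ::
  "nat \<Rightarrow> (nat \<Rightarrow> 'N::finite cfield) \<Rightarrow> (complex^'N) set \<Rightarrow> (complex^'N \<Rightarrow> 'N cvector set)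
     \<Rightarrow> complex^'N \<Rightarrow> bool" where
  "basis_of_sections n L M E p0 \<longleftrightarrow>
     (\<forall>i<n. L i \<in> smooth_sections M E p0) \<and>
     (\<forall>X\<in>smooth_sections M E p0. \<exists>f :: nat \<Rightarrow> complex^'N \<Rightarrow> complex.
        (\<forall>i<n. smooth_near p0 (f i)) \<and>
        (\<forall>\<^sub>F p in nhds p0. p \<in> M \<longrightarrow> X p = (\<Sum>i<n. cscale (f i p) (L i p)))) \<and>
     (\<forall>f :: nat \<Rightarrow> complex^'N \<Rightarrow> complex.
        (\<forall>i<n. smooth_near p0 (f i)) \<longrightarrow>
        (\<forall>\<^sub>F p in nhds p0. p \<in> M \<longrightarrow> (\<Sum>i<n. cscale (f i p) (L i p)) = 0) \<longrightarrow>
        (\<forall>i<n. \<forall>\<^sub>F p in nhds p0. p \<in> M \<longrightarrow> f i p = 0))"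

text \<open>\<open>L\<^sub>0\<close> to the power \<open>\<alpha>\<^sub>0\<close> is applied last.\<close>

definition iterated_apply ::
  "nat \<Rightarrow> (nat \<Rightarrow> 'N::finite cfield) \<Rightarrow> (nat \<Rightarrow> nat) \<Rightarrow> (complex^'N \<Rightarrow> complex^'N)
     \<Rightarrow> complex^'N \<Rightarrow> complex^'N" where
  "iterated_apply n L \<alpha> F = foldr (\<lambda>i. field_apply_vec (L i) ^^ \<alpha> i) [0..<n] F"

definition finitely_nondegenerate_at ::
  "nat \<Rightarrow> (nat \<Rightarrow> complex^'N::finite \<Rightarrow> real) \<Rightarrow> (complex^'N) set \<Rightarrow> complex^'N \<Rightarrow> bool" where
  "finitely_nondegenerate_at d \<rho> M p0 \<longleftrightarrow>
     (\<exists>L. basis_of_sections (CARD('N) - d) L M (T01 d \<rho>) p0 \<and>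
          vec.span {iterated_apply (CARD('N) - d) L \<alpha> (grad_Z (\<rho> j)) p0 | j \<alpha>. j < d} = UNIV)"


subsection \<open>Holomorphic mappings\<close>

definition holomorphic_map_on ::
  "(complex^'N::finite) set \<Rightarrow> (complex^'N \<Rightarrow> complex^'N) \<Rightarrow> bool" where
  "holomorphic_map_on U H \<longleftrightarrow>
     (\<forall>z\<in>U. \<exists>A :: complex^'N^'N. (H has_derivative (\<lambda>v. A *v v)) (at z))"

definition holomorphic_map_near ::
  "complex^'N::finite \<Rightarrow> (complex^'N \<Rightarrow> complex^'N) \<Rightarrow> bool" where
  "holomorphic_map_near p H \<longleftrightarrow> (\<exists>U. open U \<and> p \<in> U \<and> holomorphic_map_on U H)"

definition local_biholomorphism_at ::
  "complex^'N::finite \<Rightarrow> (complex^'N \<Rightarrow> complex^'N) \<Rightarrow> bool" where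
  "local_biholomorphism_at p H \<longleftrightarrow>
     (\<exists>U V G. open U \<and> p \<in> U \<and> open V \<and> H ` U = V \<and> G ` V = U \<and>
        (\<forall>z\<in>U. G (H z) = z) \<and> (\<forall>w\<in>V. H (G w) = w) \<and>
        holomorphic_map_on U H \<and> holomorphic_map_on V G)"

text \<open>
  The ring of convergent power series in \<open>Z - p\<close>; a series is identified with the germ at \<open>p\<close> of
  its sum, so its elements are to be compared near \<open>p\<close> only.
\<close>

definition convergent_power_series :: "complex^'N::finite \<Rightarrow> (complex^'N \<Rightarrow> complex) set" where
  "convergent_power_series p =
     {f. \<exists>a :: ('N \<Rightarrow> nat) \<Rightarrow> complex. \<forall>\<^sub>F z in nhds p.
           ((\<lambda>\<alpha>. a \<alpha> * (\<Prod>k\<in>UNIV. (z $ k - p $ k) ^ \<alpha> k)) has_sum f z) UNIV}"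

definition component_ideal ::
  "complex^'N::finite \<Rightarrow> (complex^'N \<Rightarrow> complex^'N) \<Rightarrow> (complex^'N \<Rightarrow> complex) set" where
  "component_ideal p F =
     {h. \<exists>g :: 'N \<Rightarrow> complex^'N \<Rightarrow> complex. (\<forall>i. g i \<in> convergent_power_series p) \<and>
           (\<forall>\<^sub>F z in nhds p. h z = (\<Sum>i\<in>UNIV. g i z * F z $ i))}"

text \<open>Finite codimension: finitely many elements span the ring modulo the ideal.\<close>

definition finite_map_at :: "complex^'N::finite \<Rightarrow> (complex^'N \<Rightarrow> complex^'N) \<Rightarrow> bool" where
  "finite_map_at p H \<longleftrightarrow>
     (\<exists>B. finite B \<and> B \<subseteq> convergent_power_series p \<and>
        (\<forall>f\<in>convergent_power_series p. \<exists>c :: (complex^'N \<Rightarrow> complex) \<Rightarrow> complex.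
           (\<lambda>z. f z - (\<Sum>b\<in>B. c b * b z)) \<in> component_ideal p (\<lambda>z. H z - H p)))"

end

theory Submission
  imports Defs "HOL-Complex_Analysis.Conformal_Mappings"
begin

text \<open>
  Let \<open>J\<close> be the determinant of the complex Jacobian matrix \<open>H\<^sub>Z\<close> of \<open>H\<close>. By the inverse function
  theorem the claim is that \<open>J\<close> does not vanish at \<open>p0\<close>. Suppose that it does.

  \<^bold>\<open>Reflection.\<close> The defining functions of \<open>M'\<close>, composed with \<open>H\<close>, vanish on \<open>M\<close>, so along \<open>M\<close> their
  gradients are combinations, with real smooth coefficients \<open>A\<close>, of the gradients of the defining
  functions of \<open>M\<close>. Let \<open>a\<close> be the determinant of \<open>A\<close>. The matrix identity expressing this shows that
  \<open>a\<close> divides \<open>J\<close>, up to a unit (\<open>jacobian_factorization\<close>). Conversely, a gradient multiplied by \<open>a\<close> lies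
  in the module spanned by the rows of \<open>H\<^sub>Z\<close>. A (0,1) field annihilates the holomorphic matrix \<open>H\<^sub>Z\<close>, so
  differentiating such relations preserves them up to powers of \<open>a\<close>; finite nondegeneracy then
  gives that \<open>J\<close> divides a power of \<open>a\<close>, up to a unit (\<open>jacobian_divides_power\<close>). As \<open>a\<close> is real
  on \<open>M\<close>, a prime ideal of germs of smooth functions on \<open>M\<close> contains \<open>J\<close> if and only if it contains the
  complex conjugate of \<open>J\<close> (\<open>jacobian_mem_iff_cnj\<close>).

  \<^bold>\<open>Propagation.\<close> Let \<open>P\<close> be such a prime ideal and \<open>X\<close> a field tangent to \<open>M\<close>. The germs all of whose
  iterated derivatives along \<open>X\<close> lie in \<open>P\<close> form a prime ideal again, the kernel of the formal flow of
  \<open>X\<close> modulo \<open>P\<close> (\<open>germ_prime_invariant_part\<close>). If \<open>P\<close> contains \<open>J\<close> and \<open>X\<close> is of type (1,0), then \<open>X\<close>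
  annihilates the conjugate of \<open>J\<close>, which therefore lies in the new ideal; by reflection so does \<open>J\<close>.
  For type (0,1) the roles are exchanged. Starting with the ideal of germs that vanish at \<open>p0\<close>, one
  concludes that every derivative of \<open>J\<close> along a word in (1,0) and (0,1) fields vanishes at \<open>p0\<close>
  (\<open>flat_germs_mem\<close>). This takes the place of the iterated Segre sets, and makes sense for
  smooth \<open>M\<close>.

  \<^bold>\<open>Conclusion.\<close> By finite type and genericity the Lie algebra generated by these fields contains fields
  whose (1,0) parts at \<open>p0\<close> form a basis. Hence all holomorphic derivatives of \<open>J\<close> vanish at \<open>p0\<close>, and \<open>J\<close>
  is identically zero (\<open>holomorphic_flat_germ_zero\<close>). But the fibre of a finite map through \<open>p0\<close> is
  isolated, whereas a map with identically vanishing Jacobian would have compact fibres of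
  positive dimension nearby, contradicting the maximum principle
  (\<open>isolated_fibre_imp_jacobian_nonzero\<close>).
\<close>

section \<open>Calculus of smooth functions\<close>

lemma differentiable_upto_subset:
  "differentiable_upto k U f \<Longrightarrow> V \<subseteq> U \<Longrightarrow> differentiable_upto k V f"
  by (induction k arbitrary: f) (auto intro: continuous_on_subset)

lemma frechet_derivative_cong_open:
  assumes "open U" "x \<in> U" "\<And>y. y \<in> U \<Longrightarrow> f y = g y"
  shows "frechet_derivative f (at x) = frechet_derivative g (at x)"
proof -
  have "(f has_derivative D) (at x) \<longleftrightarrow> (g has_derivative D) (at x)" for D
    using has_derivative_transform_within_open[of _ D x UNIV U] assms by metis
  then show ?thesis by (simp add: frechet_derivative_def)
qed

lemma differentiable_cong_open:
  assumes "open U" "x \<in> U" "\<And>y. y \<in> U \<Longrightarrow> f y = g y" "f differentiable (at x)"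
  shows "g differentiable (at x)"
  using assms has_derivative_transform_within_open[of f _ x UNIV U g]
  unfolding differentiable_def by blast

lemma differentiable_upto_cong:
  assumes "open U" "\<And>x. x \<in> U \<Longrightarrow> f x = g x" "differentiable_upto k U f"
  shows "differentiable_upto k U g"
  using assms(2,3)
proof (induction k arbitrary: f g)
  case 0
  then show ?case by (simp cong: continuous_on_cong)
next
  case (Suc k)
  have "g differentiable (at x)" if "x \<in> U" for x
    using differentiable_cong_open[OF assms(1) that] Suc.prems that by auto
  moreover have "differentiable_upto k U (\<lambda>x. frechet_derivative g (at x) v)" for v
    by (rule Suc.IH[of "\<lambda>x. frechet_derivative f (at x) v"])
      (use Suc.prems frechet_derivative_cong_open[OF assms(1), of _ f g] in auto)
  ultimately show ?case by simp
qed

lemma differentiable_upto_SucD: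
  "differentiable_upto (Suc k) U f \<Longrightarrow> differentiable_upto k U f"
proof (induction k arbitrary: f)
  case 0
  then show ?case
    by (auto simp: continuous_on_eq_continuous_within differentiable_imp_continuous_within
        continuous_at_imp_continuous_at_within)
qed auto

lemma differentiable_upto_SucI:
  assumes "open U" and D: "\<And>x. x \<in> U \<Longrightarrow> (f has_derivative D x) (at x)"
    and "\<And>v. differentiable_upto k U (\<lambda>x. D x v)"
  shows "differentiable_upto (Suc k) U f"
proof -
  have "differentiable_upto k U (\<lambda>x. frechet_derivative f (at x) v)" for v
    by (rule differentiable_upto_cong[OF assms(1) _ assms(3)])
      (simp add: frechet_derivative_at[OF D])
  then show ?thesis using differentiableI[OF D] by auto
qed

lemma
  assumes "differentiable_upto (Suc k) U f"
  shows differentiable_upto_has_derivative: "x \<in> U \<Longrightarrow> (f has_derivative frechet_derivative f (at x)) (at x)"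
    and differentiable_upto_frechet: "differentiable_upto k U (\<lambda>x. frechet_derivative f (at x) v)"
  using assms by (simp_all add: frechet_derivative_works)

lemma differentiable_upto_const: "differentiable_upto k U (\<lambda>x. c)"
  by (induction k arbitrary: c) auto

lemma differentiable_upto_add:
  assumes "open U" "differentiable_upto k U f" "differentiable_upto k U g"
  shows "differentiable_upto k U (\<lambda>x. f x + g x)"
  using assms(2,3)
proof (induction k arbitrary: f g)
  case (Suc k)
  show ?case
    by (rule differentiable_upto_SucI[OF assms(1) has_derivative_add[OF Suc.prems[THEN differentiable_upto_has_derivative]]
          Suc.IH[OF Suc.prems[THEN differentiable_upto_frechet]]])
qed (simp add: continuous_on_add)

lemma differentiable_upto_bounded_linear:
  assumes "open U" "bounded_linear L" "differentiable_upto k U f"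
  shows "differentiable_upto k U (\<lambda>x. L (f x))"
  using assms(3)
proof (induction k arbitrary: f)
  case (Suc k)
  show ?case
    by (rule differentiable_upto_SucI[OF assms(1)
          bounded_linear.has_derivative[OF assms(2) Suc.prems[THEN differentiable_upto_has_derivative]]
          Suc.IH[OF Suc.prems[THEN differentiable_upto_frechet]]])
qed (simp add: bounded_linear.continuous_on[OF assms(2)])

lemma differentiable_upto_mult:
  fixes f g :: "'a::real_normed_vector \<Rightarrow> 'b::real_normed_algebra"
  assumes "open U" "differentiable_upto k U f" "differentiable_upto k U g"
  shows "differentiable_upto k U (\<lambda>x. f x * g x)"
  using assms(2,3)
proof (induction k arbitrary: f g)
  case (Suc k)
  show ?case
    by (rule differentiable_upto_SucI[OF assms(1) has_derivative_mult[OF Suc.prems[THEN differentiable_upto_has_derivative]]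
          differentiable_upto_add[OF assms(1)
            Suc.IH[OF differentiable_upto_SucD[OF Suc.prems(1)] differentiable_upto_frechet[OF Suc.prems(2)]]
            Suc.IH[OF differentiable_upto_frechet[OF Suc.prems(1)] differentiable_upto_SucD[OF Suc.prems(2)]]]])
qed (simp add: continuous_on_mult)

lemma differentiable_upto_sum:
  assumes "open U" "finite I" "\<And>i. i \<in> I \<Longrightarrow> differentiable_upto k U (f i)"
  shows "differentiable_upto k U (\<lambda>x. \<Sum>i\<in>I. f i x)"
  using assms(2,3)
  by (induction I rule: finite_induct)
    (auto intro!: differentiable_upto_add[OF assms(1)] differentiable_upto_const)

lemma differentiable_upto_inverse:
  fixes f :: "'a::real_normed_vector \<Rightarrow> complex"
  assumes "open U" "differentiable_upto k U f" "\<And>x. x \<in> U \<Longrightarrow> f x \<noteq> 0"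
  shows "differentiable_upto k U (\<lambda>x. inverse (f x))"
  using assms(2)
proof (induction k)
  case (Suc k)
  note inv = Suc.IH[OF differentiable_upto_SucD[OF Suc.prems]]
  show ?case
    by (rule differentiable_upto_SucI[OF assms(1)
          Deriv.has_derivative_inverse[OF assms(3) differentiable_upto_has_derivative[OF Suc.prems]]
          differentiable_upto_bounded_linear[OF assms(1) bounded_linear_minus[OF bounded_linear_ident]
            differentiable_upto_mult[OF assms(1) differentiable_upto_mult[OF assms(1) inv
              differentiable_upto_frechet[OF Suc.prems]] inv]]])
qed (use assms(3) in \<open>simp add: continuous_on_inverse\<close>)

text \<open>
  The derivative of \<open>f \<circ> h\<close> is a combination of the functions \<open>g \<circ> h\<close>, where \<open>g\<close> is a directional
  derivative of \<open>f\<close>, with components of the derivative of \<open>h\<close> as coefficients. Hence the induction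
  on the order is for all \<open>f\<close> at once, with \<open>h\<close> smooth throughout.
\<close>

lemma differentiable_upto_compose:
  fixes f :: "'b::euclidean_space \<Rightarrow> complex" and h :: "'a::real_normed_vector \<Rightarrow> 'b"
  assumes "open U" "open V" "h ` U \<subseteq> V" "smooth_on U h" "differentiable_upto k V f"
  shows "differentiable_upto k U (\<lambda>x. f (h x))"
  using assms(5)
proof (induction k arbitrary: f)
  case 0
  moreover have "continuous_on U h"
    using assms(4) unfolding smooth_on_def by (metis differentiable_upto.simps(1))
  ultimately show ?case
    using assms(3) by (auto intro: continuous_on_compose2)
next
  case (Suc k)
  have hd: "h differentiable (at x)" if "x \<in> U" for x
    using assms(4) that unfolding smooth_on_def by (metis differentiable_upto.simps(2))
  have hk: "differentiable_upto k U (\<lambda>x. frechet_derivative h (at x) v)" for v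
    using assms(4) unfolding smooth_on_def by (metis differentiable_upto.simps(2))
  have D: "((\<lambda>x. f (h x)) has_derivative
      (\<lambda>v. frechet_derivative f (at (h x)) (frechet_derivative h (at x) v))) (at x)"
    if "x \<in> U" for x
    using that Suc.prems assms(3) hd
    by (auto intro!: has_derivative_compose[of h _ x UNIV f] simp: frechet_derivative_works[symmetric])
  have expand: "frechet_derivative f (at (h x)) w =
      (\<Sum>b\<in>Basis. of_real (w \<bullet> b) * frechet_derivative f (at (h x)) b)" if "x \<in> U" for x w
  proof -
    have "linear (frechet_derivative f (at (h x)))"
      using that Suc.prems assms(3) by (auto intro!: linear_frechet_derivative)
    then show ?thesis
      by (subst euclidean_representation[symmetric, of w])
        (simp only: linear_sum linear_scale scaleR_conv_of_real)
  qed
  have "differentiable_upto k U (\<lambda>x. frechet_derivative f (at (h x)) (frechet_derivative h (at x) v))" for v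
  proof (rule differentiable_upto_cong[OF assms(1)])
    show "differentiable_upto k U (\<lambda>x. \<Sum>b\<in>Basis. of_real (frechet_derivative h (at x) v \<bullet> b) *
        frechet_derivative f (at (h x)) b)"
      by (intro differentiable_upto_sum[OF assms(1)] differentiable_upto_mult[OF assms(1)]
          Suc.IH[of "\<lambda>y. frechet_derivative f (at y) _"]
          differentiable_upto_bounded_linear[OF assms(1) _ hk, of "\<lambda>w. of_real (w \<bullet> _)"]
          bounded_linear_compose[OF bounded_linear_of_real bounded_linear_inner_left])
        (use Suc.prems in auto)
  qed (simp add: expand[symmetric])
  with D show ?case by (rule differentiable_upto_SucI[OF assms(1)])
qed

lemma smooth_on_subset: "smooth_on U f \<Longrightarrow> V \<subseteq> U \<Longrightarrow> smooth_on V f"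
  unfolding smooth_on_def using differentiable_upto_subset by blast

lemma smooth_near_const [simp, intro]: "smooth_near p (\<lambda>x. c)"
  unfolding smooth_near_def smooth_on_def by (intro exI[of _ UNIV]) (auto simp: differentiable_upto_const)

lemma smooth_nearE2:
  assumes "smooth_near p f" "smooth_near p g"
  obtains U where "open U" "p \<in> U" "smooth_on U f" "smooth_on U g"
proof -
  obtain U V where "open U" "p \<in> U" "smooth_on U f" "open V" "p \<in> V" "smooth_on V g"
    using assms unfolding smooth_near_def by blast
  then show ?thesis
    using that[of "U \<inter> V"] smooth_on_subset by (metis IntI inf_le1 inf_le2 open_Int)
qed

lemma smooth_near_add [intro]:
  assumes "smooth_near p f" "smooth_near p g"
  shows "smooth_near p (\<lambda>x. f x + g x)"
  by (rule smooth_nearE2[OF assms])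
    (auto simp: smooth_near_def smooth_on_def intro: differentiable_upto_add)

lemma smooth_near_mult [intro]:
  fixes f g :: "'a::real_normed_vector \<Rightarrow> 'b::real_normed_algebra"
  assumes "smooth_near p f" "smooth_near p g"
  shows "smooth_near p (\<lambda>x. f x * g x)"
  by (rule smooth_nearE2[OF assms])
    (auto simp: smooth_near_def smooth_on_def intro: differentiable_upto_mult)

lemma smooth_near_bounded_linear:
  assumes "bounded_linear L" "smooth_near p f"
  shows "smooth_near p (\<lambda>x. L (f x))"
  using assms(2) unfolding smooth_near_def smooth_on_def
  by (blast intro: differentiable_upto_bounded_linear[OF _ assms(1)])

lemma smooth_near_minus [intro]: "smooth_near p f \<Longrightarrow> smooth_near p (\<lambda>x. - f x)"
  by (rule smooth_near_bounded_linear[OF bounded_linear_minus[OF bounded_linear_ident]])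

lemma smooth_near_diff [intro]:
  "smooth_near p f \<Longrightarrow> smooth_near p g \<Longrightarrow> smooth_near p (\<lambda>x. f x - g x)"
  using smooth_near_add[OF _ smooth_near_minus, of p f g] by simp

lemma smooth_near_cnj [intro]: "smooth_near p f \<Longrightarrow> smooth_near p (\<lambda>x. cnj (f x))"
  by (rule smooth_near_bounded_linear[OF bounded_linear_cnj])

lemma smooth_near_sum [intro]:
  "finite I \<Longrightarrow> (\<And>i. i \<in> I \<Longrightarrow> smooth_near p (f i)) \<Longrightarrow> smooth_near p (\<lambda>x. \<Sum>i\<in>I. f i x)"
  by (induction I rule: finite_induct) auto

lemma smooth_near_prod [intro]:
  fixes f :: "'i \<Rightarrow> 'a::real_normed_vector \<Rightarrow> complex"
  shows "finite I \<Longrightarrow> (\<And>i. i \<in> I \<Longrightarrow> smooth_near p (f i)) \<Longrightarrow> smooth_near p (\<lambda>x. \<Prod>i\<in>I. f i x)"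
  by (induction I rule: finite_induct) auto

lemma smooth_near_power [intro]:
  fixes f :: "'a::real_normed_vector \<Rightarrow> complex"
  shows "smooth_near p f \<Longrightarrow> smooth_near p (\<lambda>x. f x ^ m)"
  by (induction m) auto

lemma smooth_near_det [intro]:
  fixes A :: "'a::real_normed_vector \<Rightarrow> complex^'N::finite^'N"
  assumes "\<And>i j. smooth_near p (\<lambda>x. A x $ i $ j)"
  shows "smooth_near p (\<lambda>x. det (A x))"
  unfolding det_def using assms by (auto intro!: smooth_near_sum smooth_near_mult smooth_near_prod)

lemma smooth_near_continuous:
  assumes "smooth_near p f"
  shows "isCont f p"
proof -
  obtain U where U: "open U" "p \<in> U" "smooth_on U f"
    using assms smooth_near_def by blast
  then have "continuous_on U f"
    unfolding smooth_on_def by (metis differentiable_upto.simps(1))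
  then show ?thesis using U continuous_on_eq_continuous_at by blast
qed

lemma smooth_near_inverse:
  fixes f :: "'a::real_normed_vector \<Rightarrow> complex"
  assumes "smooth_near p f" "f p \<noteq> 0"
  shows "smooth_near p (\<lambda>x. inverse (f x))"
proof -
  obtain U where U: "open U" "p \<in> U" "smooth_on U f"
    using assms smooth_near_def by blast
  have "\<forall>\<^sub>F x in nhds p. f x \<noteq> 0"
    using tendsto_imp_eventually_ne[OF smooth_near_continuous[OF assms(1), unfolded isCont_def] assms(2)]
      assms(2) unfolding eventually_nhds_conv_at by blast
  then obtain V where V: "open V" "p \<in> V" "\<And>x. x \<in> V \<Longrightarrow> f x \<noteq> 0"
    unfolding eventually_nhds by blast
  have "smooth_on (U \<inter> V) f" using U smooth_on_subset by blast
  then have "smooth_on (U \<inter> V) (\<lambda>x. inverse (f x))"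
    unfolding smooth_on_def using U V by (auto intro!: differentiable_upto_inverse)
  then show ?thesis
    unfolding smooth_near_def using U V by (intro exI[of _ "U \<inter> V"]) auto
qed

lemma smooth_near_compose:
  fixes f :: "'b::euclidean_space \<Rightarrow> complex" and h :: "'a::real_normed_vector \<Rightarrow> 'b"
  assumes "smooth_near p h" "smooth_near (h p) f"
  shows "smooth_near p (\<lambda>x. f (h x))"
proof -
  obtain U where U: "open U" "p \<in> U" "smooth_on U h"
    using assms smooth_near_def by blast
  obtain V where V: "open V" "h p \<in> V" "smooth_on V f"
    using assms smooth_near_def by blast
  have "continuous_on U h"
    using U(3) unfolding smooth_on_def by (metis differentiable_upto.simps(1))
  then have op: "open (U \<inter> h -` V)"
    using U(1) V(1) by (simp add: continuous_on_open_vimage Int_commute)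
  have "smooth_on (U \<inter> h -` V) (\<lambda>x. f (h x))"
    unfolding smooth_on_def
    using differentiable_upto_compose[OF op V(1) _ smooth_on_subset[OF U(3)]] V(3)
    by (auto simp: smooth_on_def)
  then show ?thesis
    unfolding smooth_near_def using op U(2) V(2) by blast
qed

lemma smooth_near_frechet [intro]:
  "smooth_near p f \<Longrightarrow> smooth_near p (\<lambda>x. frechet_derivative f (at x) v)"
  unfolding smooth_near_def smooth_on_def by (metis differentiable_upto.simps(2))

lemma smooth_near_eventually: "smooth_near p f \<Longrightarrow> \<forall>\<^sub>F x in nhds p. smooth_near x f"
  unfolding smooth_near_def eventually_nhds by blast

lemma smooth_near_differentiable: "smooth_near p f \<Longrightarrow> f differentiable (at p)"
  unfolding smooth_near_def smooth_on_def by (metis differentiable_upto.simps(2))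

lemma smooth_near_cong:
  assumes "smooth_near p f" "\<forall>\<^sub>F x in nhds p. f x = g x"
  shows "smooth_near p g"
proof -
  obtain U where U: "open U" "p \<in> U" "smooth_on U f"
    using assms smooth_near_def by blast
  obtain V where V: "open V" "p \<in> V" "\<And>x. x \<in> V \<Longrightarrow> f x = g x"
    using assms(2) unfolding eventually_nhds by blast
  have "smooth_on (U \<inter> V) f" using U smooth_on_subset by blast
  then have "smooth_on (U \<inter> V) g"
    unfolding smooth_on_def using U V differentiable_upto_cong[of "U \<inter> V" f g] by auto
  then show ?thesis
    unfolding smooth_near_def using U V by (intro exI[of _ "U \<inter> V"]) auto
qed

section \<open>Symmetry of second derivatives\<close>

abbreviation dir_deriv :: "'a::real_normed_vector \<Rightarrow> ('a \<Rightarrow> 'b::real_normed_vector) \<Rightarrow> 'a \<Rightarrow> 'b" where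
  "dir_deriv v f x \<equiv> frechet_derivative f (at x) v"

lemma dir_deriv_eqI: "(f has_derivative D) (at x) \<Longrightarrow> dir_deriv v f x = D v"
  by (simp add: frechet_derivative_at[symmetric])

lemma has_real_derivative_along_line:
  fixes g :: "'a::real_normed_vector \<Rightarrow> real"
  assumes "g differentiable (at (a + s *\<^sub>R u))"
  shows "((\<lambda>s. g (a + s *\<^sub>R u)) has_real_derivative dir_deriv u g (a + s *\<^sub>R u)) (at s)"
proof -
  have D: "(g has_derivative frechet_derivative g (at (a + s *\<^sub>R u))) (at (a + s *\<^sub>R u))"
    using assms frechet_derivative_works by blast
  have "((\<lambda>s. g (a + s *\<^sub>R u)) has_derivative
      (\<lambda>t. frechet_derivative g (at (a + s *\<^sub>R u)) (t *\<^sub>R u))) (at s)"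
    by (rule has_derivative_compose[of "\<lambda>s. a + s *\<^sub>R u" "\<lambda>t. t *\<^sub>R u" s UNIV g, OF _ D])
      (auto intro!: derivative_eq_intros)
  moreover have "frechet_derivative g (at (a + s *\<^sub>R u)) (t *\<^sub>R u)
      = t * dir_deriv u g (a + s *\<^sub>R u)" for t
    using linear_scale[OF linear_frechet_derivative[OF assms], of t u] by simp
  ultimately show ?thesis
    by (simp add: has_field_derivative_def mult_commute_abs)
qed

text \<open>
  The mean value theorem, applied in the direction \<open>u\<close> and then in the direction \<open>v\<close>. The second
  difference on the left is symmetric in \<open>u\<close> and \<open>v\<close>, so that letting \<open>h\<close> tend to 0 in the two versions
  of this formula gives the symmetry of the second derivative.
\<close>

lemma second_difference:
  fixes g :: "'a::real_normed_vector \<Rightarrow> real"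
  assumes "0 < h" and g: "\<And>x. x \<in> U \<Longrightarrow> g differentiable (at x)"
    and gu: "\<And>x. x \<in> U \<Longrightarrow> dir_deriv u g differentiable (at x)"
    and U: "\<And>s t. \<lbrakk>0 \<le> s; s \<le> h; 0 \<le> t; t \<le> h\<rbrakk> \<Longrightarrow> p + s *\<^sub>R u + t *\<^sub>R v \<in> U"
  obtains s t where "0 < s" "s < h" "0 < t" "t < h"
    "g (p + h *\<^sub>R u + h *\<^sub>R v) - g (p + h *\<^sub>R u) - g (p + h *\<^sub>R v) + g p
       = h\<^sup>2 * dir_deriv v (dir_deriv u g) (p + s *\<^sub>R u + t *\<^sub>R v)"
proof -
  define F where "F s = g ((p + h *\<^sub>R v) + s *\<^sub>R u) - g (p + s *\<^sub>R u)" for s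
  have "\<exists>s. 0 < s \<and> s < h \<and> F h - F 0
      = (h - 0) * (dir_deriv u g ((p + h *\<^sub>R v) + s *\<^sub>R u) - dir_deriv u g (p + s *\<^sub>R u))"
  proof (rule MVT2[OF assms(1)])
    fix s assume "0 \<le> s" "s \<le> h"
    then have "p + h *\<^sub>R v + s *\<^sub>R u \<in> U" "p + s *\<^sub>R u \<in> U"
      using U[of s h] U[of s 0] assms(1) by (auto simp: algebra_simps)
    then show "(F has_real_derivative
        dir_deriv u g ((p + h *\<^sub>R v) + s *\<^sub>R u) - dir_deriv u g (p + s *\<^sub>R u)) (at s)"
      unfolding F_def by (intro DERIV_diff has_real_derivative_along_line g)
  qed
  then obtain s where s: "0 < s" "s < h" and Fs: "F h - F 0
      = h * (dir_deriv u g ((p + s *\<^sub>R u) + h *\<^sub>R v) - dir_deriv u g ((p + s *\<^sub>R u) + 0 *\<^sub>R v))"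
    by (auto simp: algebra_simps)
  have "\<exists>t. 0 < t \<and> t < h \<and>
      dir_deriv u g ((p + s *\<^sub>R u) + h *\<^sub>R v) - dir_deriv u g ((p + s *\<^sub>R u) + 0 *\<^sub>R v)
      = (h - 0) * dir_deriv v (dir_deriv u g) ((p + s *\<^sub>R u) + t *\<^sub>R v)"
    by (rule MVT2[OF assms(1)])
      (use s in \<open>auto intro!: has_real_derivative_along_line gu U\<close>)
  then obtain t where t: "0 < t" "t < h" and "dir_deriv u g ((p + s *\<^sub>R u) + h *\<^sub>R v)
      - dir_deriv u g ((p + s *\<^sub>R u) + 0 *\<^sub>R v)
      = h * dir_deriv v (dir_deriv u g) ((p + s *\<^sub>R u) + t *\<^sub>R v)"
    by auto
  then have "F h - F 0 = h\<^sup>2 * dir_deriv v (dir_deriv u g) (p + s *\<^sub>R u + t *\<^sub>R v)"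
    using Fs by (simp add: power2_eq_square)
  then show ?thesis
    using s t that[of s t] by (simp add: F_def algebra_simps)
qed

lemma dir_deriv_commute_real:
  fixes g :: "'a::real_normed_vector \<Rightarrow> real"
  assumes "smooth_near p g"
  shows "dir_deriv v (dir_deriv u g) p = dir_deriv u (dir_deriv v g) p"
proof (rule ccontr)
  assume ne: "\<not> ?thesis"
  let ?A = "dir_deriv v (dir_deriv u g)" and ?B = "dir_deriv u (dir_deriv v g)"
  define e where "e = dist (?A p) (?B p) / 2"
  have e: "e > 0" using ne by (simp add: e_def)
  have cont: "isCont ?A p" "isCont ?B p"
    using assms by (auto intro!: smooth_near_continuous)
  have "\<forall>\<^sub>F x in nhds p. dist (?A x) (?A p) < e \<and> dist (?B x) (?B p) < e \<and> smooth_near x g"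
    using cont[unfolded continuous_at] e smooth_near_eventually[OF assms]
    by (auto intro!: eventually_conj tendstoD simp: tendsto_nhds_iff isCont_def)
  then obtain r where r: "r > 0" "\<And>x. dist x p < r \<Longrightarrow>
      dist (?A x) (?A p) < e \<and> dist (?B x) (?B p) < e \<and> smooth_near x g"
    unfolding eventually_nhds_metric by blast
  define N where "N = norm u + norm v + 1"
  have N: "N > 0" by (simp add: N_def add_nonneg_pos)
  \<comment> \<open>The parallelogram with sides \<open>h u\<close> and \<open>h v\<close> fits into the ball of radius \<open>r\<close>.\<close>
  define h where "h = r / (2 * N)"
  have h: "h > 0" using r(1) N by (simp add: h_def)
  have close: "dist (p + s *\<^sub>R u + t *\<^sub>R v) p < r" if "0 \<le> s" "s \<le> h" "0 \<le> t" "t \<le> h" for s t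
  proof -
    have "norm (s *\<^sub>R u + t *\<^sub>R v) \<le> s * norm u + t * norm v"
      using that by (metis abs_of_nonneg norm_scaleR norm_triangle_ineq)
    also have "\<dots> \<le> h * norm u + h * norm v"
      using that by (intro add_mono mult_right_mono) auto
    also have "\<dots> < 2 * h * (norm u + norm v + 1)"
    proof -
      have "0 \<le> h * norm u" "0 \<le> h * norm v" using h by auto
      moreover have "a + b < 2 * (a + b + h)" if "0 \<le> a" "0 \<le> b" for a b :: real
        using add_nonneg_nonneg[OF that] h by (simp add: distrib_left)
      ultimately have "h * norm u + h * norm v < 2 * (h * norm u + h * norm v + h)" by blast
      then show ?thesis by (simp only: distrib_left mult.assoc mult_1_right)
    qed
    also have "\<dots> = r" using N by (simp add: h_def N_def[symmetric])
    finally show ?thesis by (simp add: dist_norm algebra_simps)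
  qed
  have close': "dist (p + s *\<^sub>R v + t *\<^sub>R u) p < r" if "0 \<le> s" "s \<le> h" "0 \<le> t" "t \<le> h" for s t
    using close[of t s] that by (simp add: add.assoc add.commute[of "s *\<^sub>R v"])
  have sm: "smooth_near x g" if "x \<in> ball p r" for x
    using that r(2) by (simp add: dist_commute)
  obtain s t where st: "0 < s" "s < h" "0 < t" "t < h"
    "g (p + h *\<^sub>R u + h *\<^sub>R v) - g (p + h *\<^sub>R u) - g (p + h *\<^sub>R v) + g p
       = h\<^sup>2 * ?A (p + s *\<^sub>R u + t *\<^sub>R v)"
    by (rule second_difference[of h "ball p r" g u p v])
      (use h close sm in \<open>auto simp: dist_commute intro!: smooth_near_differentiable\<close>)
  obtain s' t' where st': "0 < s'" "s' < h" "0 < t'" "t' < h"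
    "g (p + h *\<^sub>R v + h *\<^sub>R u) - g (p + h *\<^sub>R v) - g (p + h *\<^sub>R u) + g p
       = h\<^sup>2 * ?B (p + s' *\<^sub>R v + t' *\<^sub>R u)"
    by (rule second_difference[of h "ball p r" g v p u])
      (use h close' sm in \<open>auto simp: dist_commute intro!: smooth_near_differentiable\<close>)
  have "h\<^sup>2 * ?A (p + s *\<^sub>R u + t *\<^sub>R v) = h\<^sup>2 * ?B (p + t' *\<^sub>R u + s' *\<^sub>R v)"
    using st(5) st'(5) by (simp add: algebra_simps)
  then have eq: "?A (p + s *\<^sub>R u + t *\<^sub>R v) = ?B (p + t' *\<^sub>R u + s' *\<^sub>R v)"
    using h by simp
  have "dist (?A (p + s *\<^sub>R u + t *\<^sub>R v)) (?A p) < e" "dist (?B (p + t' *\<^sub>R u + s' *\<^sub>R v)) (?B p) < e"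
    using r(2)[OF close, of s t] r(2)[OF close, of t' s'] st st' by auto
  then show False
    using eq dist_triangle_half_r[of "?A (p + s *\<^sub>R u + t *\<^sub>R v)" "?A p" "2 * e" "?B p"]
    by (simp add: e_def)
qed

lemma dir_deriv_bounded_linear:
  assumes "bounded_linear L" "f differentiable (at x)"
  shows "dir_deriv v (\<lambda>x. L (f x)) x = L (dir_deriv v f x)"
  by (rule dir_deriv_eqI[OF bounded_linear.has_derivative[OF assms(1)]])
    (use assms(2) in \<open>simp add: frechet_derivative_works[symmetric]\<close>)

lemma dir_deriv_cong:
  "\<forall>\<^sub>F x in nhds p. f x = g x \<Longrightarrow> dir_deriv v f p = dir_deriv v g p"
  by (auto simp: eventually_nhds dest: frechet_derivative_cong_open)

lemma dir_deriv_commute_linear: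
  fixes f :: "'a::real_normed_vector \<Rightarrow> complex"
  assumes "smooth_near p f" "bounded_linear (L :: complex \<Rightarrow> real)"
  shows "L (dir_deriv v (dir_deriv u f) p) = L (dir_deriv u (dir_deriv v f) p)"
proof -
  have *: "L (dir_deriv v (dir_deriv u f) p) = dir_deriv v (dir_deriv u (\<lambda>x. L (f x))) p" for u v
  proof -
    have "L (dir_deriv v (dir_deriv u f) p) = dir_deriv v (\<lambda>x. L (dir_deriv u f x)) p"
      using assms by (intro dir_deriv_bounded_linear[symmetric]) (auto intro: smooth_near_differentiable)
    also have "\<dots> = dir_deriv v (dir_deriv u (\<lambda>x. L (f x))) p"
    proof (rule dir_deriv_cong)
      show "\<forall>\<^sub>F x in nhds p. L (dir_deriv u f x) = dir_deriv u (\<lambda>x. L (f x)) x"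
        using smooth_near_eventually[OF assms(1)]
        by eventually_elim (simp add: dir_deriv_bounded_linear assms smooth_near_differentiable)
    qed
    finally show ?thesis .
  qed
  show ?thesis
    using dir_deriv_commute_real[OF smooth_near_bounded_linear[OF assms(2,1)], of v u]
    by (simp only: *[of v u] *[of u v])
qed

lemma dir_deriv_commute:
  fixes f :: "'a::real_normed_vector \<Rightarrow> complex"
  assumes "smooth_near p f"
  shows "dir_deriv v (dir_deriv u f) p = dir_deriv u (dir_deriv v f) p"
  using dir_deriv_commute_linear[OF assms bounded_linear_Re]
    dir_deriv_commute_linear[OF assms bounded_linear_Im] complex_eqI by metis

section \<open>Wirtinger derivatives and vector fields\<close>

text \<open>
  The derivatives \<open>\<partial>/\<partial>Z\<^sub>k\<close> and \<open>\<partial>/\<partial>Zbar\<^sub>k\<close> have the indices \<open>(k, True)\<close> and \<open>(k, False)\<close>, so that a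
  vector field is a single sum over all its coordinates.
\<close>

definition wirtinger :: "'N::finite \<times> bool \<Rightarrow> (complex^'N \<Rightarrow> complex) \<Rightarrow> complex^'N \<Rightarrow> complex" where
  "wirtinger \<kappa> f p = (dir_deriv (axis (fst \<kappa>) 1) f p
     + (if snd \<kappa> then - \<i> else \<i>) * dir_deriv (axis (fst \<kappa>) \<i>) f p) / 2"

definition coord :: "'N::finite cvector \<Rightarrow> 'N \<times> bool \<Rightarrow> complex" where
  "coord \<xi> \<kappa> = (if snd \<kappa> then fst \<xi> $ fst \<kappa> else snd \<xi> $ fst \<kappa>)"

lemma dZ_wirtinger: "dZ k f p = wirtinger (k, True) f p"
  by (simp add: dZ_def wirtinger_def)

lemma dZbar_wirtinger: "dZbar k f p = wirtinger (k, False) f p"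
  by (simp add: dZbar_def wirtinger_def)

lemma vector_apply_coord:
  "vector_apply \<xi> f p = (\<Sum>\<kappa>\<in>UNIV. coord \<xi> \<kappa> * wirtinger \<kappa> f p)"
proof -
  have "(\<Sum>\<kappa>\<in>UNIV. coord \<xi> \<kappa> * wirtinger \<kappa> f p) =
      (\<Sum>k\<in>UNIV. \<Sum>b\<in>UNIV. coord \<xi> (k, b) * wirtinger (k, b) f p)"
    by (simp add: sum.cartesian_product UNIV_Times_UNIV[symmetric] split_def del: UNIV_Times_UNIV)
  then show ?thesis
    by (simp add: vector_apply_def UNIV_bool coord_def dZ_wirtinger dZbar_wirtinger add.commute)
qed

lemma wirtinger_cong:
  "\<forall>\<^sub>F x in nhds p. f x = g x \<Longrightarrow> wirtinger \<kappa> f p = wirtinger \<kappa> g p"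
  by (simp add: wirtinger_def dir_deriv_cong[of f g])

lemma smooth_near_wirtinger [intro]: "smooth_near p f \<Longrightarrow> smooth_near p (wirtinger \<kappa> f)"
  unfolding wirtinger_def divide_inverse
  by (intro smooth_near_mult smooth_near_add smooth_near_const smooth_near_frechet)

lemma dir_deriv_add:
  "f differentiable (at x) \<Longrightarrow> g differentiable (at x) \<Longrightarrow>
   dir_deriv v (\<lambda>x. f x + g x) x = dir_deriv v f x + dir_deriv v g x"
  by (rule dir_deriv_eqI) (auto intro!: has_derivative_add simp: frechet_derivative_works[symmetric])

lemma dir_deriv_mult:
  fixes f g :: "'a::real_normed_vector \<Rightarrow> 'b::real_normed_algebra"
  shows "f differentiable (at x) \<Longrightarrow> g differentiable (at x) \<Longrightarrow>
   dir_deriv v (\<lambda>x. f x * g x) x = f x * dir_deriv v g x + dir_deriv v f x * g x"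
  by (rule dir_deriv_eqI) (auto intro!: has_derivative_mult simp: frechet_derivative_works[symmetric])

lemma wirtinger_add:
  "f differentiable (at x) \<Longrightarrow> g differentiable (at x) \<Longrightarrow>
   wirtinger \<kappa> (\<lambda>x. f x + g x) x = wirtinger \<kappa> f x + wirtinger \<kappa> g x"
  by (simp add: wirtinger_def dir_deriv_add algebra_simps add_divide_distrib)

lemma wirtinger_mult:
  "f differentiable (at x) \<Longrightarrow> g differentiable (at x) \<Longrightarrow>
   wirtinger \<kappa> (\<lambda>x. f x * g x) x = f x * wirtinger \<kappa> g x + wirtinger \<kappa> f x * g x"
  by (simp add: wirtinger_def dir_deriv_mult algebra_simps add_divide_distrib diff_divide_distrib)

lemma wirtinger_const [simp]: "wirtinger \<kappa> (\<lambda>x. c) x = 0"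
  by (simp add: wirtinger_def)

lemma wirtinger_commute:
  assumes "smooth_near p f"
  shows "wirtinger \<kappa> (wirtinger \<mu> f) p = wirtinger \<mu> (wirtinger \<kappa> f) p"
proof -
  have *: "dir_deriv v (wirtinger \<mu> f) p = (dir_deriv v (dir_deriv (axis (fst \<mu>) 1) f) p
     + (if snd \<mu> then - \<i> else \<i>) * dir_deriv v (dir_deriv (axis (fst \<mu>) \<i>) f) p) / 2" for v \<mu>
  proof -
    have d: "dir_deriv u f differentiable (at p)" for u
      using assms by (auto intro: smooth_near_differentiable)
    show ?thesis
      unfolding wirtinger_def divide_inverse
      by (subst dir_deriv_mult dir_deriv_add | simp add: d dir_deriv_mult dir_deriv_add)+
  qed
  show ?thesis
    unfolding wirtinger_def[of _ "wirtinger _ _"] *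
    using dir_deriv_commute[OF assms]
    by (simp add: field_simps)
qed

lemma dir_deriv_wirtinger:
  fixes f :: "complex^'N::finite \<Rightarrow> complex"
  assumes "f differentiable (at p)"
  shows "dir_deriv v f p = (\<Sum>k\<in>UNIV. v $ k * dZ k f p + cnj (v $ k) * dZbar k f p)"
proof -
  have lin: "linear (frechet_derivative f (at p))"
    using assms linear_frechet_derivative by blast
  have v: "v = (\<Sum>k\<in>UNIV. Re (v $ k) *\<^sub>R axis k 1 + Im (v $ k) *\<^sub>R axis k \<i>)"
    by (simp add: vec_eq_iff axis_def if_distrib cong: if_cong) (simp add: complex_eq_iff)
  have "dir_deriv v f p = (\<Sum>k\<in>UNIV. of_real (Re (v $ k)) * dir_deriv (axis k 1) f p
      + of_real (Im (v $ k)) * dir_deriv (axis k \<i>) f p)"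
    by (subst v)
      (simp only: linear_sum[OF lin] linear_add[OF lin] linear_scale[OF lin] scaleR_conv_of_real[where 'a=complex])
  also have "\<dots> = (\<Sum>k\<in>UNIV. v $ k * dZ k f p + cnj (v $ k) * dZbar k f p)"
  proof (rule sum.cong[OF refl])
    fix k
    have gen: "of_real a * A + of_real b * B
        = (of_real a + \<i> * of_real b) * ((A - \<i> * B) / 2)
          + (of_real a - \<i> * of_real b) * ((A + \<i> * B) / 2)" for a b and A B :: complex
      by (simp add: field_simps)
    have *: "of_real (Re z) + \<i> * of_real (Im z) = z" "of_real (Re z) - \<i> * of_real (Im z) = cnj z" for z
      by (simp_all add: complex_eq_iff)
    show "of_real (Re (v $ k)) * dir_deriv (axis k 1) f p
      + of_real (Im (v $ k)) * dir_deriv (axis k \<i>) f p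
      = v $ k * dZ k f p + cnj (v $ k) * dZbar k f p"
      unfolding dZ_def dZbar_def by (subst gen) (simp only: *)
  qed
  finally show ?thesis .
qed

lemma vector_apply_cong:
  "\<forall>\<^sub>F x in nhds p. f x = g x \<Longrightarrow> vector_apply \<xi> f p = vector_apply \<xi> g p"
  by (simp add: vector_apply_coord wirtinger_cong[of f g])

lemma vector_apply_add:
  "f differentiable (at p) \<Longrightarrow> g differentiable (at p) \<Longrightarrow>
   vector_apply \<xi> (\<lambda>x. f x + g x) p = vector_apply \<xi> f p + vector_apply \<xi> g p"
  by (simp add: vector_apply_coord wirtinger_add algebra_simps sum.distrib)

lemma vector_apply_mult:
  "f differentiable (at p) \<Longrightarrow> g differentiable (at p) \<Longrightarrow>
   vector_apply \<xi> (\<lambda>x. f x * g x) p = f p * vector_apply \<xi> g p + vector_apply \<xi> f p * g p"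
  by (simp add: vector_apply_coord wirtinger_mult algebra_simps sum.distrib sum_distrib_left)

lemma vector_apply_const [simp]: "vector_apply \<xi> (\<lambda>x. c) p = 0"
  by (simp add: vector_apply_coord)

lemma vector_apply_sum:
  assumes "finite I" "\<And>i. i \<in> I \<Longrightarrow> f i differentiable (at p)"
  shows "vector_apply \<xi> (\<lambda>x. \<Sum>i\<in>I. f i x) p = (\<Sum>i\<in>I. vector_apply \<xi> (f i) p)"
  using assms by (induction I rule: finite_induct) (auto simp: vector_apply_add)

lemma vector_apply_power:
  assumes "f differentiable (at p)"
  shows "vector_apply \<xi> (\<lambda>x. f x ^ Suc m) p = of_nat (Suc m) * f p ^ m * vector_apply \<xi> f p"
proof (induction m)
  case (Suc m)
  have "(\<lambda>x. f x ^ Suc m) differentiable (at p)"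
    using assms by (rule differentiable_power)
  then have "vector_apply \<xi> (\<lambda>x. f x * f x ^ Suc m) p
      = f p * vector_apply \<xi> (\<lambda>x. f x ^ Suc m) p + vector_apply \<xi> f p * f p ^ Suc m"
    using assms by (intro vector_apply_mult)
  then show ?case using Suc by (simp add: algebra_simps)
qed simp

lemma coord_add: "coord (\<xi> + \<eta>) \<kappa> = coord \<xi> \<kappa> + coord \<eta> \<kappa>"
  by (simp add: coord_def)

lemma coord_cscale: "coord (cscale c \<xi>) \<kappa> = c * coord \<xi> \<kappa>"
  by (simp add: coord_def cscale_def)

lemma bounded_linear_coord: "bounded_linear (\<lambda>\<xi>. coord \<xi> \<kappa>)"
  unfolding coord_def
  by (cases "snd \<kappa>")
    (auto intro!: bounded_linear_compose[OF bounded_linear_vec_nth] bounded_linear_fst bounded_linear_snd)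

definition smooth_field_near :: "complex^'N::finite \<Rightarrow> 'N cfield \<Rightarrow> bool" where
  "smooth_field_near p X \<longleftrightarrow> (\<forall>\<kappa>. smooth_near p (\<lambda>z. coord (X z) \<kappa>))"

lemma smooth_near_imp_field: "smooth_near p X \<Longrightarrow> smooth_field_near p X"
  unfolding smooth_field_near_def by (blast intro: smooth_near_bounded_linear[OF bounded_linear_coord])

lemma smooth_near_field_apply [intro]:
  assumes "smooth_field_near p X" "smooth_near p f"
  shows "smooth_near p (field_apply X f)"
proof -
  have "field_apply X f = (\<lambda>p. \<Sum>\<kappa>\<in>UNIV. coord (X p) \<kappa> * wirtinger \<kappa> f p)"
    by (simp add: fun_eq_iff field_apply_def vector_apply_coord)
  then show ?thesis
    using assms by (auto simp: smooth_field_near_def intro!: smooth_near_sum smooth_near_mult)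
qed

lemma coord_lie_bracket:
  "coord (lie_bracket X Y p) \<kappa> =
     field_apply X (\<lambda>z. coord (Y z) \<kappa>) p - field_apply Y (\<lambda>z. coord (X z) \<kappa>) p"
  by (simp add: coord_def lie_bracket_def field_apply_vec_def)

lemma smooth_field_near_lie_bracket:
  "smooth_field_near p X \<Longrightarrow> smooth_field_near p Y \<Longrightarrow> smooth_field_near p (lie_bracket X Y)"
  unfolding smooth_field_near_def[of _ "lie_bracket X Y"] coord_lie_bracket
  by (auto intro!: smooth_near_diff smooth_near_field_apply simp: smooth_field_near_def)

text \<open>
  Expanding \<open>X (Y f)\<close> and \<open>Y (X f)\<close> by the product rule, the second order terms agree because the
  Wirtinger derivatives commute; what remains is the bracket.
\<close>

lemma field_apply_lie_bracket_at:
  assumes X: "smooth_field_near p X" and Y: "smooth_field_near p Y" and f: "smooth_near p f"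
  shows "field_apply (lie_bracket X Y) f p
    = field_apply X (field_apply Y f) p - field_apply Y (field_apply X f) p"
proof -
  have *: "field_apply X (field_apply Y f) p =
      (\<Sum>\<mu>\<in>UNIV. field_apply X (\<lambda>z. coord (Y z) \<mu>) p * wirtinger \<mu> f p)
      + (\<Sum>\<kappa>\<in>UNIV. \<Sum>\<mu>\<in>UNIV. coord (X p) \<kappa> * coord (Y p) \<mu> * wirtinger \<kappa> (wirtinger \<mu> f) p)"
    if X: "smooth_field_near p X" and Y: "smooth_field_near p Y" for X Y
  proof -
    have "field_apply X (field_apply Y f) p
        = vector_apply (X p) (\<lambda>z. \<Sum>\<mu>\<in>UNIV. coord (Y z) \<mu> * wirtinger \<mu> f z) p"
    proof -
      have "field_apply Y f = (\<lambda>z. \<Sum>\<mu>\<in>UNIV. coord (Y z) \<mu> * wirtinger \<mu> f z)"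
        by (simp add: fun_eq_iff field_apply_def vector_apply_coord)
      then show ?thesis by (simp add: field_apply_def)
    qed
    also have "\<dots> = (\<Sum>\<mu>\<in>UNIV. vector_apply (X p) (\<lambda>z. coord (Y z) \<mu> * wirtinger \<mu> f z) p)"
      using Y f
      by (intro vector_apply_sum)
        (auto simp: smooth_field_near_def intro!: smooth_near_differentiable smooth_near_mult)
    also have "\<dots> = (\<Sum>\<mu>\<in>UNIV. coord (Y p) \<mu> * vector_apply (X p) (wirtinger \<mu> f) p
        + vector_apply (X p) (\<lambda>z. coord (Y z) \<mu>) p * wirtinger \<mu> f p)"
      using Y f
      by (intro sum.cong refl vector_apply_mult)
        (auto simp: smooth_field_near_def intro!: smooth_near_differentiable)
    also have "\<dots> = (\<Sum>\<mu>\<in>UNIV. vector_apply (X p) (\<lambda>z. coord (Y z) \<mu>) p * wirtinger \<mu> f p)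
        + (\<Sum>\<mu>\<in>UNIV. coord (Y p) \<mu> * (\<Sum>\<kappa>\<in>UNIV. coord (X p) \<kappa> * wirtinger \<kappa> (wirtinger \<mu> f) p))"
      by (simp add: sum.distrib add.commute vector_apply_coord[of _ "wirtinger _ f"])
    also have "(\<Sum>\<mu>\<in>UNIV. coord (Y p) \<mu> * (\<Sum>\<kappa>\<in>UNIV. coord (X p) \<kappa> * wirtinger \<kappa> (wirtinger \<mu> f) p))
        = (\<Sum>\<kappa>\<in>UNIV. \<Sum>\<mu>\<in>UNIV. coord (X p) \<kappa> * coord (Y p) \<mu> * wirtinger \<kappa> (wirtinger \<mu> f) p)"
      by (subst sum.swap) (simp add: sum_distrib_left mult_ac)
    finally show ?thesis by (simp only: field_apply_def[of X])
  qed
  have "(\<Sum>\<kappa>\<in>UNIV. \<Sum>\<mu>\<in>UNIV. coord (Y p) \<kappa> * coord (X p) \<mu> * wirtinger \<kappa> (wirtinger \<mu> f) p)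
      = (\<Sum>\<kappa>\<in>UNIV. \<Sum>\<mu>\<in>UNIV. coord (X p) \<kappa> * coord (Y p) \<mu> * wirtinger \<kappa> (wirtinger \<mu> f) p)"
    by (subst sum.swap) (simp add: wirtinger_commute[OF f] mult.commute)
  then have "field_apply X (field_apply Y f) p - field_apply Y (field_apply X f) p
      = (\<Sum>\<mu>\<in>UNIV. coord (lie_bracket X Y p) \<mu> * wirtinger \<mu> f p)"
    unfolding *[OF X Y] *[OF Y X] coord_lie_bracket
    by (simp add: left_diff_distrib sum_subtractf)
  then show ?thesis
    by (simp add: field_apply_def vector_apply_coord)
qed

section \<open>Holomorphic functions of several variables\<close>

text \<open>
  Complex differentiability at every point, stated through the Cauchy-Riemann equations so that
  the product rule for Wirtinger derivatives yields the algebraic closure properties.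
\<close>

definition holo_on :: "(complex^'N::finite) set \<Rightarrow> (complex^'N \<Rightarrow> complex) \<Rightarrow> bool" where
  "holo_on U f \<longleftrightarrow> (\<forall>z\<in>U. f differentiable (at z) \<and> (\<forall>k. dZbar k f z = 0))"

lemma holo_on_subset: "holo_on U f \<Longrightarrow> V \<subseteq> U \<Longrightarrow> holo_on V f"
  unfolding holo_on_def by blast

lemma holo_on_has_derivative:
  assumes "holo_on U f" "z \<in> U"
  shows "(f has_derivative (\<lambda>v. \<Sum>k\<in>UNIV. v $ k * dZ k f z)) (at z)"
proof -
  have "(f has_derivative frechet_derivative f (at z)) (at z)"
    using assms frechet_derivative_works holo_on_def by blast
  moreover have "frechet_derivative f (at z) = (\<lambda>v. \<Sum>k\<in>UNIV. v $ k * dZ k f z)"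
    using assms by (simp add: fun_eq_iff holo_on_def dir_deriv_wirtinger)
  ultimately show ?thesis by simp
qed

lemma
  assumes "(f has_derivative (\<lambda>v. \<Sum>k\<in>UNIV. v $ k * a k)) (at z)"
  shows dZ_eqI: "dZ k f z = a k" and dZbar_eqI: "dZbar k f z = 0"
proof -
  have *: "dir_deriv (axis k c) f z = c * a k" for c
    using dir_deriv_eqI[OF assms, of "axis k c"]
    by (simp add: axis_def if_distrib[of "\<lambda>x. x * _"] cong: if_cong)
  show "dZ k f z = a k" "dZbar k f z = 0"
    unfolding dZ_def dZbar_def * by (simp_all add: field_simps)
qed

lemma holo_onI:
  assumes "\<And>z. z \<in> U \<Longrightarrow> \<exists>a. (f has_derivative (\<lambda>v. \<Sum>k\<in>UNIV. v $ k * a k)) (at z)"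
  shows "holo_on U f"
  unfolding holo_on_def using assms by (blast intro: differentiableI dZbar_eqI)

lemma holo_on_continuous_on:
  "holo_on U f \<Longrightarrow> continuous_on U f"
  unfolding holo_on_def
  by (meson continuous_at_imp_continuous_on differentiable_imp_continuous_within)

lemma continuous_on_line:
  "continuous_on S (\<lambda>x. g x) \<Longrightarrow> continuous_on S (\<lambda>x. g x *s (v :: complex^'N::finite))"
  unfolding vector_scalar_mult_def by (intro continuous_intros)

lemma norm_smult_axis: "norm (c *s axis k 1 :: complex^'N::finite) = norm c"
proof -
  have "c *s axis k 1 = (axis k c :: complex^'N)"
    by (simp add: vec_eq_iff axis_def)
  moreover have "(\<Sum>i\<in>UNIV. (norm ((axis k c :: complex^'N) $ i))\<^sup>2) = (norm c)\<^sup>2"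
    by (simp add: axis_def if_distrib[where f=norm] if_distrib[where f="\<lambda>x. x\<^sup>2"] cong: if_cong)
  ultimately show ?thesis
    by (simp add: norm_vec_def L2_set_def)
qed

lemma bounded_linear_smult_left: "bounded_linear (\<lambda>t. t *s (v :: complex^'N::finite))"
  unfolding linear_conv_bounded_linear[symmetric]
  by (rule linearI) (simp_all add: vec_eq_iff algebra_simps)

lemma bounded_linear_axis: "bounded_linear (axis i :: complex \<Rightarrow> complex^'N::finite)"
  unfolding linear_conv_bounded_linear[symmetric]
  by (rule linearI) (simp_all add: vec_eq_iff axis_def)

lemma sum_axis: "(\<Sum>i\<in>UNIV. axis i (w $ i)) = (w :: complex^'N::finite)"
  by (simp add: vec_eq_iff axis_def if_distrib cong: if_cong)

lemma complex_line_has_derivative: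
  "((\<lambda>\<zeta>. z + \<zeta> *s v) has_derivative (\<lambda>h. h *s (v :: complex^'N::finite))) (at \<zeta>)"
  using has_derivative_add[OF has_derivative_const
      bounded_linear_imp_has_derivative[OF bounded_linear_smult_left], of z] by simp

lemma holo_on_curve:
  assumes "holo_on U f" "\<gamma> \<zeta> \<in> U" "(\<gamma> has_derivative (\<lambda>h. h *s v)) (at \<zeta>)"
  shows "((\<lambda>\<zeta>. f (\<gamma> \<zeta>)) has_field_derivative (\<Sum>k\<in>UNIV. v $ k * dZ k f (\<gamma> \<zeta>))) (at \<zeta>)"
proof -
  have "((\<lambda>\<zeta>. f (\<gamma> \<zeta>)) has_derivative (\<lambda>h. \<Sum>k\<in>UNIV. (h *s v) $ k * dZ k f (\<gamma> \<zeta>))) (at \<zeta>)"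
    by (rule has_derivative_compose[OF assms(3) holo_on_has_derivative[OF assms(1,2)]])
  moreover have "(\<lambda>h. \<Sum>k\<in>UNIV. (h *s v) $ k * dZ k f (\<gamma> \<zeta>))
      = (*) (\<Sum>k\<in>UNIV. v $ k * dZ k f (\<gamma> \<zeta>))"
    by (simp add: fun_eq_iff sum_distrib_right sum_distrib_left mult_ac)
  ultimately show ?thesis by (simp add: has_field_derivative_def)
qed

lemmas holo_on_line = holo_on_curve[OF _ _ complex_line_has_derivative]

text \<open>
  The integral formula for the derivative in one variable, on the circle of radius \<open>r\<close> in the
  direction of the \<open>k\<close>-th coordinate, parametrized by the unit interval.
\<close>

lemma Cauchy_formula_dZ:
  fixes f :: "complex^'N::finite \<Rightarrow> complex"
  assumes "holo_on (ball z R) f" "0 < r" "r < R"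
  shows "dZ k f z = integral {0..1} (\<lambda>t. f (z + (of_real r * exp (2 * of_real pi * \<i> * of_real t)) *s axis k 1)
           * (exp (- (2 * of_real pi * \<i> * of_real t)) / of_real r))"
proof -
  define g where "g = (\<lambda>\<zeta>. f (z + \<zeta> *s axis k 1))"
  have inb: "z + \<zeta> *s axis k 1 \<in> ball z R" if "norm \<zeta> < R" for \<zeta>
    using that by (simp add: dist_norm norm_smult_axis)
  have g': "(g has_field_derivative dZ k f (z + \<zeta> *s axis k 1)) (at \<zeta>)" if "norm \<zeta> < R" for \<zeta>
    using holo_on_line[OF assms(1) inb[OF that]] unfolding g_def
    by (simp add: axis_def if_distrib[of "\<lambda>x. x * _"] cong: if_cong)
  then have hol: "g holomorphic_on ball 0 R"
    by (auto simp: holomorphic_on_open intro!: exI g')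
  have "2 * of_real pi * \<i> * deriv g 0 = contour_integral (circlepath 0 r) (\<lambda>u. g u / (u - 0)^2)"
    using assms(2,3) Cauchy_contour_integral_circlepath_2[of 0 r g 0]
      holomorphic_on_imp_continuous_on[OF holomorphic_on_subset[OF hol, of "cball 0 r"]]
      holomorphic_on_subset[OF hol, of "ball 0 r"]
    by (simp add: subset_iff)
  also have "\<dots> = integral {0..1} (\<lambda>t. g (circlepath 0 r t) / (circlepath 0 r t)^2
      * vector_derivative (circlepath 0 r) (at t within {0..1}))"
    by (simp add: contour_integral_def integral_def has_contour_integral_def contour_integrable_on_def
        integrable_on_def)
  also have "\<dots> = integral {0..1} (\<lambda>t. (2 * of_real pi * \<i>) * (g (of_real r * exp (2 * of_real pi * \<i> * of_real t))
           * (exp (- (2 * of_real pi * \<i> * of_real t)) / of_real r)))"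
  proof (rule integral_cong)
    fix t :: real assume t: "t \<in> {0..1}"
    show "g (circlepath 0 r t) / (circlepath 0 r t)^2 * vector_derivative (circlepath 0 r) (at t within {0..1})
      = (2 * of_real pi * \<i>) * (g (of_real r * exp (2 * of_real pi * \<i> * of_real t))
           * (exp (- (2 * of_real pi * \<i> * of_real t)) / of_real r))"
      by (subst vector_derivative_circlepath01)
        (use t assms(2) in \<open>simp_all add: circlepath exp_minus field_simps power2_eq_square\<close>)
  qed
  also have "\<dots> = (2 * of_real pi * \<i>) * integral {0..1} (\<lambda>t. g (of_real r * exp (2 * of_real pi * \<i> * of_real t))
           * (exp (- (2 * of_real pi * \<i> * of_real t)) / of_real r))"
    by simp
  finally have "deriv g 0 = integral {0..1} (\<lambda>t. g (of_real r * exp (2 * of_real pi * \<i> * of_real t))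
           * (exp (- (2 * of_real pi * \<i> * of_real t)) / of_real r))"
    by (rule mult_left_cancel[THEN iffD1, rotated]) simp
  moreover have "deriv g 0 = dZ k f z"
    using g'[of 0] assms(2,3) by (simp add: DERIV_imp_deriv)
  ultimately show ?thesis by (simp add: g_def)
qed

text \<open>
  Cauchy's formula presents the partial derivatives as integrals of \<open>f\<close> depending on a parameter, so
  they are continuous. Therefore the integral may be differentiated under the integral sign, and its
  derivative is complex linear, since the derivative of the integrand is.
\<close>

lemma holo_on_dZ:
  fixes f :: "complex^'N::finite \<Rightarrow> complex"
  assumes "open U" "holo_on U f"
  shows "holo_on U (dZ k f)"
proof -
  define w where "w r t = (of_real r * exp (2 * of_real pi * \<i> * of_real t) :: complex)" for r t :: real
  define c where "c r t = (exp (- (2 * of_real pi * \<i> * of_real t)) / of_real r :: complex)" for r t :: real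
  have nw: "norm (w r t) = r" if "r > 0" for r t
    using that by (simp add: w_def norm_mult norm_exp_eq_Re)
  have cont_w: "continuous_on S (\<lambda>x. w r (h x))" if "continuous_on S h" for S :: "'x::topological_space set" and r h
    unfolding w_def by (intro continuous_intros that)
  have cont_c: "continuous_on S (\<lambda>x. c r (h x))" if "continuous_on S h" "r > 0"
    for S :: "'x::topological_space set" and r h
    unfolding c_def using that(2) by (intro continuous_intros that) auto
  have near: "\<exists>r>0. \<forall>z\<in>ball z0 r. ball z (3 * r) \<subseteq> U \<and>
      (\<forall>t. \<forall>k. z + w r t *s axis k 1 \<in> U)" if z0: "z0 \<in> U" for z0
  proof -
    obtain e where e: "e > 0" "ball z0 e \<subseteq> U"
      using openE[OF assms(1) z0] by blast
    show ?thesis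
    proof (intro exI[of _ "e / 4"] conjI ballI allI)
      fix z t k assume z: "z \<in> ball z0 (e / 4)"
      then show sub: "ball z (3 * (e / 4)) \<subseteq> U"
      proof -
        have "dist z0 x < e" if "x \<in> ball z (3 * (e / 4))" for x
          using z that dist_triangle[of z0 x z] by (simp only: mem_ball)
        then show ?thesis using e(2) by auto
      qed
      have "z + w (e / 4) t *s axis k 1 \<in> ball z (3 * (e / 4))"
        using e(1) by (simp add: dist_norm norm_smult_axis nw)
      then show "z + w (e / 4) t *s axis k 1 \<in> U" using sub by (rule subsetD[rotated])
    qed (use e in auto)
  qed
  have formula: "dZ k f z = integral {0..1} (\<lambda>t. f (z + w r t *s axis k 1) * c r t)"
    if "ball z (3 * r) \<subseteq> U" "r > 0" for k z r
    using Cauchy_formula_dZ[OF holo_on_subset[OF assms(2) that(1)], of r k] that(2)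
    unfolding w_def c_def by simp
  have cont_on_prod: "continuous_on (S \<times> {0..1}) (\<lambda>(z, t). g (z + w r t *s axis k 1) * c r t)"
    if "continuous_on U g" "r > 0" "\<And>z t. z \<in> S \<Longrightarrow> z + w r t *s axis k 1 \<in> U" for g :: "complex^'N \<Rightarrow> complex" and S r k
    unfolding split_def
    by (intro continuous_on_mult continuous_on_compose2[OF that(1)] continuous_on_add continuous_on_line
        cont_w cont_c continuous_intros) (use that in auto)
  have integrable: "(\<lambda>t. g (z + w r t *s axis k 1) * c r t) integrable_on cbox 0 1"
    if "continuous_on U g" "r > 0" "\<And>t. z + w r t *s axis k 1 \<in> U"
    for g :: "complex^'N \<Rightarrow> complex" and z r k
  proof -
    have "continuous_on ({z} \<times> {0..1}) (\<lambda>(z, t). g (z + w r t *s axis k 1) * c r t)"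
      using that by (intro cont_on_prod) auto
    then have "continuous_on {0..1} (\<lambda>t. g (z + w r t *s axis k 1) * c r t)"
      by (rule continuous_on_compose2[of _ "\<lambda>(z, t). g (z + w r t *s axis k 1) * c r t" _ "\<lambda>t. (z, t)",
            unfolded prod.case]) (auto intro!: continuous_intros)
    then show ?thesis by (simp add: cbox_interval integrable_continuous_real)
  qed
  have cont: "continuous_on U (dZ j f)" for j
  proof (rule continuous_at_imp_continuous_on, rule ballI)
    fix z0 assume "z0 \<in> U"
    then obtain r where r: "r > 0" "\<And>z. z \<in> ball z0 r \<Longrightarrow> ball z (3 * r) \<subseteq> U"
      "\<And>z t k. z \<in> ball z0 r \<Longrightarrow> z + w r t *s axis k 1 \<in> U"
      using near by blast
    have "continuous_on (ball z0 r) (\<lambda>z. integral (cbox 0 1) (\<lambda>t. f (z + w r t *s axis j 1) * c r t))"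
      unfolding cbox_interval[symmetric, where 'a=real]
      by (intro integral_continuous_on_param)
        (simp only: cbox_interval cont_on_prod[OF holo_on_continuous_on[OF assms(2)] r(1) r(3)])
    then have "continuous_on (ball z0 r) (dZ j f)"
      by (rule continuous_on_eq) (simp only: cbox_interval formula[OF r(2) r(1)])
    then show "isCont (dZ j f) z0"
      by (rule continuous_on_interior) (use r(1) in simp)
  qed
  show ?thesis
  proof (rule holo_onI)
    fix z0 assume z0: "z0 \<in> U"
    then obtain r where r: "r > 0" "\<And>z. z \<in> ball z0 r \<Longrightarrow> ball z (3 * r) \<subseteq> U"
      "\<And>z t k. z \<in> ball z0 r \<Longrightarrow> z + w r t *s axis k 1 \<in> U"
      using near by blast
    define comp :: "'N \<Rightarrow> ((complex^'N) \<Rightarrow>\<^sub>L complex)" where "comp j = Blinfun (\<lambda>v. v $ j)" for j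
    have comp: "blinfun_apply (comp j) v = v $ j" for j v
      unfolding comp_def by (simp add: bounded_linear_Blinfun_apply bounded_linear_vec_nth)
    define F where "F z t = (\<Sum>j\<in>UNIV. blinfun_mult_right (dZ j f (z + w r t *s axis k 1) * c r t) o\<^sub>L comp j)" for z t
    have F: "blinfun_apply (F z t) v = (\<Sum>j\<in>UNIV. v $ j * (dZ j f (z + w r t *s axis k 1) * c r t))" for z t v
      by (simp add: F_def blinfun.sum_left comp mult_ac)
    then have F_fun: "blinfun_apply (F z t) = (\<lambda>v. \<Sum>j\<in>UNIV. v $ j * (dZ j f (z + w r t *s axis k 1) * c r t))" for z t
      by blast
    have contF: "continuous_on (ball z0 r \<times> cbox 0 1) (\<lambda>(z, t). F z t)"
      unfolding F_def split_def
      by (intro continuous_on_sum continuous_on_const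
          bounded_bilinear.continuous_on[OF bounded_bilinear_blinfun_compose]
          bounded_linear.continuous_on[OF bounded_linear_blinfun_mult_right])
        (simp only: cbox_interval cont_on_prod[OF cont r(1) r(3), unfolded split_def])
    have D: "((\<lambda>z. integral (cbox 0 1) (\<lambda>t. f (z + w r t *s axis k 1) * c r t)) has_derivative
        integral (cbox 0 1) (F z0)) (at z0 within ball z0 r)"
    proof (rule leibniz_rule[OF _ _ contF])
      fix z and t :: real assume z: "z \<in> ball z0 r" "t \<in> cbox 0 1"
      have "((\<lambda>z. f (z + w r t *s axis k 1)) has_derivative
          (\<lambda>v. \<Sum>j\<in>UNIV. v $ j * dZ j f (z + w r t *s axis k 1))) (at z)"
      proof -
        have "((\<lambda>z. z + w r t *s axis k 1) has_derivative (\<lambda>v. v)) (at z)"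
          by (auto intro!: derivative_eq_intros)
        from has_derivative_compose[OF this holo_on_has_derivative[OF assms(2) r(3)[OF z(1)]]]
        show ?thesis .
      qed
      from has_derivative_mult_left[OF this, of "c r t"]
      have "((\<lambda>z. f (z + w r t *s axis k 1) * c r t) has_derivative blinfun_apply (F z t)) (at z)"
        by (simp only: F_fun sum_distrib_right mult.assoc)
      then show "((\<lambda>z. f (z + w r t *s axis k 1) * c r t) has_derivative blinfun_apply (F z t))
          (at z within ball z0 r)"
        by (rule has_derivative_at_withinI)
    next
      fix z assume z: "z \<in> ball z0 r"
      show "(\<lambda>t. f (z + w r t *s axis k 1) * c r t) integrable_on cbox 0 1"
        by (rule integrable[OF holo_on_continuous_on[OF assms(2)] r(1) r(3)[OF z]])
    qed (use r(1) in auto)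
    have intF: "F z0 integrable_on cbox 0 1"
    proof -
      have "continuous_on (cbox 0 1) (F z0)"
        by (rule continuous_on_compose2[OF contF, of _ "\<lambda>t. (z0, t)", unfolded prod.case])
          (use r(1) in \<open>auto intro!: continuous_intros\<close>)
      then show ?thesis by (rule integrable_continuous)
    qed
    have intj: "(\<lambda>t. dZ j f (z0 + w r t *s axis k 1) * c r t) integrable_on cbox 0 1" for j
      by (rule integrable[OF cont r(1) r(3)]) (use r(1) in simp)
    have "blinfun_apply (integral (cbox 0 1) (F z0)) v =
        (\<Sum>j\<in>UNIV. v $ j * integral (cbox 0 1) (\<lambda>t. dZ j f (z0 + w r t *s axis k 1) * c r t))" for v
      unfolding blinfun_apply_integral[OF intF] F
      by (subst integral_sum) (auto intro!: integrable_on_mult_right intj[unfolded cbox_interval])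
    then have eq: "blinfun_apply (integral (cbox 0 1) (F z0)) = (\<lambda>v.
        \<Sum>j\<in>UNIV. v $ j * integral (cbox 0 1) (\<lambda>t. dZ j f (z0 + w r t *s axis k 1) * c r t))"
      by blast
    have "(dZ k f has_derivative blinfun_apply (integral (cbox 0 1) (F z0))) (at z0 within ball z0 r)"
      by (rule has_derivative_transform_within[OF D zero_less_one])
        (use r(1) in \<open>simp_all only: cbox_interval formula[OF r(2) r(1)] centre_in_ball\<close>)
    moreover have "at z0 within ball z0 r = at z0"
      using r(1) by (intro at_within_open) auto
    ultimately have "(dZ k f has_derivative (\<lambda>v. \<Sum>j\<in>UNIV. v $ j *
        integral (cbox 0 1) (\<lambda>t. dZ j f (z0 + w r t *s axis k 1) * c r t))) (at z0)"
      by (simp only: eq)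
    then show "\<exists>a. (dZ k f has_derivative (\<lambda>v. \<Sum>j\<in>UNIV. v $ j * a j)) (at z0)"
      by (rule exI[of _ "\<lambda>j. integral (cbox 0 1) (\<lambda>t. dZ j f (z0 + w r t *s axis k 1) * c r t)"])
  qed
qed

lemma holo_on_differentiable_upto:
  assumes "open U" "holo_on U f"
  shows "differentiable_upto m U f"
  using assms(2)
proof (induction m arbitrary: f)
  case 0
  then show ?case by (simp add: holo_on_continuous_on)
next
  case (Suc m)
  have dk: "differentiable_upto m U (dZ k f)" for k
    by (rule Suc.IH[OF holo_on_dZ[OF assms(1) Suc.prems]])
  have dir: "dir_deriv v f x = (\<Sum>k\<in>UNIV. v $ k * dZ k f x)" if "x \<in> U" for v x
    using Suc.prems that by (simp add: dir_deriv_wirtinger holo_on_def)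
  have "differentiable_upto m U (\<lambda>x. dir_deriv v f x)" for v
    by (rule differentiable_upto_cong[OF assms(1), of "\<lambda>x. \<Sum>k\<in>UNIV. v $ k * dZ k f x"])
      (use Suc.prems in \<open>auto intro!: differentiable_upto_sum differentiable_upto_mult
        differentiable_upto_const dk assms(1) simp: dir\<close>)
  then show ?case using Suc.prems by (auto simp: holo_on_def)
qed

lemma holo_on_smooth_near: "open U \<Longrightarrow> holo_on U f \<Longrightarrow> p \<in> U \<Longrightarrow> smooth_near p f"
  unfolding smooth_near_def smooth_on_def using holo_on_differentiable_upto by blast

lemma holo_on_const [intro]: "holo_on U (\<lambda>z. c)"
  by (simp add: holo_on_def dZbar_wirtinger)

lemma holo_on_add [intro]: "holo_on U f \<Longrightarrow> holo_on U g \<Longrightarrow> holo_on U (\<lambda>z. f z + g z)"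
  by (auto simp: holo_on_def dZbar_wirtinger wirtinger_add)

lemma holo_on_mult [intro]: "holo_on U f \<Longrightarrow> holo_on U g \<Longrightarrow> holo_on U (\<lambda>z. f z * g z)"
  by (auto simp: holo_on_def dZbar_wirtinger wirtinger_mult)

lemma holo_on_sum [intro]:
  "finite I \<Longrightarrow> (\<And>i. i \<in> I \<Longrightarrow> holo_on U (f i)) \<Longrightarrow> holo_on U (\<lambda>z. \<Sum>i\<in>I. f i z)"
  by (induction I rule: finite_induct) auto

lemma holo_on_prod [intro]:
  "finite I \<Longrightarrow> (\<And>i. i \<in> I \<Longrightarrow> holo_on U (f i)) \<Longrightarrow> holo_on U (\<lambda>z. \<Prod>i\<in>I. f i z)"
  by (induction I rule: finite_induct) auto

lemma holo_on_det [intro]: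
  assumes "\<And>i j. holo_on U (\<lambda>z. A z $ i $ j)"
  shows "holo_on U (\<lambda>z. det (A z :: complex^'N::finite^'N))"
  unfolding det_def using assms by (auto intro!: holo_on_sum holo_on_mult holo_on_prod)

lemma has_derivative_component:
  fixes i :: "'N::finite"
  shows "((\<lambda>z. z $ i :: complex) has_derivative (\<lambda>v. \<Sum>k\<in>UNIV. v $ k * (if k = i then 1 else 0))) (at z)"
proof -
  have "(\<lambda>v :: complex^'N. \<Sum>k\<in>UNIV. v $ k * (if k = i then 1 else 0)) = (\<lambda>v. v $ i)"
    by (simp add: if_distrib cong: if_cong)
  then show ?thesis
    using bounded_linear_imp_has_derivative[OF bounded_linear_vec_nth] by metis
qed

lemma holo_on_component [intro]: "holo_on U (\<lambda>z. z $ i)"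
  by (rule holo_onI, rule exI, rule has_derivative_component)

lemma dZ_component: "dZ k (\<lambda>z. z $ i) z = (if k = i then 1 else 0)"
  by (rule dZ_eqI[OF has_derivative_component])

definition cjac :: "(complex^'N::finite \<Rightarrow> complex^'N) \<Rightarrow> complex^'N \<Rightarrow> complex^'N^'N" where
  "cjac F z = (\<chi> i k. dZ k (\<lambda>z. F z $ i) z)"

definition holo_map :: "(complex^'N::finite) set \<Rightarrow> (complex^'N \<Rightarrow> complex^'N) \<Rightarrow> bool" where
  "holo_map U F \<longleftrightarrow> (\<forall>i. holo_on U (\<lambda>z. F z $ i))"

lemma holo_map_has_derivative:
  assumes "holo_map U F" "z \<in> U"
  shows "(F has_derivative (\<lambda>v. cjac F z *v v)) (at z)"
proof -
  have "((\<lambda>z. \<Sum>i\<in>UNIV. axis i (F z $ i)) has_derivative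
      (\<lambda>v. \<Sum>i\<in>UNIV. axis i (\<Sum>k\<in>UNIV. v $ k * dZ k (\<lambda>z. F z $ i) z))) (at z)"
    using assms holo_on_has_derivative
    by (intro has_derivative_sum bounded_linear.has_derivative[OF bounded_linear_axis]) (auto simp: holo_map_def)
  moreover have "(\<Sum>i\<in>UNIV. axis i (\<Sum>k\<in>UNIV. v $ k * dZ k (\<lambda>z. F z $ i) z)) = cjac F z *v v" for v
    by (subst sum_axis[symmetric, of "cjac F z *v v"])
      (simp add: matrix_vector_mult_def cjac_def mult.commute)
  ultimately show ?thesis by (simp add: sum_axis)
qed

lemma has_derivative_matrix_component:
  fixes F :: "complex^'N::finite \<Rightarrow> complex^'N"
  assumes "(F has_derivative (\<lambda>v. A *v v)) (at z)"
  shows "((\<lambda>z. F z $ i) has_derivative (\<lambda>v. \<Sum>k\<in>UNIV. v $ k * A $ i $ k)) (at z)"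
proof -
  have "(\<lambda>v. (A *v v) $ i) = (\<lambda>v. \<Sum>k\<in>UNIV. v $ k * A $ i $ k)"
    by (simp add: fun_eq_iff matrix_vector_mult_def mult.commute)
  then show ?thesis
    using bounded_linear.has_derivative[OF bounded_linear_vec_nth[of i] assms] by simp
qed

lemma holomorphic_map_on_iff: "holomorphic_map_on U F \<longleftrightarrow> holo_map U F"
proof
  assume *: "holomorphic_map_on U F"
  show "holo_map U F"
    unfolding holo_map_def
  proof (intro allI holo_onI)
    fix i z assume "z \<in> U"
    then obtain A :: "complex^'a^'a" where "(F has_derivative (\<lambda>v. A *v v)) (at z)"
      using * holomorphic_map_on_def by blast
    then show "\<exists>a. ((\<lambda>z. F z $ i) has_derivative (\<lambda>v. \<Sum>k\<in>UNIV. v $ k * a k)) (at z)"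
      by (intro exI[of _ "\<lambda>k. A $ i $ k"]) (rule has_derivative_matrix_component)
  qed
next
  assume "holo_map U F"
  then show "holomorphic_map_on U F"
    unfolding holomorphic_map_on_def using holo_map_has_derivative by blast
qed

lemma holo_on_cjac:
  "open U \<Longrightarrow> holo_map U F \<Longrightarrow> holo_on U (\<lambda>z. cjac F z $ i $ k)"
  by (simp add: cjac_def holo_map_def holo_on_dZ)

section \<open>Inverse functions\<close>

lemma inverse_function_C1:
  fixes f :: "'a::euclidean_space \<Rightarrow> 'a"
  assumes "open U" "p \<in> U" and diff: "\<And>x. x \<in> U \<Longrightarrow> f differentiable (at x)"
    and cont: "\<And>v. continuous_on U (dir_deriv v f)"
    and inj: "inj (frechet_derivative f (at p))"
  obtains U' V g where "open U'" "U' \<subseteq> U" "p \<in> U'" "open V" "f p \<in> V" "f ` U' = V" "g ` V = U'"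
    "\<And>x. x \<in> U' \<Longrightarrow> g (f x) = x" "\<And>y. y \<in> V \<Longrightarrow> f (g y) = y"
    "\<And>y. y \<in> V \<Longrightarrow> (g has_derivative inv (frechet_derivative f (at (g y)))) (at y)"
    "\<And>y. y \<in> V \<Longrightarrow> bij (frechet_derivative f (at (g y)))"
proof -
  define f' where "f' x = Blinfun (frechet_derivative f (at x))" for x
  have f': "blinfun_apply (f' x) = frechet_derivative f (at x)" if "x \<in> U" for x
    unfolding f'_def
    by (rule bounded_linear_Blinfun_apply)
      (use diff[OF that] in \<open>simp add: frechet_derivative_works has_derivative_bounded_linear\<close>)
  have contf: "continuous_on U f'"
    by (rule continuous_on_blinfun_componentwise, rule continuous_on_eq[OF cont]) (simp add: f')
  have lin: "linear (frechet_derivative f (at p))"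
    using diff assms(2) linear_frechet_derivative by blast
  obtain h where h: "linear h" "h \<circ> frechet_derivative f (at p) = id"
    using linear_injective_left_inverse[OF lin inj] by blast
  have "Blinfun h o\<^sub>L f' p = id_blinfun"
  proof (rule blinfun_eqI)
    fix v
    have "blinfun_apply (Blinfun h) = h"
      using h(1) by (intro bounded_linear_Blinfun_apply) (simp add: linear_conv_bounded_linear)
    then show "blinfun_apply (Blinfun h o\<^sub>L f' p) v = blinfun_apply id_blinfun v"
      using f'[OF assms(2)] fun_cong[OF h(2), of v] by simp
  qed
  from inverse_function_theorem[OF assms(1) _ contf assms(2) this]
  obtain U' V g g' where *: "open U'" "U' \<subseteq> U" "p \<in> U'" "open V" "f p \<in> V" "homeomorphism U' V f g"
    "\<And>y. y \<in> V \<Longrightarrow> (g has_derivative (g' y)) (at y)"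
    "\<And>y. y \<in> V \<Longrightarrow> g' y = inv (blinfun_apply (f'(g y)))"
    "\<And>y. y \<in> V \<Longrightarrow> bij (blinfun_apply (f'(g y)))"
    using f' diff frechet_derivative_works by (metis (no_types, lifting))
  have gU: "g y \<in> U" if "y \<in> V" for y
    using *(2,6) that unfolding homeomorphism_def by blast
  show ?thesis
  proof (rule that[of U' V g])
    show "(g has_derivative inv (frechet_derivative f (at (g y)))) (at y)" if "y \<in> V" for y
      using *(7,8)[OF that] f'[OF gU[OF that]] by simp
    show "bij (frechet_derivative f (at (g y)))" if "y \<in> V" for y
      using *(9)[OF that] f'[OF gU[OF that]] by simp
  qed (use * in \<open>auto simp: homeomorphism_def\<close>)
qed

lemma frechet_holo_map:
  "holo_map U F \<Longrightarrow> z \<in> U \<Longrightarrow> frechet_derivative F (at z) = (\<lambda>v. cjac F z *v v)"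
  using holo_map_has_derivative frechet_derivative_at by metis

lemma inverse_function_holo_map:
  assumes "open U" "p \<in> U" "holo_map U F" "det (cjac F p) \<noteq> 0"
  obtains U' V G where "open U'" "U' \<subseteq> U" "p \<in> U'" "open V" "F p \<in> V" "F ` U' = V" "G ` V = U'"
    "\<And>x. x \<in> U' \<Longrightarrow> G (F x) = x" "\<And>y. y \<in> V \<Longrightarrow> F (G y) = y"
    "\<And>y. y \<in> V \<Longrightarrow> \<exists>B. cjac F (G y) ** B = mat 1 \<and> (G has_derivative (\<lambda>v. B *v v)) (at y)"
proof -
  have diff: "F differentiable (at x)" if "x \<in> U" for x
    using holo_map_has_derivative[OF assms(3) that] differentiableI by blast
  have cont: "continuous_on U (dir_deriv v F)" for v
  proof (rule continuous_on_eq)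
    show "continuous_on U (\<lambda>x. cjac F x *v v)"
      unfolding matrix_vector_mult_def
      by (intro continuous_intros holo_on_continuous_on holo_on_cjac[OF assms(1,3)])
  qed (simp add: frechet_holo_map[OF assms(3)])
  have "invertible (cjac F p)"
    using assms(4) invertible_det_nz by blast
  then have inj: "inj (frechet_derivative F (at p))"
    unfolding frechet_holo_map[OF assms(3,2)] by (rule inj_matrix_vector_mult)
  show ?thesis
  proof (rule inverse_function_C1[OF assms(1,2) diff cont inj])
    fix U' V G
    assume *: "open U'" "U' \<subseteq> U" "p \<in> U'" "open V" "F p \<in> V" "F ` U' = V" "G ` V = U'"
      "\<And>x. x \<in> U' \<Longrightarrow> G (F x) = x" "\<And>y. y \<in> V \<Longrightarrow> F (G y) = y"
      "\<And>y. y \<in> V \<Longrightarrow> (G has_derivative inv (frechet_derivative F (at (G y)))) (at y)"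
      "\<And>y. y \<in> V \<Longrightarrow> bij (frechet_derivative F (at (G y)))"
    show thesis
    proof (rule that[OF *(1-9)])
      fix y assume y: "y \<in> V"
      define A where "A = cjac F (G y)"
      have GU: "G y \<in> U" using * y by blast
      have A: "frechet_derivative F (at (G y)) = (\<lambda>v. A *v v)"
        using frechet_holo_map[OF assms(3) GU] by (simp add: A_def)
      have "bij (\<lambda>v. A *v v)" using *(11)[OF y] A by simp
      then have "inj ((*v) A)" by (rule bij_is_inj)
      then obtain B where B: "B ** A = mat 1"
        using matrix_left_invertible_injective by blast
      then have AB: "A ** B = mat 1" by (rule matrix_left_right_inverse[THEN iffD1])
      have inv: "inv (\<lambda>v. A *v v) = (\<lambda>v. B *v v)"
        by (rule inv_equality) (simp_all add: matrix_vector_mul_assoc AB B)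
      have "(G has_derivative (\<lambda>v. B *v v)) (at y)"
        using *(10)[OF y] by (simp only: A inv)
      then show "\<exists>B. cjac F (G y) ** B = mat 1 \<and> (G has_derivative (\<lambda>v. B *v v)) (at y)"
        using AB A_def by blast
    qed
  qed
qed

lemma local_biholomorphism_atI:
  assumes "open U" "p \<in> U" "holo_map U F" "det (cjac F p) \<noteq> 0"
  shows "local_biholomorphism_at p F"
proof -
  show ?thesis
  proof (rule inverse_function_holo_map[OF assms])
    fix U' V G
    assume *: "open U'" "U' \<subseteq> U" "p \<in> U'" "open V" "F p \<in> V" "F ` U' = V" "G ` V = U'"
      "\<And>x. x \<in> U' \<Longrightarrow> G (F x) = x" "\<And>y. y \<in> V \<Longrightarrow> F (G y) = y"
      "\<And>y. y \<in> V \<Longrightarrow> \<exists>B. cjac F (G y) ** B = mat 1 \<and> (G has_derivative (\<lambda>v. B *v v)) (at y)"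
    have "holomorphic_map_on U' F"
      using assms(3) *(2) holo_on_subset unfolding holomorphic_map_on_iff holo_map_def by blast
    moreover have "holomorphic_map_on V G"
      using *(10) unfolding holomorphic_map_on_def by blast
    ultimately show ?thesis
      unfolding local_biholomorphism_at_def using *(1,3-9)
      by (intro exI[of _ U'] exI[of _ V] exI[of _ G]) simp
  qed
qed

section \<open>The identity theorem\<close>

definition line_deriv :: "complex^'N::finite \<Rightarrow> (complex^'N \<Rightarrow> complex) \<Rightarrow> complex^'N \<Rightarrow> complex" where
  "line_deriv v f z = (\<Sum>k\<in>UNIV. v $ k * dZ k f z)"

lemma holo_on_line_deriv: "open U \<Longrightarrow> holo_on U f \<Longrightarrow> holo_on U (line_deriv v f)"
  unfolding line_deriv_def by (intro holo_on_sum holo_on_mult holo_on_const holo_on_dZ) auto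

text \<open>
  On the complex line through \<open>p\<close> and \<open>z\<close> this is the identity theorem in one variable: the iterates
  of \<open>line_deriv (z - p)\<close> are the derivatives of the restriction of \<open>f\<close>.
\<close>

lemma holo_identity_theorem:
  assumes "holo_on (ball p R) f" and zero: "\<And>v n. (line_deriv v ^^ n) f p = 0" and z: "z \<in> ball p R"
  shows "f z = 0"
proof (cases "z = p")
  case True
  then show ?thesis using zero[where n = 0] by simp
next
  case False
  define v where "v = z - p"
  define r where "r = R / norm v"
  have nv: "norm v > 0" using False by (simp add: v_def)
  have norm_sm: "norm (\<zeta> *s v) = norm \<zeta> * norm v" for \<zeta>
    by (simp add: norm_vec_def norm_mult L2_set_right_distrib)
  have inb: "p + \<zeta> *s v \<in> ball p R" if "\<zeta> \<in> ball 0 r" for \<zeta>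
    using that nv by (simp add: dist_norm norm_sm r_def pos_less_divide_eq)
  have hol: "holo_on (ball p R) ((line_deriv v ^^ n) f)" for n
    by (induction n) (auto intro: holo_on_line_deriv assms)
  have der: "((\<lambda>\<zeta>. (line_deriv v ^^ n) f (p + \<zeta> *s v)) has_field_derivative
      (line_deriv v ^^ Suc n) f (p + \<zeta> *s v)) (at \<zeta>)" if "\<zeta> \<in> ball 0 r" for \<zeta> n
    using holo_on_line[OF hol inb[OF that]] by (simp add: line_deriv_def)
  have der_n: "(deriv ^^ n) (\<lambda>\<zeta>. f (p + \<zeta> *s v)) \<zeta> = (line_deriv v ^^ n) f (p + \<zeta> *s v)"
    if "\<zeta> \<in> ball 0 r" for n \<zeta>
    using that
  proof (induction n arbitrary: \<zeta>)
    case (Suc n)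
    have "\<forall>\<^sub>F x in nhds \<zeta>. x \<in> ball 0 r"
      using Suc.prems by (intro eventually_nhds_in_open) auto
    then have "\<forall>\<^sub>F x in nhds \<zeta>. (deriv ^^ n) (\<lambda>\<zeta>. f (p + \<zeta> *s v)) x = (line_deriv v ^^ n) f (p + x *s v)"
      by eventually_elim (rule Suc.IH)
    then have "deriv ((deriv ^^ n) (\<lambda>\<zeta>. f (p + \<zeta> *s v))) \<zeta> = deriv (\<lambda>\<zeta>. (line_deriv v ^^ n) f (p + \<zeta> *s v)) \<zeta>"
      by (intro deriv_cong_ev) auto
    also have "\<dots> = (line_deriv v ^^ Suc n) f (p + \<zeta> *s v)"
      by (rule DERIV_imp_deriv[OF der[OF Suc.prems]])
    finally show ?case by simp
  qed simp
  have "R > 0" using z zero_le_dist[of p z] unfolding mem_ball by linarith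
  then have r: "r > 0" using nv by (simp add: r_def)
  have "(\<lambda>\<zeta>. f (p + \<zeta> *s v)) holomorphic_on ball 0 r"
  proof -
    have "\<exists>f'. ((\<lambda>\<zeta>. f (p + \<zeta> *s v)) has_field_derivative f') (at \<zeta>)" if "\<zeta> \<in> ball 0 r" for \<zeta>
      using der[OF that, of 0] by (simp only: funpow_0) (rule exI)
    then show ?thesis by (simp only: holomorphic_on_open[OF open_ball]) blast
  qed
  moreover have "1 \<in> ball (0::complex) r"
    using z nv by (simp add: r_def v_def dist_norm norm_minus_commute)
  moreover have "(deriv ^^ n) (\<lambda>\<zeta>. f (p + \<zeta> *s v)) 0 = 0" for n
    using der_n[of 0 n] r zero by simp
  ultimately have "f (p + 1 *s v) = 0"
    by (rule holomorphic_fun_eq_0_on_ball)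
  then show ?thesis by (simp add: v_def)
qed

section \<open>The Jacobian of a finite map\<close>

text \<open>Gaussian elimination of one unknown for each equation.\<close>

lemma homogeneous_system_solution:
  fixes c :: "'i \<Rightarrow> 'b \<Rightarrow> 'c::field"
  assumes "finite B" "finite I" "card B < card I"
  shows "\<exists>x. (\<exists>i\<in>I. x i \<noteq> 0) \<and> (\<forall>b\<in>B. (\<Sum>i\<in>I. x i * c i b) = 0)"
  using assms
proof (induction B arbitrary: I c rule: finite_induct)
  case empty
  then have "I \<noteq> {}" by auto
  then show ?case by (intro exI[of _ "\<lambda>_. 1"]) auto
next
  case (insert b B)
  show ?case
  proof (cases "\<forall>i\<in>I. c i b = 0")
    case True
    obtain x where "\<exists>i\<in>I. x i \<noteq> 0" "\<forall>b\<in>B. (\<Sum>i\<in>I. x i * c i b) = 0"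
      using insert.IH[of I c] insert.prems insert.hyps by auto
    then show ?thesis using True by (intro exI[of _ x]) auto
  next
    case False
    then obtain i0 where i0: "i0 \<in> I" "c i0 b \<noteq> 0" by blast
    define I' where "I' = I - {i0}"
    define c' where "c' i b' = c i b' - c i b / c i0 b * c i0 b'" for i b'
    have I': "finite I'" "card B < card I'" and split: "I = insert i0 I'" "i0 \<notin> I'"
      using insert.prems insert.hyps i0 by (auto simp: I'_def)
    obtain x where x: "\<exists>i\<in>I'. x i \<noteq> 0" "\<forall>b'\<in>B. (\<Sum>i\<in>I'. x i * c' i b') = 0"
      using insert.IH[OF I'] by blast
    define y where "y = x(i0 := - (\<Sum>i\<in>I'. x i * c i b) / c i0 b)"
    have "(\<Sum>i\<in>I. y i * c i b') = (\<Sum>i\<in>I'. x i * c' i b')" for b'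
    proof -
      have "(\<Sum>i\<in>I'. y i * c i b') = (\<Sum>i\<in>I'. x i * c i b')"
        using split(2) by (intro sum.cong) (auto simp: y_def)
      then have "(\<Sum>i\<in>I. y i * c i b') = - (\<Sum>i\<in>I'. x i * c i b) / c i0 b * c i0 b' + (\<Sum>i\<in>I'. x i * c i b')"
        using I'(1) split by (simp add: y_def)
      also have "\<dots> = (\<Sum>i\<in>I'. x i * c' i b')"
        by (simp add: c'_def algebra_simps sum_subtractf sum_distrib_left sum_divide_distrib)
      finally show ?thesis .
    qed
    moreover have "(\<Sum>i\<in>I'. x i * c' i b) = 0"
      using i0(2) by (simp add: c'_def)
    moreover have "\<exists>i\<in>I. y i \<noteq> 0"
      using x(1) split by (auto simp: y_def)
    ultimately show ?thesis using x(2) by (intro exI[of _ y]) auto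
  qed
qed

lemma coordinate_power_in_power_series:
  "(\<lambda>z. (z $ k - p $ k) ^ n) \<in> convergent_power_series (p :: complex^'N::finite)"
proof -
  define \<alpha> :: "'N \<Rightarrow> nat" where "\<alpha> = (\<lambda>j. if j = k then n else 0)"
  define a :: "('N \<Rightarrow> nat) \<Rightarrow> complex" where "a \<beta> = (if \<beta> = \<alpha> then 1 else 0)" for \<beta>
  have "((\<lambda>\<beta>. a \<beta> * (\<Prod>k\<in>UNIV. (z $ k - p $ k) ^ \<beta> k)) has_sum (z $ k - p $ k) ^ n) UNIV" for z
  proof -
    have "(\<Prod>j\<in>UNIV. (z $ j - p $ j) ^ \<alpha> j) = (\<Prod>j\<in>UNIV. if j = k then (z $ j - p $ j) ^ n else 1)"
      by (intro prod.cong) (auto simp: \<alpha>_def)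
    then have "(\<Prod>j\<in>UNIV. (z $ j - p $ j) ^ \<alpha> j) = (z $ k - p $ k) ^ n"
      by simp
    then have "((\<lambda>\<beta>. a \<beta> * (\<Prod>k\<in>UNIV. (z $ k - p $ k) ^ \<beta> k)) has_sum (z $ k - p $ k) ^ n) {\<alpha>}"
      by (intro has_sum_finiteI) (auto simp: a_def)
    then show ?thesis
      by (rule has_sum_cong_neutral[THEN iffD1, rotated -1]) (auto simp: a_def)
  qed
  then show ?thesis
    unfolding convergent_power_series_def mem_Collect_eq by (intro exI[of _ a] always_eventually allI)
qed

lemma component_ideal_vanishes:
  assumes "h \<in> component_ideal p F"
  shows "\<forall>\<^sub>F z in nhds p. F z = 0 \<longrightarrow> h z = 0"
proof -
  from assms obtain g where "(\<forall>i. g i \<in> convergent_power_series p) \<and>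
      (\<forall>\<^sub>F z in nhds p. h z = (\<Sum>i\<in>UNIV. g i z * F z $ i))"
    unfolding component_ideal_def mem_Collect_eq ..
  then have "\<forall>\<^sub>F z in nhds p. h z = (\<Sum>i\<in>UNIV. g i z * F z $ i)" ..
  then show ?thesis by (rule eventually_mono) simp
qed

text \<open>
  Modulo the ideal of \<open>H - H p\<close> the powers of \<open>z\<^sub>k - p\<^sub>k\<close> lie in the span of a finite set \<open>B\<close>, so the first
  \<open>card B + 1\<close> of them satisfy a linear relation. It is a nonzero polynomial in \<open>z\<^sub>k - p\<^sub>k\<close> that vanishes
  on the fibre through \<open>p\<close>; as its roots are isolated, \<open>z\<^sub>k = p\<^sub>k\<close> on the fibre near \<open>p\<close>.
\<close>

lemma finite_map_isolated_fibre:
  fixes H :: "complex^'N::finite \<Rightarrow> complex^'N"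
  assumes "finite_map_at p H"
  shows "\<forall>\<^sub>F z in nhds p. H z = H p \<longrightarrow> z = p"
proof -
  from assms obtain B where *: "finite B \<and> B \<subseteq> convergent_power_series p \<and>
      (\<forall>f\<in>convergent_power_series p. \<exists>c :: (complex^'N \<Rightarrow> complex) \<Rightarrow> complex.
        (\<lambda>z. f z - (\<Sum>b\<in>B. c b * b z)) \<in> component_ideal p (\<lambda>z. H z - H p))"
    unfolding finite_map_at_def ..
  note B = *[THEN conjunct1] *[THEN conjunct2, THEN conjunct2, THEN bspec]
  have coord: "\<forall>\<^sub>F z in nhds p. H z = H p \<longrightarrow> z $ k = p $ k" for k
  proof -
    have "\<forall>n. \<exists>c. (\<lambda>z. (z $ k - p $ k) ^ n - (\<Sum>b\<in>B. c b * b z)) \<in> component_ideal p (\<lambda>z. H z - H p)"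
      by (intro allI B(2) coordinate_power_in_power_series)
    from choice[OF this] obtain c where
      c: "\<forall>n. (\<lambda>z. (z $ k - p $ k) ^ n - (\<Sum>b\<in>B. c n b * b z)) \<in> component_ideal p (\<lambda>z. H z - H p)" ..
    have fibre: "\<forall>\<^sub>F z in nhds p. H z = H p \<longrightarrow> (z $ k - p $ k) ^ n = (\<Sum>b\<in>B. c n b * b z)" for n
      using component_ideal_vanishes[OF c[THEN spec[of _ n]]] by simp
    define m where "m = card B"
    have "card B < card {..m}" by (simp add: m_def)
    then obtain x where x: "\<exists>i\<in>{..m}. x i \<noteq> 0" "\<And>b. b \<in> B \<Longrightarrow> (\<Sum>i\<le>m. x i * c i b) = 0"
      using homogeneous_system_solution[OF B(1) finite_atMost, of m c] by blast
    define Z where "Z = {t. (\<Sum>i\<le>m. x i * t ^ i) = 0}"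
    have "finite Z"
      unfolding Z_def using x(1) polyfun_finite_roots[of x m] by auto
    then obtain e where e: "e > 0" "\<And>t. t \<in> Z \<Longrightarrow> t \<noteq> 0 \<Longrightarrow> e \<le> dist 0 t"
      using finite_set_avoid[of Z 0] by metis
    have "\<forall>\<^sub>F z in nhds p. \<forall>n\<in>{..m}. H z = H p \<longrightarrow> (z $ k - p $ k) ^ n = (\<Sum>b\<in>B. c n b * b z)"
      by (intro eventually_ball_finite ballI fibre) auto
    moreover have "\<forall>\<^sub>F z in nhds p. dist z p < e"
      using e(1) eventually_nhds_metric by blast
    ultimately show ?thesis
    proof eventually_elim
      case (elim z)
      show ?case
      proof
        assume Hz: "H z = H p"
        have "(\<Sum>i\<le>m. x i * (z $ k - p $ k) ^ i) = (\<Sum>i\<le>m. \<Sum>b\<in>B. x i * c i b * b z)"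
          using elim(1) Hz by (intro sum.cong) (auto simp: sum_distrib_left mult.assoc)
        also have "\<dots> = (\<Sum>b\<in>B. (\<Sum>i\<le>m. x i * c i b) * b z)"
          by (subst sum.swap) (simp add: sum_distrib_right)
        also have "\<dots> = 0" using x(2) by simp
        finally have "z $ k - p $ k \<in> Z" by (simp add: Z_def)
        moreover have "dist 0 (z $ k - p $ k) < e"
          using elim(2) dist_vec_nth_le[of z k p] by (simp add: dist_norm norm_minus_commute)
        ultimately show "z $ k = p $ k" using e(2) by force
      qed
    qed
  qed
  have "\<forall>\<^sub>F z in nhds p. \<forall>k. H z = H p \<longrightarrow> z $ k = p $ k"
    by (rule eventually_all_finite[OF coord])
  then show ?thesis by eventually_elim (auto simp: vec_eq_iff)
qed

text \<open>
  If \<open>x\<close> are the coefficients of the linear form \<open>h\<close> with respect to the rows of \<open>A\<close>, then the value of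
  \<open>h\<close> at \<open>v\<close> is \<open>x\<^sub>t\<close>, while by Cramer's rule the given determinant is \<open>x\<^sub>t * det A\<close>.
\<close>

lemma linear_form_kills_dual_vector:
  fixes A :: "complex^'N::finite^'N"
  assumes "det A \<noteq> 0" "A *v v = axis t 1" "det (\<chi> i. if i = t then h else A $ i) = 0"
  shows "(\<Sum>k\<in>UNIV. h $ k * v $ k) = 0"
proof -
  have "invertible (transpose A)" using assms(1) by (simp add: invertible_det_nz)
  then obtain x where x: "transpose A *v x = h"
    by (metis invertible_def matrix_vector_mul_assoc matrix_vector_mul_lid)
  have h: "h $ k = (\<Sum>i\<in>UNIV. x $ i * A $ i $ k)" for k
    unfolding x[symmetric] by (simp add: matrix_vector_mult_def transpose_def mult.commute)
  have "h = (\<Sum>i\<in>UNIV. x $ i *s row i A)"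
    by (simp add: vec_eq_iff h row_def)
  then have "(\<chi> i. if i = t then h else A $ i) = (\<chi> i. if i = t then (\<Sum>i\<in>UNIV. x $ i *s row i A) else row i A)"
    by (simp add: vec_eq_iff row_def)
  then have "x $ t * det A = 0"
    using assms(3) cramer_lemma_transpose[of t x A] by simp
  then have xt: "x $ t = 0" using assms(1) by simp
  have "(\<Sum>k\<in>UNIV. h $ k * v $ k) = (\<Sum>k\<in>UNIV. \<Sum>i\<in>UNIV. x $ i * (A $ i $ k * v $ k))"
    by (simp add: h sum_distrib_right mult.assoc)
  also have "\<dots> = (\<Sum>i\<in>UNIV. x $ i * (A *v v) $ i)"
    by (subst sum.swap) (simp add: matrix_vector_mult_def sum_distrib_left)
  also have "\<dots> = x $ t"
    unfolding assms(2) by (simp add: axis_def if_distrib cong: if_cong)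
  finally show ?thesis using xt by simp
qed

text \<open>
  Choose a set \<open>T\<close> of coordinates, as small as possible, such that these coordinates together with
  suitable components of \<open>H\<close> have a Jacobian determinant that is not identically zero near a given
  point. Then \<open>CARD('N) - card T\<close> is the generic rank of \<open>H\<close>, and where the determinant does not vanish
  the coordinates in \<open>T\<close> parametrize the fibres of \<open>H\<close>, as in the constant rank theorem.
\<close>

definition mixed_map :: "'N set \<Rightarrow> ('N \<Rightarrow> 'N) \<Rightarrow> (complex^'N::finite \<Rightarrow> complex^'N) \<Rightarrow> complex^'N \<Rightarrow> complex^'N" where
  "mixed_map T \<sigma> H z = (\<chi> i. if i \<in> T then z $ i else H z $ \<sigma> i)"

lemma holo_map_mixed: "holo_map U H \<Longrightarrow> holo_map U (mixed_map T \<sigma> H)"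
proof -
  assume "holo_map U H"
  then have "holo_on U (\<lambda>z. if i \<in> T then z $ i else H z $ \<sigma> i)" for i
    by (cases "i \<in> T") (auto simp: holo_map_def)
  then show ?thesis by (simp add: holo_map_def mixed_map_def)
qed

lemma cjac_mixed:
  "cjac (mixed_map T \<sigma> H) z = (\<chi> i. if i \<in> T then axis i 1 else cjac H z $ \<sigma> i)"
  by (simp add: vec_eq_iff cjac_def mixed_map_def dZ_component axis_def eq_commute)

definition mixed_minor :: "'N set \<Rightarrow> ('N \<Rightarrow> 'N) \<Rightarrow> (complex^'N::finite \<Rightarrow> complex^'N) \<Rightarrow> complex^'N \<Rightarrow> complex" where
  "mixed_minor T \<sigma> H z = det (cjac (mixed_map T \<sigma> H) z)"

lemma holo_on_mixed_minor: "open U \<Longrightarrow> holo_map U H \<Longrightarrow> holo_on U (mixed_minor T \<sigma> H)"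
  unfolding mixed_minor_def[abs_def] by (intro holo_on_det holo_on_cjac holo_map_mixed)

text \<open>
  Near \<open>b\<close> the mixed map is a coordinate system; the curve moves the coordinate \<open>t\<close> and keeps the others
  fixed. That no component of \<open>H\<close> can replace the coordinate \<open>t\<close> means that the differentials of all
  components annihilate the velocity of the curve, so that it stays in a fibre.
\<close>

lemma fibre_curve:
  fixes H :: "complex^'N::finite \<Rightarrow> complex^'N"
  assumes W: "open W" "b \<in> W" "holo_map W H" and t: "t \<in> T"
    and minor: "mixed_minor T \<sigma> H b \<noteq> 0"
    and zero: "\<And>z i. z \<in> W \<Longrightarrow> mixed_minor (T - {t}) (\<sigma>(t := i)) H z = 0"
  shows "\<exists>s>0. \<exists>\<gamma>. \<gamma> 0 = b \<and> (\<forall>\<zeta>\<in>ball 0 s. \<gamma> \<zeta> \<in> W \<and> H (\<gamma> \<zeta>) = H b \<and> \<gamma> \<zeta> $ t = b $ t + \<zeta> \<and>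
    (\<exists>v. (\<gamma> has_derivative (\<lambda>h. h *s v)) (at \<zeta>)))"
proof -
  define \<Psi> where "\<Psi> = mixed_map T \<sigma> H"
  have hol\<Psi>: "holo_map W \<Psi>" unfolding \<Psi>_def by (rule holo_map_mixed[OF W(3)])
  have det\<Psi>: "det (cjac \<Psi> b) \<noteq> 0" using minor by (simp add: mixed_minor_def \<Psi>_def)
  show ?thesis
  proof (rule inverse_function_holo_map[OF W(1,2) hol\<Psi> det\<Psi>])
    fix U' V G
    assume G: "open U'" "U' \<subseteq> W" "b \<in> U'" "open V" "\<Psi> b \<in> V" "\<Psi> ` U' = V" "G ` V = U'"
      "\<And>x. x \<in> U' \<Longrightarrow> G (\<Psi> x) = x" "\<And>y. y \<in> V \<Longrightarrow> \<Psi> (G y) = y"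
      "\<And>y. y \<in> V \<Longrightarrow> \<exists>B. cjac \<Psi> (G y) ** B = mat 1 \<and> (G has_derivative (\<lambda>v. B *v v)) (at y)"
    obtain s where s: "s > 0" "ball (\<Psi> b) s \<subseteq> V"
      by (rule openE[OF G(4,5)])
    define \<gamma> where "\<gamma> \<zeta> = G (\<Psi> b + \<zeta> *s axis t 1)" for \<zeta>
    have inV: "\<Psi> b + \<zeta> *s axis t 1 \<in> V" if "\<zeta> \<in> ball 0 s" for \<zeta>
      using that by (intro subsetD[OF s(2)]) (simp add: dist_norm norm_smult_axis)
    have \<gamma>W: "\<gamma> \<zeta> \<in> W" if "\<zeta> \<in> ball 0 s" for \<zeta>
      using inV[OF that] G(2,7) by (auto simp: \<gamma>_def)
    have \<Psi>\<gamma>: "\<Psi> (\<gamma> \<zeta>) = \<Psi> b + \<zeta> *s axis t 1" if "\<zeta> \<in> ball 0 s" for \<zeta>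
      using inV[OF that] G(9) by (simp add: \<gamma>_def)
    have \<gamma>0: "\<gamma> 0 = b" using G(3,8) by (simp add: \<gamma>_def)
    have \<gamma>': "\<exists>v. cjac \<Psi> (\<gamma> \<zeta>) *v v = axis t 1 \<and> det (cjac \<Psi> (\<gamma> \<zeta>)) \<noteq> 0 \<and>
        (\<gamma> has_derivative (\<lambda>h. h *s v)) (at \<zeta>)" if \<zeta>: "\<zeta> \<in> ball 0 s" for \<zeta>
    proof -
      obtain B where B: "cjac \<Psi> (\<gamma> \<zeta>) ** B = mat 1"
        "(G has_derivative (\<lambda>v. B *v v)) (at (\<Psi> b + \<zeta> *s axis t 1))"
        using G(10)[OF inV[OF \<zeta>]] by (auto simp: \<gamma>_def)
      from has_derivative_compose[OF complex_line_has_derivative B(2)]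
      have "(\<gamma> has_derivative (\<lambda>h. B *v (h *s axis t 1))) (at \<zeta>)"
        unfolding \<gamma>_def .
      moreover have "B *v (h *s axis t 1) = h *s (B *v axis t 1)" for h
        by (simp add: vector_scalar_commute)
      moreover have "cjac \<Psi> (\<gamma> \<zeta>) *v (B *v axis t 1) = axis t 1"
        by (simp add: matrix_vector_mul_assoc B(1))
      moreover have "det (cjac \<Psi> (\<gamma> \<zeta>)) \<noteq> 0"
        using B(1) by (simp add: invertible_det_nz[symmetric] invertible_right_inverse) blast
      ultimately show ?thesis by auto
    qed
    have H\<gamma>': "((\<lambda>\<zeta>. H (\<gamma> \<zeta>) $ i) has_field_derivative 0) (at \<zeta>)" if \<zeta>: "\<zeta> \<in> ball 0 s" for \<zeta> i
    proof -
      obtain v where v: "cjac \<Psi> (\<gamma> \<zeta>) *v v = axis t 1" "det (cjac \<Psi> (\<gamma> \<zeta>)) \<noteq> 0"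
        "(\<gamma> has_derivative (\<lambda>h. h *s v)) (at \<zeta>)"
        using \<gamma>'[OF \<zeta>] by blast
      have "(\<chi> j. if j = t then cjac H (\<gamma> \<zeta>) $ i else cjac \<Psi> (\<gamma> \<zeta>) $ j)
          = cjac (mixed_map (T - {t}) (\<sigma>(t := i)) H) (\<gamma> \<zeta>)"
        unfolding \<Psi>_def cjac_mixed by (simp add: vec_eq_iff)
      then have "det (\<chi> j. if j = t then cjac H (\<gamma> \<zeta>) $ i else cjac \<Psi> (\<gamma> \<zeta>) $ j) = 0"
        using zero[OF \<gamma>W[OF \<zeta>], of i] by (simp add: mixed_minor_def)
      from linear_form_kills_dual_vector[OF v(2,1) this]
      have "(\<Sum>k\<in>UNIV. v $ k * dZ k (\<lambda>z. H z $ i) (\<gamma> \<zeta>)) = 0"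
        by (simp add: cjac_def mult.commute)
      moreover have "holo_on W (\<lambda>z. H z $ i)" using W(3) by (simp add: holo_map_def)
      ultimately show ?thesis
        using holo_on_curve[of W "\<lambda>z. H z $ i", OF _ \<gamma>W[OF \<zeta>] v(3)] by simp
    qed
    have s0: "0 \<in> ball (0::complex) s" using s(1) by simp
    have const: "\<exists>c. \<forall>\<zeta>\<in>ball 0 s. H (\<gamma> \<zeta>) $ i = c" for i
      by (rule has_field_derivative_zero_constant[OF convex_ball])
        (rule has_field_derivative_at_within[OF H\<gamma>'])
    have "H (\<gamma> \<zeta>) $ i = H b $ i" if \<zeta>: "\<zeta> \<in> ball 0 s" for \<zeta> i
    proof -
      from const[of i] obtain c where c: "\<forall>\<zeta>\<in>ball 0 s. H (\<gamma> \<zeta>) $ i = c" ..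
      show ?thesis using bspec[OF c \<zeta>] bspec[OF c s0] \<gamma>0 by simp
    qed
    then have H\<gamma>: "H (\<gamma> \<zeta>) = H b" if "\<zeta> \<in> ball 0 s" for \<zeta>
      using that by (simp add: vec_eq_iff)
    have "\<gamma> \<zeta> $ t = b $ t + \<zeta>" if "\<zeta> \<in> ball 0 s" for \<zeta>
    proof -
      have "\<Psi> z $ t = z $ t" for z using t by (simp add: \<Psi>_def mixed_map_def)
      then have "\<gamma> \<zeta> $ t = (\<Psi> b + \<zeta> *s axis t 1) $ t"
        using \<Psi>\<gamma>[OF that] by metis
      then show ?thesis using t by (simp add: \<Psi>_def mixed_map_def axis_def)
    qed
    then show ?thesis
      using s(1) \<gamma>0 \<gamma>W H\<gamma> \<gamma>'
      by (intro exI[of _ s] exI[of _ \<gamma>] conjI ballI) (assumption | blast)+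
  qed
qed

text \<open>
  Suppose the minor does not vanish identically on the compact fibre \<open>K\<close>. Where its modulus is
  maximal on \<open>K\<close>, it is constant along the curves of \<open>fibre_curve\<close>, by the maximum modulus principle.
  These curves thus stay in the compact set of points of \<open>K\<close> where the minor has one fixed nonzero
  value. But the real part of the \<open>t\<close>-th coordinate attains a maximum on that set and increases
  along the curves.
\<close>

lemma no_compact_fibre:
  fixes H :: "complex^'N::finite \<Rightarrow> complex^'N"
  assumes W: "open W" "holo_map W H" and t: "t \<in> T"
    and zero: "\<And>z i. z \<in> W \<Longrightarrow> mixed_minor (T - {t}) (\<sigma>(t := i)) H z = 0"
    and K: "compact K" "K \<subseteq> W" "\<And>z. z \<in> K \<longleftrightarrow> z \<in> W \<and> H z = w"
    and z0: "z0 \<in> K"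
  shows "mixed_minor T \<sigma> H z0 = 0"
proof (rule ccontr)
  let ?\<delta> = "mixed_minor T \<sigma> H"
  assume nz: "?\<delta> z0 \<noteq> 0"
  have hol\<delta>: "holo_on W ?\<delta>" by (rule holo_on_mixed_minor[OF W])
  have cont\<delta>: "continuous_on K ?\<delta>"
    by (rule continuous_on_subset[OF holo_on_continuous_on[OF hol\<delta>] K(2)])
  have "K \<noteq> {}" using z0 by blast
  from continuous_attains_sup[OF K(1) this continuous_on_norm[OF cont\<delta>]]
  obtain q where q: "q \<in> K" "\<forall>z\<in>K. norm (?\<delta> z) \<le> norm (?\<delta> q)"
    by (elim bexE) (rule that)
  have q0: "?\<delta> q \<noteq> 0" using bspec[OF q(2) z0] nz by auto
  \<comment> \<open>On \<open>K2\<close> the modulus is maximal, so the maximum principle applies at each of its points.\<close>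
  define K2 where "K2 = {z \<in> K. ?\<delta> z = ?\<delta> q}"
  have "closed K2"
    unfolding K2_def by (rule continuous_closed_preimage_constant[OF cont\<delta> compact_imp_closed[OF K(1)]])
  then have "compact (K \<inter> K2)" by (intro compact_Int_closed K(1))
  moreover have "K \<inter> K2 = K2" by (auto simp: K2_def)
  ultimately have K2: "compact K2" by simp
  have "K2 \<noteq> {}" using q(1) by (auto simp: K2_def)
  have "continuous_on K2 (\<lambda>z. Re (z $ t))" by (intro continuous_intros)
  from continuous_attains_sup[OF K2 \<open>K2 \<noteq> {}\<close> this]
  obtain b where b: "b \<in> K2" "\<forall>z\<in>K2. Re (z $ t) \<le> Re (b $ t)"
    by (elim bexE) (rule that)
  have b': "b \<in> W" "H b = w" "?\<delta> b = ?\<delta> q" "?\<delta> b \<noteq> 0"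
    using b(1) K(3) q0 by (auto simp: K2_def)
  have "\<exists>s>0. \<exists>\<gamma>. \<gamma> 0 = b \<and> (\<forall>\<zeta>\<in>ball 0 s. \<gamma> \<zeta> \<in> W \<and> H (\<gamma> \<zeta>) = H b \<and> \<gamma> \<zeta> $ t = b $ t + \<zeta> \<and>
      (\<exists>v. (\<gamma> has_derivative (\<lambda>h. h *s v)) (at \<zeta>)))"
    by (rule fibre_curve[OF W(1) b'(1) W(2) t b'(4) zero])
  then obtain s \<gamma> where s: "s > 0" and \<gamma>0: "\<gamma> 0 = b" and \<gamma>: "\<forall>\<zeta>\<in>ball 0 s. \<gamma> \<zeta> \<in> W \<and> H (\<gamma> \<zeta>) = H b \<and>
      \<gamma> \<zeta> $ t = b $ t + \<zeta> \<and> (\<exists>v. (\<gamma> has_derivative (\<lambda>h. h *s v)) (at \<zeta>))"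
    by (elim exE conjE) (rule that)
  have \<gamma>K: "\<gamma> \<zeta> \<in> K" if "\<zeta> \<in> ball 0 s" for \<zeta>
    using bspec[OF \<gamma> that] b'(2) by (simp add: K(3))
  have "\<exists>f'. ((\<lambda>\<zeta>. ?\<delta> (\<gamma> \<zeta>)) has_field_derivative f') (at \<zeta>)" if "\<zeta> \<in> ball 0 s" for \<zeta>
    using bspec[OF \<gamma> that] holo_on_curve[OF hol\<delta>] by blast
  then have "(\<lambda>\<zeta>. ?\<delta> (\<gamma> \<zeta>)) holomorphic_on ball 0 s"
    by (simp only: holomorphic_on_open[OF open_ball]) blast
  then have "(\<lambda>\<zeta>. ?\<delta> (\<gamma> \<zeta>)) constant_on ball 0 s"
    by (rule maximum_modulus_principle[of _ _ "ball 0 s" 0])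
      (use s q(2) \<gamma>K b'(3) \<gamma>0 in auto)
  then obtain c where c: "\<forall>\<zeta>\<in>ball 0 s. ?\<delta> (\<gamma> \<zeta>) = c"
    unfolding constant_on_def ..
  have half: "of_real (s / 2) \<in> ball (0::complex) s" and "0 \<in> ball (0::complex) s" using s by simp_all
  then have "\<gamma> (of_real (s / 2)) \<in> K2"
    using \<gamma>K bspec[OF c half] bspec[OF c, of 0] b'(3) \<gamma>0 by (simp add: K2_def)
  moreover have "\<gamma> (of_real (s / 2)) $ t = b $ t + of_real (s / 2)"
    using bspec[OF \<gamma> half] by simp
  ultimately show False using bspec[OF b(2)] s by fastforce
qed

text \<open>
  If the Jacobian vanished identically, a minimal set \<open>T\<close> as above would not be empty. Since \<open>H p\<close> is
  not attained on a small sphere around \<open>p\<close>, neither is \<open>H z0\<close> for \<open>z0\<close> close to \<open>p\<close>, so that the fibre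
  through \<open>z0\<close> is compact inside the ball. Choosing \<open>z0\<close> where the minor does not vanish contradicts
  \<open>no_compact_fibre\<close>.
\<close>

lemma isolated_fibre_imp_jacobian_nonzero:
  fixes H :: "complex^'N::finite \<Rightarrow> complex^'N"
  assumes U: "open U" "p \<in> U" "holo_map U H" and iso: "\<forall>\<^sub>F z in nhds p. H z = H p \<longrightarrow> z = p"
  shows "\<not> (\<forall>\<^sub>F z in nhds p. det (cjac H z) = 0)"
proof
  assume J0: "\<forall>\<^sub>F z in nhds p. det (cjac H z) = 0"
  let ?\<delta> = "\<lambda>T \<sigma>. mixed_minor T \<sigma> H"
  define active where "active T \<longleftrightarrow> (\<exists>\<sigma>. \<not> (\<forall>\<^sub>F z in nhds p. ?\<delta> T \<sigma> z = 0))" for T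
  have "active UNIV"
  proof -
    have "cjac (mixed_map UNIV id H) z = mat 1" for z
      by (simp add: cjac_mixed vec_eq_iff axis_def mat_def eq_commute)
    then have "?\<delta> UNIV id z = 1" for z by (simp add: mixed_minor_def)
    then show ?thesis unfolding active_def by (intro exI[of _ id]) simp
  qed
  from ex_has_least_nat[of active, OF this, of card]
  obtain T where "active T \<and> (\<forall>T'. active T' \<longrightarrow> card T \<le> card T')" ..
  then have T: "active T" "active T' \<Longrightarrow> card T \<le> card T'" for T' by simp_all
  have "T \<noteq> {}"
  proof
    assume "T = {}"
    from T(1)[unfolded active_def this] obtain \<sigma> where \<sigma>: "\<not> (\<forall>\<^sub>F z in nhds p. ?\<delta> {} \<sigma> z = 0)" ..
    have "?\<delta> {} \<sigma> z = 0" if "det (cjac H z) = 0" for z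
    proof (cases "inj \<sigma>")
      case True
      then have "\<sigma> permutes UNIV"
        by (rule inj_imp_permutes) auto
      then show ?thesis
        using that det_permute_rows[of \<sigma> "cjac H z"] by (simp add: mixed_minor_def cjac_mixed)
    next
      case False
      then obtain i j where "i \<noteq> j" "\<sigma> i = \<sigma> j" by (auto simp: inj_def)
      then show ?thesis
        unfolding mixed_minor_def cjac_mixed by (intro det_identical_rows[of i j]) (simp_all add: row_def)
    qed
    with J0 have "\<forall>\<^sub>F z in nhds p. ?\<delta> {} \<sigma> z = 0"
      by (rule eventually_mono)
    then show False using \<sigma> by blast
  qed
  then obtain t where t: "t \<in> T" by blast
  from T(1)[unfolded active_def] obtain \<sigma> where \<sigma>: "\<not> (\<forall>\<^sub>F z in nhds p. ?\<delta> T \<sigma> z = 0)" ..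
  have "\<not> active (T - {t})"
    using T(2)[of "T - {t}"] t by (metis card_Diff1_less finite linorder_not_less)
  then have "\<forall>\<^sub>F z in nhds p. ?\<delta> (T - {t}) (\<sigma>(t := i)) z = 0" for i
    unfolding active_def by blast
  then have "\<forall>\<^sub>F z in nhds p. \<forall>i. ?\<delta> (T - {t}) (\<sigma>(t := i)) z = 0"
    by (rule eventually_all_finite)
  moreover have "\<forall>\<^sub>F z in nhds p. z \<in> U" using U eventually_nhds_in_open by blast
  ultimately have "\<forall>\<^sub>F z in nhds p. z \<in> U \<and> (H z = H p \<longrightarrow> z = p) \<and> (\<forall>i. ?\<delta> (T - {t}) (\<sigma>(t := i)) z = 0)"
    using iso by eventually_elim auto
  then obtain r where r: "r > 0" "\<And>z. dist z p < r \<Longrightarrow>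
      z \<in> U \<and> (H z = H p \<longrightarrow> z = p) \<and> (\<forall>i. ?\<delta> (T - {t}) (\<sigma>(t := i)) z = 0)"
    unfolding eventually_nhds_metric by blast
  define \<epsilon> where "\<epsilon> = r / 2"
  have \<epsilon>: "\<epsilon> > 0" using r(1) by (simp add: \<epsilon>_def)
  have near: "z \<in> U" "H z = H p \<Longrightarrow> z = p" "?\<delta> (T - {t}) (\<sigma>(t := i)) z = 0" if "z \<in> cball p \<epsilon>" for z i
    using r(2)[of z] that r(1) by (auto simp: \<epsilon>_def dist_commute)
  have contH: "continuous_on U H"
    by (intro continuous_at_imp_continuous_on ballI
        has_derivative_continuous[OF holo_map_has_derivative[OF U(3)]])
  have cball_U: "cball p \<epsilon> \<subseteq> U" using near(1) by (rule subsetI)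
  have contHe: "continuous_on (cball p \<epsilon>) H"
    by (rule continuous_on_subset[OF contH cball_U])
  let ?S = "sphere p \<epsilon>"
  have "compact (H ` ?S)"
    by (intro compact_continuous_image continuous_on_subset[OF contHe] compact_sphere) auto
  then have "open (- (H ` ?S))" by (simp add: compact_imp_closed open_Compl)
  then have "open (U \<inter> H -` (- (H ` ?S)))"
    by (rule continuous_open_preimage[OF contH U(1)])
  moreover have "p \<in> U \<inter> H -` (- (H ` ?S))"
  proof -
    have "H p \<noteq> H z" if "z \<in> ?S" for z
      using near(2)[of z] that \<epsilon> by auto
    then show ?thesis using U(2) by blast
  qed
  ultimately have "\<forall>\<^sub>F z in nhds p. z \<in> U \<inter> H -` (- (H ` ?S))"
    by (rule eventually_nhds_in_open)
  moreover have "\<forall>\<^sub>F z in nhds p. z \<in> ball p \<epsilon>"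
    using \<epsilon> by (intro eventually_nhds_in_open) auto
  ultimately have ev: "\<forall>\<^sub>F z in nhds p. z \<in> ball p \<epsilon> \<and> H z \<notin> H ` ?S"
    by eventually_elim blast
  have "\<exists>z0. z0 \<in> ball p \<epsilon> \<and> H z0 \<notin> H ` ?S \<and> ?\<delta> T \<sigma> z0 \<noteq> 0"
  proof (rule ccontr)
    assume "\<not> ?thesis"
    then have "?\<delta> T \<sigma> z = 0" if "z \<in> ball p \<epsilon> \<and> H z \<notin> H ` ?S" for z
      using that by blast
    then have "\<forall>\<^sub>F z in nhds p. ?\<delta> T \<sigma> z = 0"
      by (rule eventually_mono[OF ev])
    with \<sigma> show False by (rule notE)
  qed
  then obtain z0 where z0: "z0 \<in> ball p \<epsilon>" "H z0 \<notin> H ` ?S" "?\<delta> T \<sigma> z0 \<noteq> 0"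
    by (elim exE conjE) (rule that)
  define K where "K = {z \<in> cball p \<epsilon>. H z = H z0}"
  have "closed K"
    unfolding K_def by (rule continuous_closed_preimage_constant[OF contHe closed_cball])
  then have "compact (cball p \<epsilon> \<inter> K)"
    by (intro compact_Int_closed compact_cball)
  moreover have "cball p \<epsilon> \<inter> K = K" by (auto simp: K_def)
  ultimately have K: "compact K" by simp
  have Kball: "K \<subseteq> ball p \<epsilon>"
  proof
    fix z assume z: "z \<in> K"
    then have "H z \<notin> H ` ?S" using z0(2) by (simp add: K_def)
    then have "z \<notin> ?S" by blast
    then show "z \<in> ball p \<epsilon>" using z by (simp add: K_def)
  qed
  have "ball p \<epsilon> \<subseteq> U" using ball_subset_cball cball_U by (rule order_trans)
  then have holH: "holo_map (ball p \<epsilon>) H"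
    using U(3) holo_on_subset unfolding holo_map_def by blast
  have "?\<delta> T \<sigma> z0 = 0"
  proof (rule no_compact_fibre[OF open_ball holH t _ K Kball])
    show "z \<in> K \<longleftrightarrow> z \<in> ball p \<epsilon> \<and> H z = H z0" for z
      using Kball by (auto simp: K_def)
    show "z0 \<in> K" using z0(1) by (simp add: K_def)
  qed (use near(3) in auto)
  then show False using z0(3) by blast
qed

section \<open>Prime ideals of germs of smooth functions\<close>

lemma field_apply_cong:
  assumes "\<forall>\<^sub>F z in nhds p. f z = g z"
  shows "\<forall>\<^sub>F z in nhds p. field_apply X f z = field_apply X g z"
proof -
  have "\<forall>\<^sub>F z in nhds p. \<forall>\<^sub>F y in nhds z. f y = g y"
    using assms by (simp add: eventually_eventually)
  then show ?thesis
    by (rule eventually_mono) (simp add: field_apply_def vector_apply_cong)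
qed

lemma field_apply_add_near:
  assumes "smooth_near p f" "smooth_near p g"
  shows "\<forall>\<^sub>F z in nhds p. field_apply X (\<lambda>z. f z + g z) z = field_apply X f z + field_apply X g z"
  using smooth_near_eventually[OF assms(1)] smooth_near_eventually[OF assms(2)]
  by eventually_elim (simp add: field_apply_def vector_apply_add smooth_near_differentiable)

lemma field_apply_mult_near:
  assumes "smooth_near p f" "smooth_near p g"
  shows "\<forall>\<^sub>F z in nhds p. field_apply X (\<lambda>z. f z * g z) z = f z * field_apply X g z + field_apply X f z * g z"
  using smooth_near_eventually[OF assms(1)] smooth_near_eventually[OF assms(2)]
  by eventually_elim (simp add: field_apply_def vector_apply_mult smooth_near_differentiable)

definition vanishes_on :: "(complex^'N::finite) set \<Rightarrow> complex^'N \<Rightarrow> (complex^'N \<Rightarrow> complex) \<Rightarrow> bool" where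
  "vanishes_on M p f \<longleftrightarrow> (\<forall>\<^sub>F z in nhds p. z \<in> M \<longrightarrow> f z = 0)"

definition tangent_field :: "(complex^'N::finite) set \<Rightarrow> complex^'N \<Rightarrow> 'N cfield \<Rightarrow> bool" where
  "tangent_field M p X \<longleftrightarrow> smooth_field_near p X \<and>
     (\<forall>f. smooth_near p f \<longrightarrow> vanishes_on M p f \<longrightarrow> vanishes_on M p (field_apply X f))"

text \<open>
  A prime ideal, contained in the maximal ideal of \<open>p\<close>, in the ring of germs at \<open>p\<close> of smooth functions
  on the ambient space. As it contains the germs that vanish on \<open>M\<close>, it amounts to a prime ideal in the
  ring of germs of smooth functions on \<open>M\<close>; membership depends only on the germ of the restriction to
  \<open>M\<close> (\<open>eq_on\<close>).
\<close>

locale germ_prime =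
  fixes M :: "(complex^'N::finite) set" and p :: "complex^'N" and P :: "(complex^'N \<Rightarrow> complex) set"
  assumes smooth: "f \<in> P \<Longrightarrow> smooth_near p f"
    and vanishing: "smooth_near p f \<Longrightarrow> vanishes_on M p f \<Longrightarrow> f \<in> P"
    and add: "f \<in> P \<Longrightarrow> g \<in> P \<Longrightarrow> (\<lambda>z. f z + g z) \<in> P"
    and mult: "f \<in> P \<Longrightarrow> smooth_near p g \<Longrightarrow> (\<lambda>z. f z * g z) \<in> P"
    and prime: "(\<lambda>z. f z * g z) \<in> P \<Longrightarrow> smooth_near p f \<Longrightarrow> smooth_near p g \<Longrightarrow> f \<in> P \<or> g \<in> P"
    and proper: "f \<in> P \<Longrightarrow> f p = 0"
begin

lemma eq_on:
  assumes "f \<in> P" "smooth_near p g" "\<forall>\<^sub>F z in nhds p. z \<in> M \<longrightarrow> f z = g z"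
  shows "g \<in> P"
proof -
  have "vanishes_on M p (\<lambda>z. g z - f z)"
    unfolding vanishes_on_def using assms(3) by (rule eventually_mono) auto
  then have "(\<lambda>z. g z - f z) \<in> P"
    by (intro vanishing smooth_near_diff assms(2) smooth[OF assms(1)])
  from add[OF assms(1) this] show ?thesis by simp
qed

lemma eq_near:
  assumes "f \<in> P" "\<forall>\<^sub>F z in nhds p. f z = g z"
  shows "g \<in> P"
  using assms(1) smooth_near_cong[OF smooth[OF assms(1)] assms(2)]
  by (rule eq_on) (use assms(2) in \<open>auto elim: eventually_mono\<close>)

lemma zero: "(\<lambda>z. 0) \<in> P"
  by (rule vanishing) (auto simp: vanishes_on_def)

lemma sum:
  assumes "finite I" "\<And>i. i \<in> I \<Longrightarrow> f i \<in> P"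
  shows "(\<lambda>z. \<Sum>i\<in>I. f i z) \<in> P"
  using assms by (induction I rule: finite_induct) (auto simp: zero intro: add)

lemma mult_left: "f \<in> P \<Longrightarrow> smooth_near p g \<Longrightarrow> (\<lambda>z. g z * f z) \<in> P"
  using mult[of f g] by (simp add: mult.commute)

lemma cancel_unit:
  assumes "(\<lambda>z. u z * f z) \<in> P" "smooth_near p u" "u p \<noteq> 0" "smooth_near p f"
  shows "f \<in> P"
  using prime[OF assms(1,2,4)] proper assms(3) by blast

lemma power:
  assumes "(\<lambda>z. f z ^ m) \<in> P" "smooth_near p f"
  shows "f \<in> P"
  using assms(1)
proof (induction m)
  case 0
  then show ?case using proper by fastforce
next
  case (Suc m)
  then show ?case
    using prime[of f "\<lambda>z. f z ^ m"] assms(2) smooth_near_power by auto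
qed

lemma det_column:
  assumes "\<And>i j. smooth_near p (\<lambda>z. A z $ i $ j)" "\<And>i. (\<lambda>z. A z $ i $ l) \<in> P"
  shows "(\<lambda>z. det (A z :: complex^'N^'N)) \<in> P"
  unfolding det_def
proof (intro sum mult_left)
  fix \<pi> :: "'N \<Rightarrow> 'N"
  assume "\<pi> \<in> {\<pi>. \<pi> permutes UNIV}"
  then have "surj \<pi>" using permutes_surj by auto
  then obtain i where i: "\<pi> i = l" by (metis surj_def)
  have "(\<lambda>z. \<Prod>i\<in>UNIV. A z $ i $ \<pi> i) = (\<lambda>z. A z $ i $ l * (\<Prod>i\<in>UNIV - {i}. A z $ i $ \<pi> i))"
    using i by (auto simp: fun_eq_iff prod.remove[of UNIV i])
  moreover have "\<dots> \<in> P"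
    by (intro mult assms smooth_near_prod) auto
  ultimately show "(\<lambda>z. \<Prod>i\<in>UNIV. A z $ i $ \<pi> i) \<in> P" by simp
qed auto

end

text \<open>
  The kernel of the formal flow \<open>exp (t X)\<close>, regarded as a ring homomorphism into the power series in
  \<open>t\<close> over the ring of germs modulo \<open>P\<close>.
\<close>

definition invariant_part :: "complex^'N::finite \<Rightarrow> (complex^'N \<Rightarrow> complex) set \<Rightarrow> 'N cfield \<Rightarrow> (complex^'N \<Rightarrow> complex) set" where
  "invariant_part p P X = {f. smooth_near p f \<and> (\<forall>k. (field_apply X ^^ k) f \<in> P)}"

lemma smooth_near_funpow_field_apply:
  "smooth_field_near p X \<Longrightarrow> smooth_near p f \<Longrightarrow> smooth_near p ((field_apply X ^^ k) f)"
  by (induction k) auto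

lemma funpow_field_apply_cong:
  "\<forall>\<^sub>F z in nhds p. f z = g z \<Longrightarrow>
   \<forall>\<^sub>F z in nhds p. (field_apply X ^^ k) f z = (field_apply X ^^ k) g z"
  by (induction k) (auto intro: field_apply_cong)

lemma funpow_field_apply_add_near:
  assumes X: "smooth_field_near p X" and "smooth_near p f" "smooth_near p g"
  shows "\<forall>\<^sub>F z in nhds p. (field_apply X ^^ k) (\<lambda>z. f z + g z) z
    = (field_apply X ^^ k) f z + (field_apply X ^^ k) g z"
proof (induction k)
  case (Suc k)
  show ?case
    using field_apply_cong[OF Suc, of X]
      field_apply_add_near[of p "(field_apply X ^^ k) f" "(field_apply X ^^ k) g" X]
      smooth_near_funpow_field_apply[OF X assms(2)] smooth_near_funpow_field_apply[OF X assms(3)]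
    by (auto elim: eventually_elim2)
qed simp

context germ_prime
begin

lemma funpow_mult_split:
  assumes X: "smooth_field_near p X" and f: "smooth_near p f" and g: "smooth_near p g"
  shows "\<forall>\<^sub>F z in nhds p. (field_apply X ^^ k) (\<lambda>z. f z * field_apply X g z) z
    + (field_apply X ^^ k) (\<lambda>z. field_apply X f z * g z) z = (field_apply X ^^ Suc k) (\<lambda>z. f z * g z) z"
proof -
  have "\<forall>\<^sub>F z in nhds p. (field_apply X ^^ k) (field_apply X (\<lambda>z. f z * g z)) z
      = (field_apply X ^^ k) (\<lambda>z. f z * field_apply X g z + field_apply X f z * g z) z"
    by (intro funpow_field_apply_cong field_apply_mult_near f g)
  moreover have "\<forall>\<^sub>F z in nhds p. (field_apply X ^^ k) (\<lambda>z. f z * field_apply X g z + field_apply X f z * g z) z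
      = (field_apply X ^^ k) (\<lambda>z. f z * field_apply X g z) z + (field_apply X ^^ k) (\<lambda>z. field_apply X f z * g z) z"
    by (intro funpow_field_apply_add_near X smooth_near_mult smooth_near_field_apply f g)
  ultimately show ?thesis
    by eventually_elim (simp add: funpow_swap1)
qed

lemma funpow_mult_mem:
  assumes X: "smooth_field_near p X"
  shows "\<lbrakk>smooth_near p f; smooth_near p g; \<And>j. j \<le> n \<Longrightarrow> (field_apply X ^^ j) f \<in> P\<rbrakk>
    \<Longrightarrow> (field_apply X ^^ n) (\<lambda>z. f z * g z) \<in> P"
proof (induction n arbitrary: f g)
  case 0
  then show ?case using mult[of f g] by simp
next
  case (Suc n)
  have "(field_apply X ^^ n) (\<lambda>z. f z * field_apply X g z) \<in> P"
    by (intro Suc.IH Suc.prems smooth_near_field_apply X) auto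
  moreover have "(field_apply X ^^ n) (\<lambda>z. field_apply X f z * g z) \<in> P"
  proof (intro Suc.IH Suc.prems smooth_near_field_apply X)
    fix j assume "j \<le> n"
    then show "(field_apply X ^^ j) (field_apply X f) \<in> P"
      using Suc.prems(3)[of "Suc j"] by (simp add: funpow_swap1)
  qed
  ultimately show ?case
    by (rule eq_near[OF add funpow_mult_split[OF X Suc.prems(1,2)]])
qed

text \<open>
  The product of the leading coefficients of two power series is the leading coefficient of their
  product. The number \<open>c\<close> is the binomial coefficient \<open>n choose a\<close>; only its positivity
  matters, and the induction adds it up by Pascal's rule.
\<close>

lemma funpow_mult_leading:
  assumes X: "smooth_field_near p X"
  shows "\<lbrakk>n = a + b; smooth_near p f; smooth_near p g; \<And>j. j < a \<Longrightarrow> (field_apply X ^^ j) f \<in> P;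
      \<And>j. j < b \<Longrightarrow> (field_apply X ^^ j) g \<in> P\<rbrakk>
    \<Longrightarrow> \<exists>c::nat. c > 0 \<and> (\<lambda>z. (field_apply X ^^ n) (\<lambda>z. f z * g z) z
        + (- of_nat c) * ((field_apply X ^^ a) f z * (field_apply X ^^ b) g z)) \<in> P"
proof (induction n arbitrary: a b f g)
  case 0
  then show ?case by (intro exI[of _ 1]) (simp add: zero)
next
  case (Suc n)
  let ?A = "field_apply X"
  let ?lead = "\<lambda>z. (?A ^^ a) f z * (?A ^^ b) g z"
  have s: "smooth_near p (?A f)" "smooth_near p (?A g)"
    using Suc.prems X by auto
  have split: "\<forall>\<^sub>F z in nhds p. (?A ^^ n) (\<lambda>z. f z * ?A g z) z
    + (?A ^^ n) (\<lambda>z. ?A f z * g z) z = (?A ^^ Suc n) (\<lambda>z. f z * g z) z"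
    by (rule funpow_mult_split[OF X Suc.prems(2,3)])
  have left: "\<exists>c::nat. (b > 0 \<longrightarrow> c > 0) \<and> (\<lambda>z. (?A ^^ n) (\<lambda>z. f z * ?A g z) z + (- of_nat c) * ?lead z) \<in> P"
  proof (cases b)
    case 0
    have "(?A ^^ n) (\<lambda>z. f z * ?A g z) \<in> P"
      using Suc.prems 0 by (intro funpow_mult_mem X s) auto
    then show ?thesis using 0 by (intro exI[of _ 0]) simp
  next
    case (Suc b')
    have "\<exists>c::nat. c > 0 \<and> (\<lambda>z. (?A ^^ n) (\<lambda>z. f z * ?A g z) z
        + (- of_nat c) * ((?A ^^ a) f z * (?A ^^ b') (?A g) z)) \<in> P"
    proof (intro Suc.IH s)
      show "(?A ^^ j) (?A g) \<in> P" if "j < b'" for j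
        using Suc.prems(5)[of "Suc j"] that Suc by (simp add: funpow_swap1)
    qed (use Suc.prems Suc in auto)
    then show ?thesis using Suc by (auto simp: funpow_swap1)
  qed
  have right: "\<exists>c::nat. (a > 0 \<longrightarrow> c > 0) \<and> (\<lambda>z. (?A ^^ n) (\<lambda>z. ?A f z * g z) z + (- of_nat c) * ?lead z) \<in> P"
  proof (cases a)
    case 0
    have "(?A ^^ n) (\<lambda>z. g z * ?A f z) \<in> P"
      using Suc.prems 0 by (intro funpow_mult_mem X s) auto
    then show ?thesis using 0 by (intro exI[of _ 0]) (simp add: mult.commute)
  next
    case (Suc a')
    have "\<exists>c::nat. c > 0 \<and> (\<lambda>z. (?A ^^ n) (\<lambda>z. ?A f z * g z) z
        + (- of_nat c) * ((?A ^^ a') (?A f) z * (?A ^^ b) g z)) \<in> P"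
    proof (intro Suc.IH s)
      show "(?A ^^ j) (?A f) \<in> P" if "j < a'" for j
        using Suc.prems(4)[of "Suc j"] that Suc by (simp add: funpow_swap1)
    qed (use Suc.prems Suc in auto)
    then show ?thesis using Suc by (auto simp: funpow_swap1)
  qed
  obtain c c' where c: "b > 0 \<longrightarrow> c > 0" "(\<lambda>z. (?A ^^ n) (\<lambda>z. f z * ?A g z) z + (- of_nat c) * ?lead z) \<in> P"
    and c': "a > 0 \<longrightarrow> c' > 0" "(\<lambda>z. (?A ^^ n) (\<lambda>z. ?A f z * g z) z + (- of_nat c') * ?lead z) \<in> P"
    using left right by (elim exE conjE) (rule that)
  have "(\<lambda>z. (?A ^^ Suc n) (\<lambda>z. f z * g z) z + (- of_nat (c + c')) * ?lead z) \<in> P"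
    by (rule eq_near[OF add[OF c(2) c'(2)]], rule eventually_mono[OF split]) (simp add: algebra_simps)
  moreover have "c + c' > 0" using c(1) c'(1) Suc.prems(1) by auto
  ultimately show ?case by blast
qed

lemma germ_prime_invariant_part:
  assumes "tangent_field M p X"
  shows "germ_prime M p (invariant_part p P X)"
proof
  have X: "smooth_field_near p X" using assms by (simp add: tangent_field_def)
  let ?A = "field_apply X"
  show "smooth_near p f" if "f \<in> invariant_part p P X" for f
    using that by (simp add: invariant_part_def)
  show "f \<in> invariant_part p P X" if f: "smooth_near p f" "vanishes_on M p f" for f
  proof -
    have "smooth_near p ((?A ^^ k) f) \<and> vanishes_on M p ((?A ^^ k) f)" for k
      using f assms by (induction k) (auto simp: tangent_field_def)
    then show ?thesis using f(1) vanishing by (simp add: invariant_part_def)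
  qed
  show "(\<lambda>z. f z + g z) \<in> invariant_part p P X" if "f \<in> invariant_part p P X" "g \<in> invariant_part p P X" for f g
  proof -
    have fg: "smooth_near p f" "smooth_near p g" "(?A ^^ k) f \<in> P" "(?A ^^ k) g \<in> P" for k
      using that by (auto simp: invariant_part_def)
    have "(?A ^^ k) (\<lambda>z. f z + g z) \<in> P" for k
      by (rule eq_near[OF add[OF fg(3,4)]],
          rule eventually_mono[OF funpow_field_apply_add_near[OF X fg(1,2)]], rule sym)
    then show ?thesis using fg by (auto simp: invariant_part_def)
  qed
  show "(\<lambda>z. f z * g z) \<in> invariant_part p P X" if "f \<in> invariant_part p P X" "smooth_near p g" for f g
    using that funpow_mult_mem[OF X] by (auto simp: invariant_part_def)
  show "f p = 0" if "f \<in> invariant_part p P X" for f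
    using that proper by (metis (mono_tags, lifting) funpow_0 invariant_part_def mem_Collect_eq)
  show "f \<in> invariant_part p P X \<or> g \<in> invariant_part p P X"
    if fg: "(\<lambda>z. f z * g z) \<in> invariant_part p P X" and f: "smooth_near p f" and g: "smooth_near p g" for f g
  proof (rule ccontr)
    assume not: "\<not> ?thesis"
    define a where "a = (LEAST j. (?A ^^ j) f \<notin> P)"
    define b where "b = (LEAST j. (?A ^^ j) g \<notin> P)"
    have ex: "\<exists>j. (?A ^^ j) f \<notin> P" "\<exists>j. (?A ^^ j) g \<notin> P"
      using not f g by (auto simp: invariant_part_def)
    have a: "(?A ^^ a) f \<notin> P" and b: "(?A ^^ b) g \<notin> P"
      unfolding a_def b_def by (rule LeastI_ex[OF ex(1)], rule LeastI_ex[OF ex(2)])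
    have "(?A ^^ j) f \<in> P" if "j < a" for j using not_less_Least that unfolding a_def by blast
    moreover have "(?A ^^ j) g \<in> P" if "j < b" for j using not_less_Least that unfolding b_def by blast
    ultimately obtain c :: nat where c: "c > 0" "(\<lambda>z. (?A ^^ (a + b)) (\<lambda>z. f z * g z) z
        + (- of_nat c) * ((?A ^^ a) f z * (?A ^^ b) g z)) \<in> P"
      using funpow_mult_leading[OF X refl f g, of a b] by blast
    have top: "(?A ^^ (a + b)) (\<lambda>z. f z * g z) \<in> P"
      using fg by (simp add: invariant_part_def)
    have s: "smooth_near p ((?A ^^ a) f)" "smooth_near p ((?A ^^ b) g)"
      using smooth_near_funpow_field_apply[OF X] f g by auto
    \<comment> \<open>Subtracting the two elements of \<open>P\<close> leaves the product of the leading coefficients.\<close>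
    have "(\<lambda>z. inverse (of_nat c) * ((?A ^^ (a + b)) (\<lambda>z. f z * g z) z
        + (- 1) * ((?A ^^ (a + b)) (\<lambda>z. f z * g z) z
        + (- of_nat c) * ((?A ^^ a) f z * (?A ^^ b) g z)))) \<in> P"
      by (intro mult_left add top c smooth_near_const)
    then have "(\<lambda>z. (?A ^^ a) f z * (?A ^^ b) g z) \<in> P"
      using c(1) by (simp add: mult.assoc[symmetric])
    then show False using prime[OF _ s] a b by blast
  qed
qed

end

lemma germ_prime_maximal:
  "p \<in> M \<Longrightarrow> germ_prime M p {f. smooth_near p f \<and> f p = 0}"
  by unfold_locales (auto simp: vanishes_on_def dest!: eventually_nhds_x_imp_x)

text \<open>
  The ideals obtained from the maximal ideal by flowing along fields in \<open>G\<close>, any number of times. For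
  fields of type (1,0) and (0,1) they are a formal counterpart of the ideals of functions vanishing
  on the iterated Segre sets.
\<close>

inductive_set germ_prime_chain :: "complex^'N::finite \<Rightarrow> 'N cfield set \<Rightarrow> (complex^'N \<Rightarrow> complex) set set"
  for p :: "complex^'N" and G :: "'N cfield set" where
  maximal: "{f. smooth_near p f \<and> f p = 0} \<in> germ_prime_chain p G"
| invariant: "P \<in> germ_prime_chain p G \<Longrightarrow> X \<in> G \<Longrightarrow> invariant_part p P X \<in> germ_prime_chain p G"

lemma germ_prime_chain_prime:
  assumes "p \<in> M" "\<And>X. X \<in> G \<Longrightarrow> tangent_field M p X" "P \<in> germ_prime_chain p G"
  shows "germ_prime M p P"
  using assms(3)
proof induction
  case maximal
  show ?case by (rule germ_prime_maximal[OF assms(1)])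
next
  case (invariant P X)
  show ?case
    by (rule germ_prime.germ_prime_invariant_part[OF invariant.IH assms(2)[OF invariant.hyps(2)]])
qed

definition flat_germs :: "complex^'N::finite \<Rightarrow> 'N cfield set \<Rightarrow> (complex^'N \<Rightarrow> complex) set" where
  "flat_germs p G = \<Inter> (germ_prime_chain p G)"

lemma flat_germs_generator:
  assumes "X \<in> G" "f \<in> flat_germs p G"
  shows "field_apply X f \<in> flat_germs p G"
proof -
  have "field_apply X f \<in> P" if "P \<in> germ_prime_chain p G" for P
  proof -
    have "f \<in> invariant_part p P X"
      using assms germ_prime_chain.invariant[OF that] by (auto simp: flat_germs_def)
    then have "(field_apply X ^^ Suc 0) f \<in> P" unfolding invariant_part_def by blast
    then show ?thesis by simp
  qed
  then show ?thesis by (simp add: flat_germs_def)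
qed

lemma
  assumes "f \<in> flat_germs p G"
  shows flat_germs_zero: "f p = 0" and flat_germs_smooth: "smooth_near p f"
proof -
  have "f \<in> {f. smooth_near p f \<and> f p = 0}"
    using assms unfolding flat_germs_def by (rule InterD) (rule germ_prime_chain.maximal)
  then show "f p = 0" "smooth_near p f" by simp_all
qed

lemma vector_apply_add_left: "vector_apply (\<xi> + \<eta>) f p = vector_apply \<xi> f p + vector_apply \<eta> f p"
  by (simp only: vector_apply_coord coord_add distrib_right sum.distrib)

lemma vector_apply_cscale: "vector_apply (cscale c \<xi>) f p = c * vector_apply \<xi> f p"
  by (simp only: vector_apply_coord coord_cscale sum_distrib_left mult.assoc)

lemma flat_germs_lie_algebra:
  assumes M: "p \<in> M" "\<And>X. X \<in> G \<Longrightarrow> tangent_field M p X" and "X \<in> generated_lie_algebra G"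
  shows "smooth_field_near p X \<and> (\<forall>f\<in>flat_germs p G. field_apply X f \<in> flat_germs p G)"
  using assms(3)
proof induction
  case (generator X)
  then show ?case using M flat_germs_generator by (auto simp: tangent_field_def)
next
  case (add X Y)
  have "field_apply (\<lambda>z. X z + Y z) f = (\<lambda>z. field_apply X f z + field_apply Y f z)" for f
    by (simp add: fun_eq_iff field_apply_def vector_apply_add_left)
  moreover have "smooth_field_near p (\<lambda>z. X z + Y z)"
    using add by (auto simp: smooth_field_near_def coord_add)
  ultimately show ?case
    using add germ_prime.add[OF germ_prime_chain_prime[OF M]] by (auto simp: flat_germs_def)
next
  case (scale X c)
  have "field_apply (\<lambda>z. cscale c (X z)) f = (\<lambda>z. c * field_apply X f z)" for f
    by (simp add: fun_eq_iff field_apply_def vector_apply_cscale)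
  moreover have "smooth_field_near p (\<lambda>z. cscale c (X z))"
    using scale by (auto simp: smooth_field_near_def coord_cscale)
  ultimately show ?case
    using scale germ_prime.mult_left[OF germ_prime_chain_prime[OF M]] by (auto simp: flat_germs_def)
next
  case (bracket X Y)
  have "field_apply (lie_bracket X Y) f \<in> P" if f: "f \<in> flat_germs p G" and P: "P \<in> germ_prime_chain p G" for f P
  proof -
    interpret germ_prime M p P by (rule germ_prime_chain_prime[OF M P])
    have "\<forall>\<^sub>F z in nhds p. smooth_field_near z X" "\<forall>\<^sub>F z in nhds p. smooth_field_near z Y"
      using bracket.IH unfolding smooth_field_near_def
      by (auto intro!: eventually_all_finite smooth_near_eventually)
    moreover have "\<forall>\<^sub>F z in nhds p. smooth_near z f"
      by (rule smooth_near_eventually[OF flat_germs_smooth[OF f]])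
    ultimately have near: "\<forall>\<^sub>F z in nhds p. field_apply X (field_apply Y f) z
        + (- 1) * field_apply Y (field_apply X f) z = field_apply (lie_bracket X Y) f z"
      by eventually_elim (simp add: field_apply_lie_bracket_at)
    have "field_apply X (field_apply Y f) \<in> P" "field_apply Y (field_apply X f) \<in> P"
      using bracket.IH f P by (auto simp: flat_germs_def)
    then have "(\<lambda>z. field_apply X (field_apply Y f) z + (- 1) * field_apply Y (field_apply X f) z) \<in> P"
      by (intro add mult_left smooth_near_const)
    from eq_near[OF this near] show ?thesis .
  qed
  then show ?case
    using bracket.IH smooth_field_near_lie_bracket by (auto simp: flat_germs_def)
qed

text \<open>
  The fields \<open>Y k\<close> act on a holomorphic function through the matrix of their (1,0) components, which is
  invertible at \<open>p\<close>. By Cramer's rule a multiple of \<open>dZ l f\<close> by a unit is a determinant with the column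
  \<open>Y k f\<close>, whose entries lie in all the ideals of the chain.
\<close>

lemma flat_germs_dZ:
  assumes M: "p \<in> M" "\<And>X. X \<in> G \<Longrightarrow> tangent_field M p X"
    and Y: "\<And>k. Y k \<in> generated_lie_algebra G" "\<And>k. fst (Y k p) = axis k 1"
    and f: "f \<in> flat_germs p G" "open U" "p \<in> U" "holo_on U f"
  shows "dZ l f \<in> flat_germs p G"
proof -
  define A :: "complex^'a \<Rightarrow> complex^'a^'a" where "A z = (\<chi> k j. fst (Y k z) $ j)" for z
  have Ys: "smooth_field_near p (Y k)" "field_apply (Y k) f \<in> flat_germs p G" for k
    using flat_germs_lie_algebra[OF M Y(1)] f(1) by auto
  have As: "smooth_near p (\<lambda>z. A z $ k $ j)" for k j
    using Ys(1)[of k, unfolded smooth_field_near_def, THEN spec[of _ "(j, True)"]]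
    by (simp add: A_def coord_def)
  have "A p = mat 1" by (simp add: A_def Y(2) vec_eq_iff mat_def axis_def eq_commute)
  then have det1: "det (A p) \<noteq> 0" by simp
  have Yf: "field_apply (Y k) f z = (A z *v (\<chi> j. dZ j f z)) $ k" if "z \<in> U" for z k
    using f(4) that
    by (simp add: field_apply_def vector_apply_def holo_on_def A_def matrix_vector_mult_def)
  have smf: "smooth_near p f" "smooth_near p (dZ l f)"
    using holo_on_smooth_near[OF f(2) _ f(3)] f(4) holo_on_dZ[OF f(2,4)] by auto
  have "dZ l f \<in> P" if P: "P \<in> germ_prime_chain p G" for P
  proof -
    interpret germ_prime M p P by (rule germ_prime_chain_prime[OF M P])
    define C where "C z = (\<chi> i j. if j = l then field_apply (Y i) f z else A z $ i $ j)" for z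
    have "(\<lambda>z. det (C z)) \<in> P"
    proof (rule det_column[of _ l])
      show "(\<lambda>z. C z $ i $ l) \<in> P" for i
        using Ys(2)[of i] P by (simp add: C_def flat_germs_def)
      show "smooth_near p (\<lambda>z. C z $ i $ j)" for i j
        using As Ys(1) smf(1) by (cases "j = l") (auto simp: C_def)
    qed
    moreover have "\<forall>\<^sub>F z in nhds p. det (C z) = det (A z) * dZ l f z"
    proof -
      have "det (C z) = det (A z) * dZ l f z" if "z \<in> U" for z
        using cramer_lemma[where A = "A z" and k = l and x = "\<chi> j. dZ j f z"]
        by (simp only: C_def Yf[OF that] vec_lambda_beta mult.commute)
      then show ?thesis
        using eventually_nhds_in_open[OF f(2,3)] by (auto elim: eventually_mono)
    qed
    ultimately have "(\<lambda>z. det (A z) * dZ l f z) \<in> P" by (rule eq_near)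
    then show ?thesis
      by (rule cancel_unit[OF _ smooth_near_det[OF As] det1 smf(2)])
  qed
  then show ?thesis by (simp add: flat_germs_def)
qed

lemma holomorphic_flat_germ_zero:
  assumes M: "p \<in> M" "\<And>X. X \<in> G \<Longrightarrow> tangent_field M p X"
    and Y: "\<And>k. Y k \<in> generated_lie_algebra G" "\<And>k. fst (Y k p) = axis k 1"
    and f: "f \<in> flat_germs p G" "open U" "p \<in> U" "holo_on U f"
  shows "\<forall>\<^sub>F z in nhds p. f z = 0"
proof -
  have "(line_deriv v ^^ n) f \<in> flat_germs p G \<and> holo_on U ((line_deriv v ^^ n) f)" for v n
  proof (induction n)
    case (Suc n)
    let ?g = "(line_deriv v ^^ n) f"
    have "line_deriv v ?g \<in> P" if P: "P \<in> germ_prime_chain p G" for P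
    proof -
      interpret germ_prime M p P by (rule germ_prime_chain_prime[OF M P])
      have "dZ k ?g \<in> P" for k
        using flat_germs_dZ[OF M Y _ f(2,3), of ?g k] Suc P by (auto simp: flat_germs_def)
      then have "(\<lambda>z. \<Sum>k\<in>UNIV. v $ k * dZ k ?g z) \<in> P"
        by (intro sum mult_left smooth_near_const finite)
      moreover have "line_deriv v ?g = (\<lambda>z. \<Sum>k\<in>UNIV. v $ k * dZ k ?g z)"
        by (simp add: fun_eq_iff line_deriv_def)
      ultimately show ?thesis by simp
    qed
    then show ?case using Suc holo_on_line_deriv[OF f(2)] by (auto simp: flat_germs_def)
  qed (use f in auto)
  then have zero: "(line_deriv v ^^ n) f p = 0" for v n
    using flat_germs_zero by blast
  obtain R where R: "R > 0" "ball p R \<subseteq> U" by (rule openE[OF f(2,3)])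
  have "f z = 0" if "z \<in> ball p R" for z
    by (rule holo_identity_theorem[OF holo_on_subset[OF f(4) R(2)] zero that])
  moreover have "\<forall>\<^sub>F z in nhds p. z \<in> ball p R"
    using R(1) by (intro eventually_nhds_in_open) auto
  ultimately show ?thesis by (auto elim: eventually_mono)
qed

text \<open>
  When passing from \<open>P\<close> to \<open>invariant_part p P X\<close>, whichever of \<open>J\<close> and its conjugate is annihilated by \<open>X\<close>
  stays in the ideal, and the hypothesis on prime ideals brings the other one along.
\<close>

lemma flat_germs_mem:
  assumes M: "p \<in> M" "\<And>X. X \<in> G \<Longrightarrow> tangent_field M p X"
    and J: "smooth_near p J" "J p = 0"
    and cases: "\<And>X. X \<in> G \<Longrightarrow> vanishes_on M p (field_apply X J) \<or> vanishes_on M p (field_apply X (\<lambda>z. cnj (J z)))"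
    and equiv: "\<And>P. germ_prime M p P \<Longrightarrow> J \<in> P \<longleftrightarrow> (\<lambda>z. cnj (J z)) \<in> P"
  shows "J \<in> flat_germs p G"
proof -
  have "J \<in> P" if "P \<in> germ_prime_chain p G" for P
    using that
  proof induction
    case maximal
    then show ?case using J by simp
  next
    case (invariant P X)
    interpret P: germ_prime M p P by (rule germ_prime_chain_prime[OF M invariant(1)])
    have PX: "germ_prime M p (invariant_part p P X)"
      by (rule P.germ_prime_invariant_part[OF M(2)[OF invariant(2)]])
    have X: "tangent_field M p X" by (rule M(2)[OF invariant(2)])
    have *: "g \<in> invariant_part p P X" if g: "smooth_near p g" "g \<in> P" "vanishes_on M p (field_apply X g)" for g
    proof -
      have "smooth_near p ((field_apply X ^^ Suc k) g) \<and> vanishes_on M p ((field_apply X ^^ Suc k) g)" for k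
        using g X by (induction k) (auto simp: tangent_field_def)
      then have "(field_apply X ^^ k) g \<in> P" for k
        using P.vanishing g(2) by (cases k) auto
      then show ?thesis using g(1) by (simp add: invariant_part_def)
    qed
    have JP: "(\<lambda>z. cnj (J z)) \<in> P" using equiv[OF P.germ_prime_axioms] invariant.IH by simp
    from cases[OF invariant(2)] show ?case
    proof
      assume "vanishes_on M p (field_apply X J)"
      then show ?thesis by (rule *[OF J(1) invariant.IH])
    next
      assume "vanishes_on M p (field_apply X (\<lambda>z. cnj (J z)))"
      then have "(\<lambda>z. cnj (J z)) \<in> invariant_part p P X"
        by (intro * JP smooth_near_cnj J(1))
      then show ?thesis using equiv[OF PX] by simp
    qed
  qed
  then show ?thesis by (simp add: flat_germs_def)
qed

section \<open>Frames adapted to a generic submanifold\<close>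

text \<open>Exchanging the two equal forms changes the sign of each summand and preserves the sum.\<close>

lemma wedge_repeated_form:
  assumes "a < d" "b < d" "a \<noteq> b" "\<omega> a = \<omega> b"
  shows "wedge d \<omega> v = 0"
proof -
  let ?\<tau> = "Transposition.transpose a b"
  define F where "F \<pi> = (of_int (sign \<pi>) * (\<Prod>j<d. \<omega> j (v (\<pi> j))) :: complex)" for \<pi> :: "nat \<Rightarrow> nat"
  have \<tau>: "?\<tau> permutes {..<d}"
    by (rule permutes_swap_id) (use assms(1,2) in simp_all)
  have "F (\<pi> \<circ> ?\<tau>) = - F \<pi>" if \<pi>: "\<pi> permutes {..<d}" for \<pi>
  proof -
    have "permutation \<pi>" "permutation ?\<tau>"
      by (rule permutes_imp_permutation[OF finite_lessThan \<pi>], rule permutes_imp_permutation[OF finite_lessThan \<tau>])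
    then have "sign (\<pi> \<circ> ?\<tau>) = - sign \<pi>"
      using assms(3) by (simp add: sign_compose sign_swap_id)
    moreover have "\<omega> (?\<tau> j) = \<omega> j" for j
      using assms(4) by (simp add: Transposition.transpose_def)
    then have "(\<Prod>j<d. \<omega> j (v ((\<pi> \<circ> ?\<tau>) j))) = (\<Prod>j<d. \<omega> j (v (\<pi> j)))"
      by (subst (2) prod.permute[OF \<tau>]) (simp add: o_def)
    ultimately show ?thesis by (simp add: F_def)
  qed
  then have "(\<Sum>\<pi> | \<pi> permutes {..<d}. F (\<pi> \<circ> ?\<tau>)) = (\<Sum>\<pi> | \<pi> permutes {..<d}. - F \<pi>)"
    by (intro sum.cong) auto
  moreover have "(\<Sum>\<pi> | \<pi> permutes {..<d}. F (\<pi> \<circ> ?\<tau>)) = (\<Sum>\<pi> | \<pi> permutes {..<d}. F \<pi>)"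
    by (rule sum_permutations_compose_right[OF \<tau>, symmetric])
  ultimately have "(\<Sum>\<pi> | \<pi> permutes {..<d}. F \<pi>) = 0"
    by (simp add: sum_negf)
  then show ?thesis by (simp add: wedge_def F_def)
qed

lemma wedge_linear:
  assumes "a < d" "finite I"
  shows "wedge d (fun_upd \<omega> a (\<lambda>u. \<Sum>i\<in>I. c i * \<eta> i u)) v = (\<Sum>i\<in>I. c i * wedge d (fun_upd \<omega> a (\<eta> i)) v)"
proof -
  have split: "(\<Prod>j<d. (fun_upd \<omega> a \<theta>) j (v (\<pi> j))) = \<theta> (v (\<pi> a)) * (\<Prod>j\<in>{..<d} - {a}. \<omega> j (v (\<pi> j)))"
    for \<theta> and \<pi> :: "nat \<Rightarrow> nat"
    using assms(1) by (subst prod.remove[of _ a]) auto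
  show ?thesis
    unfolding wedge_def split
    by (subst sum_distrib_left, subst sum.swap)
      (simp add: sum_distrib_left sum_distrib_right mult_ac)
qed

lemma wedge_nonzero_imp_independent:
  assumes "wedge d \<omega> \<noteq> (\<lambda>v. 0)" and dep: "\<And>u. (\<Sum>j<d. c j * \<omega> j u) = 0" and "a < d"
  shows "c a = 0"
proof (rule ccontr)
  assume ca: "c a \<noteq> 0"
  define I where "I = {..<d} - {a}"
  have "\<omega> a u = (\<Sum>j\<in>I. - (c j / c a) * \<omega> j u)" for u
  proof -
    have "c a * \<omega> a u + (\<Sum>j\<in>I. c j * \<omega> j u) = 0"
      using dep[of u] assms(3) by (simp add: I_def sum.remove[of _ a])
    then have "\<omega> a u = - (\<Sum>j\<in>I. c j * \<omega> j u) / c a"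
      using ca by (simp add: field_simps eq_neg_iff_add_eq_0)
    then show ?thesis by (simp add: sum_divide_distrib sum_negf)
  qed
  then have \<omega>: "\<omega> = fun_upd \<omega> a (\<lambda>u. \<Sum>j\<in>I. - (c j / c a) * \<omega> j u)"
    by (simp add: fun_eq_iff)
  have "wedge d \<omega> v = 0" for v
  proof -
    have "wedge d (fun_upd \<omega> a (\<omega> j)) v = 0" if "j \<in> I" for j
      using that assms(3) by (intro wedge_repeated_form[of a d j]) (auto simp: I_def)
    then show ?thesis
      by (subst \<omega>) (simp only: wedge_linear[OF assms(3)] I_def finite_Diff finite_lessThan, simp)
  qed
  then show False using assms(1) by (simp add: fun_eq_iff)
qed

text \<open>
  Independent vectors are part of a basis, which has \<open>CARD('N)\<close> elements; the injection \<open>e\<close> decides at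
  which rows of the matrix they are placed. Using the same \<open>e\<close> for two families makes their matrices
  comparable.
\<close>

lemma independent_family_completion:
  fixes g :: "nat \<Rightarrow> complex^'N::finite"
  assumes indep: "\<And>c a. \<lbrakk>(\<Sum>j<d. c j *s g j) = 0; a < d\<rbrakk> \<Longrightarrow> c a = 0"
  shows "d \<le> CARD('N)"
    and "inj_on e {..<d} \<Longrightarrow>
      \<exists>b. det (\<chi> i. if i \<in> e ` {..<d} then g (the_inv_into {..<d} e i) else b i) \<noteq> 0"
proof -
  have inj: "inj_on g {..<d}"
  proof (rule inj_onI, rule ccontr)
    fix j j' assume j: "j \<in> {..<d}" "j' \<in> {..<d}" "g j = g j'" "j \<noteq> j'"
    let ?c = "\<lambda>i. if i = j then 1 else if i = j' then - 1 else (0::complex)"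
    have "(\<Sum>i<d. ?c i *s g i) = (\<Sum>i<d. (if i = j then g j else 0) + (if i = j' then - g j' else 0))"
      using j(4) by (intro sum.cong) auto
    also have "\<dots> = 0" using j by (simp add: sum.distrib)
    finally show False using indep[of ?c j] j by simp
  qed
  let ?S = "g ` {..<d}"
  have ind: "vec.independent ?S"
  proof
    assume "vec.dependent ?S"
    then obtain u where u: "\<exists>v\<in>?S. u v \<noteq> 0" "(\<Sum>v\<in>?S. u v *s v) = 0"
      using vec.dependent_finite[of ?S] by auto
    have "(\<Sum>j<d. u (g j) *s g j) = 0"
      using u(2) by (simp add: sum.reindex[OF inj])
    then show False using indep[of "\<lambda>j. u (g j)"] u(1) by auto
  qed
  obtain T where T: "?S \<subseteq> T" "vec.independent T" "UNIV \<subseteq> vec.span T"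
    using vec.maximal_independent_subset_extend[OF subset_UNIV ind] by metis
  have finT: "finite T" using T(2) by (rule vec.finiteI_independent)
  have cardT: "card T = CARD('N)"
  proof -
    have "card T = vec.dim (UNIV :: (complex^'N) set)"
      by (rule vec.basis_card_eq_dim) (use T in auto)
    then show ?thesis by (simp only: vec_dim_card)
  qed
  have cardS: "card ?S = d" using inj by (simp add: card_image)
  show "d \<le> CARD('N)"
    using card_mono[OF finT T(1)] cardS cardT by simp
  assume e: "inj_on e {..<d}"
  let ?E = "e ` {..<d}"
  have "card (- ?E) = CARD('N) - d"
    using e by (simp add: Compl_eq_Diff_UNIV card_Diff_subset card_image)
  moreover have "card (T - ?S) = CARD('N) - d"
    using card_Diff_subset[OF _ T(1)] cardS cardT by simp
  ultimately have "card (- ?E) = card (T - ?S)" by simp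
  from finite_same_card_bij[OF finite finite_Diff[OF finT] this]
  obtain b where b: "bij_betw b (- ?E) (T - ?S)" ..
  let ?A = "\<chi> i. if i \<in> ?E then g (the_inv_into {..<d} e i) else b i"
  have "T \<subseteq> rows ?A"
  proof
    fix v assume v: "v \<in> T"
    show "v \<in> rows ?A"
    proof (cases "v \<in> ?S")
      case True
      then obtain j where "j < d" "v = g j" by auto
      then have "v = row (e j) ?A"
        using the_inv_into_f_f[OF e, of j] by (simp add: row_def vec_eq_iff)
      then show ?thesis by (auto simp: rows_def)
    next
      case False
      then have "v \<in> b ` (- ?E)"
        using v b by (simp add: bij_betw_def)
      then obtain i where "i \<notin> ?E" "v = b i" by blast
      then have "v = row i ?A" by (simp add: row_def vec_eq_iff)
      then show ?thesis by (auto simp: rows_def)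
    qed
  qed
  then have "vec.span (rows ?A) = UNIV"
    using T(3) vec.span_mono by blast
  then have "\<exists>B. B ** ?A = mat 1"
    by (simp only: matrix_left_invertible_span_rows_gen)
  then have "det ?A \<noteq> 0"
    by (simp only: invertible_det_nz[symmetric] invertible_left_inverse)
  then show "\<exists>b. det (\<chi> i. if i \<in> e ` {..<d} then g (the_inv_into {..<d} e i) else b i) \<noteq> 0"
    by (rule exI[of _ b])
qed

text \<open>
  From here on the defining functions \<open>r i\<close> are indexed by a subset \<open>E\<close> of the index type, so that
  determinants of \<open>CARD('N) \<times> CARD('N)\<close> matrices apply. In a \<open>defining_frame\<close> the constant rows \<open>b\<close> complete
  their gradients to a matrix that is invertible at the base point, and hence nearby.
\<close>

definition frame ::
  "'N set \<Rightarrow> ('N \<Rightarrow> complex^'N::finite \<Rightarrow> real) \<Rightarrow> ('N \<Rightarrow> complex^'N) \<Rightarrow> complex^'N \<Rightarrow> complex^'N^'N" where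
  "frame E r b z = (\<chi> i. if i \<in> E then grad_Z (r i) z else b i)"

definition defining_frame ::
  "'N set \<Rightarrow> ('N \<Rightarrow> complex^'N::finite \<Rightarrow> real) \<Rightarrow> ('N \<Rightarrow> complex^'N) \<Rightarrow> (complex^'N) set \<Rightarrow> complex^'N \<Rightarrow> bool" where
  "defining_frame E r b M p \<longleftrightarrow> p \<in> M \<and> det (frame E r b p) \<noteq> 0 \<and>
     (\<exists>U. open U \<and> p \<in> U \<and> (\<forall>i\<in>E. smooth_on U (r i)) \<and> M \<inter> U = {z\<in>U. \<forall>i\<in>E. r i z = 0})"

lemma generic_independent_gradients:
  assumes "generic_defining_function d \<rho> M p" "(\<Sum>j<d. c j *s grad_Z (\<rho> j) p) = 0" "a < d"
  shows "c a = 0"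
proof (rule wedge_nonzero_imp_independent[where \<omega> = "\<lambda>j. del_form (\<rho> j) p" and d = d])
  show "wedge d (\<lambda>j. del_form (\<rho> j) p) \<noteq> (\<lambda>v. 0)"
    using assms(1) by (simp add: generic_defining_function_def)
  show "(\<Sum>j<d. c j * del_form (\<rho> j) p u) = 0" for u
  proof -
    have "(\<Sum>j<d. c j * del_form (\<rho> j) p u) = (\<Sum>k\<in>UNIV. \<Sum>j<d. c j * (grad_Z (\<rho> j) p $ k * u $ k))"
      unfolding del_form_def sum_distrib_left by (rule sum.swap)
    also have "\<dots> = (\<Sum>k\<in>UNIV. (\<Sum>j<d. c j *s grad_Z (\<rho> j) p) $ k * u $ k)"
      by (simp add: sum_distrib_right mult.assoc)
    also have "\<dots> = 0" by (simp only: assms(2)) simp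
    finally show ?thesis .
  qed
qed (rule assms(3))

lemma generic_codimension_le:
  fixes M :: "(complex^'N::finite) set"
  assumes "generic_defining_function d \<rho> M p"
  shows "d \<le> CARD('N)"
  by (rule independent_family_completion(1)[where d = d and g = "\<lambda>j. grad_Z (\<rho> j) p"])
    (rule generic_independent_gradients[OF assms])

lemma generic_defining_frame:
  fixes M :: "(complex^'N::finite) set"
  assumes "generic_defining_function d \<rho> M p" "inj_on e {..<d}"
  shows "\<exists>b. defining_frame (e ` {..<d}) (\<lambda>i. \<rho> (the_inv_into {..<d} e i)) b M p"
proof -
  let ?r = "\<lambda>i. \<rho> (the_inv_into {..<d} e i)"
  have "\<exists>b. det (\<chi> i. if i \<in> e ` {..<d} then grad_Z (\<rho> (the_inv_into {..<d} e i)) p else b i) \<noteq> 0"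
    by (rule independent_family_completion(2)[where d = d and g = "\<lambda>j. grad_Z (\<rho> j) p", OF _ assms(2)])
      (rule generic_independent_gradients[OF assms(1)])
  then obtain b where b: "det (frame (e ` {..<d}) ?r b p) \<noteq> 0"
    unfolding frame_def ..
  from assms(1) obtain U where U: "open U \<and> p \<in> U \<and> (\<forall>j<d. smooth_on U (\<rho> j)) \<and>
      M \<inter> U = {p \<in> U. \<forall>j<d. \<rho> j p = 0}" and pM: "p \<in> M"
    unfolding generic_defining_function_def by (elim exE conjE) (rule that, intro conjI)
  have e: "the_inv_into {..<d} e (e j) = j" if "j < d" for j
    using the_inv_into_f_f[OF assms(2)] that by simp
  have "open U \<and> p \<in> U \<and> (\<forall>i\<in>e ` {..<d}. smooth_on U (?r i)) \<and>
      M \<inter> U = {z\<in>U. \<forall>i\<in>e ` {..<d}. ?r i z = 0}"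
    using U e by auto
  then show ?thesis
    unfolding defining_frame_def using b pM by blast
qed

lemma dZbar_real:
  assumes "r differentiable (at p)"
  shows "dZbar k (\<lambda>z. complex_of_real (r z)) p = cnj (grad_Z r p $ k)"
proof -
  have "dir_deriv v (\<lambda>z. complex_of_real (r z)) p = complex_of_real (dir_deriv v r p)" for v
    by (rule dir_deriv_bounded_linear[OF bounded_linear_of_real assms])
  then show ?thesis by (simp add: dZbar_def grad_Z_def dZ_def)
qed

lemma dir_deriv_real:
  assumes "r differentiable (at p)"
  shows "dir_deriv v r p = 2 * Re (\<Sum>k\<in>UNIV. grad_Z r p $ k * v $ k)"
proof -
  let ?R = "\<lambda>z. complex_of_real (r z)"
  have R: "?R differentiable (at p)"
    by (rule differentiableI[OF bounded_linear.has_derivative[OF bounded_linear_of_real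
            assms[unfolded frechet_derivative_works]]])
  have "complex_of_real (dir_deriv v r p) = dir_deriv v ?R p"
    by (rule dir_deriv_bounded_linear[OF bounded_linear_of_real assms, symmetric])
  also have "\<dots> = (\<Sum>k\<in>UNIV. v $ k * grad_Z r p $ k + cnj (v $ k) * cnj (grad_Z r p $ k))"
    unfolding dir_deriv_wirtinger[OF R] dZbar_real[OF assms] by (simp add: grad_Z_def)
  also have "\<dots> = (\<Sum>k\<in>UNIV. of_real (2 * Re (grad_Z r p $ k * v $ k)))"
    by (intro sum.cong) (simp_all add: complex_eq_iff)
  also have "\<dots> = of_real (2 * Re (\<Sum>k\<in>UNIV. grad_Z r p $ k * v $ k))"
    by (simp only: of_real_sum[symmetric] sum_distrib_left[symmetric] Re_sum)
  finally show ?thesis by (simp only: of_real_eq_iff)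
qed

lemma smooth_on_differentiable: "smooth_on U f \<Longrightarrow> x \<in> U \<Longrightarrow> f differentiable (at x)"
  unfolding smooth_on_def by (metis differentiable_upto.simps(2))

lemma smooth_on_dir_deriv_continuous: "smooth_on U f \<Longrightarrow> continuous_on U (dir_deriv v f)"
  unfolding smooth_on_def by (metis differentiable_upto.simps)

lemma defining_frame_dual_vectors:
  assumes "defining_frame E r b M p"
  shows "\<exists>u. \<forall>i\<in>E. \<forall>j. dir_deriv (u j) (r i) p = (if i = j then 1 else 0)"
proof -
  have "det (frame E r b p) \<noteq> 0" and diff: "\<forall>i\<in>E. r i differentiable (at p)"
    using assms by (auto simp: defining_frame_def smooth_on_differentiable)
  then obtain C where C: "frame E r b p ** C = mat 1"
    using invertible_det_nz invertible_right_inverse by blast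
  have "dir_deriv (C *v axis j (1/2)) (r i) p = (if i = j then 1 else 0)" if i: "i \<in> E" for i j
  proof -
    have "(\<Sum>k\<in>UNIV. grad_Z (r i) p $ k * (C *v axis j (1/2)) $ k)
        = (frame E r b p *v (C *v axis j (1/2))) $ i"
      using i by (simp add: frame_def matrix_vector_mult_def[of "vec_lambda _"])
    also have "\<dots> = (axis j (1/2) :: complex^'a) $ i" by (simp add: matrix_vector_mul_assoc C)
    finally show ?thesis by (simp add: dir_deriv_real[OF bspec[OF diff i]] axis_def)
  qed
  then show ?thesis by (intro exI[of _ "\<lambda>j. C *v axis j (1/2)"]) blast
qed

text \<open>
  The map \<open>\<Phi>\<close> straightens \<open>M\<close>: the differential \<open>L i\<close> of \<open>r i\<close> at \<open>p\<close> takes at \<open>\<Phi> x\<close> the value \<open>r i x\<close>. The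
  inverse image under \<open>\<Phi>\<close> of a line in a tangential direction is therefore a curve in \<open>M\<close>, along which
  \<open>f\<close> vanishes.
\<close>

lemma derivative_along_tangent_vector:
  fixes M :: "(complex^'N::finite) set" and f :: "complex^'N \<Rightarrow> complex"
  assumes frame: "defining_frame E r b M p" and f: "f differentiable (at p)" "vanishes_on M p f"
    and v: "\<And>i. i \<in> E \<Longrightarrow> dir_deriv v (r i) p = 0"
  shows "dir_deriv v f p = 0"
proof -
  obtain U where U: "open U" "p \<in> U" "\<And>i. i \<in> E \<Longrightarrow> smooth_on U (r i)"
    "M \<inter> U = {z\<in>U. \<forall>i\<in>E. r i z = 0}"
    using frame unfolding defining_frame_def by (elim exE conjE) (rule that, auto)
  have pM: "p \<in> M" using frame by (simp add: defining_frame_def)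
  define L where "L i v = dir_deriv v (r i) p" for i v
  have rd: "r i differentiable (at x)" if "i \<in> E" "x \<in> U" for i x
    using smooth_on_differentiable U(3) that by blast
  have L_lin: "linear (L i)" if "i \<in> E" for i
    unfolding L_def by (rule linear_frechet_derivative[OF rd[OF that U(2)]])
  from defining_frame_dual_vectors[OF frame] obtain u where
    u: "\<forall>i\<in>E. \<forall>j. dir_deriv (u j) (r i) p = (if i = j then 1 else 0)" ..
  then have Lu: "L i (u j) = (if i = j then 1 else 0)" if "i \<in> E" for i j
    using that by (simp add: L_def)
  \<comment> \<open>\<open>u\<close> is dual to \<open>L\<close>, so the correction replaces the value \<open>L i x\<close> by \<open>r i x\<close>.\<close>
  define \<Phi> where "\<Phi> x = x + (\<Sum>i\<in>E. (r i x - L i x) *\<^sub>R u i)" for x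
  have L\<Phi>: "L i (\<Phi> x) = r i x" if "i \<in> E" for i x
  proof -
    have "L i (\<Phi> x) = L i x + (\<Sum>j\<in>E. (r j x - L j x) * L i (u j))"
      unfolding \<Phi>_def by (simp add: linear_add[OF L_lin] linear_sum[OF L_lin] linear_scale[OF L_lin] that)
    also have "\<dots> = L i x + (\<Sum>j\<in>E. if i = j then r j x - L j x else 0)"
      using Lu[OF that] by (intro arg_cong[where f = "\<lambda>y. L i x + y"] sum.cong) auto
    finally show ?thesis using that by simp
  qed
  have D\<Phi>: "(\<Phi> has_derivative (\<lambda>w. w + (\<Sum>i\<in>E. (dir_deriv w (r i) x - L i w) *\<^sub>R u i))) (at x)"
    if "x \<in> U" for x
    unfolding \<Phi>_def
    using that rd L_lin
    by (intro has_derivative_add has_derivative_ident has_derivative_sum has_derivative_scaleR_left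
        has_derivative_diff linear_imp_has_derivative) (simp_all add: frechet_derivative_works[symmetric])
  have frechet: "frechet_derivative \<Phi> (at x) = (\<lambda>w. w + (\<Sum>i\<in>E. (dir_deriv w (r i) x - L i w) *\<^sub>R u i))"
    if "x \<in> U" for x
    by (rule frechet_derivative_at[OF D\<Phi>[OF that], symmetric])
  have id: "frechet_derivative \<Phi> (at p) = id"
    unfolding frechet[OF U(2)] by (simp add: L_def id_def)
  have cont: "continuous_on U (dir_deriv w \<Phi>)" for w
  proof (rule continuous_on_eq)
    show "continuous_on U (\<lambda>x. w + (\<Sum>i\<in>E. (dir_deriv w (r i) x - L i w) *\<^sub>R u i))"
      using U(3) by (intro continuous_intros smooth_on_dir_deriv_continuous)
  qed (simp add: frechet)
  have inj: "inj (frechet_derivative \<Phi> (at p))" by (simp add: id)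
  show ?thesis
  proof (rule inverse_function_C1[OF U(1,2) differentiableI[OF D\<Phi>] cont inj])
    fix U' V g
    assume G: "open U'" "U' \<subseteq> U" "p \<in> U'" "open V" "\<Phi> p \<in> V" "\<Phi> ` U' = V" "g ` V = U'"
      "\<And>x. x \<in> U' \<Longrightarrow> g (\<Phi> x) = x" "\<And>y. y \<in> V \<Longrightarrow> \<Phi> (g y) = y"
      "\<And>y. y \<in> V \<Longrightarrow> (g has_derivative inv (frechet_derivative \<Phi> (at (g y)))) (at y)"
    define \<gamma> where "\<gamma> t = g (\<Phi> p + t *\<^sub>R v)" for t
    have \<gamma>0: "\<gamma> 0 = p" using G(3,8) by (simp add: \<gamma>_def)
    have "(g has_derivative id) (at (\<Phi> p + 0 *\<^sub>R v))"
      using G(10)[OF G(5)] G(8)[OF G(3)] by (simp add: id)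
    moreover have "((\<lambda>t. \<Phi> p + t *\<^sub>R v) has_derivative (\<lambda>t. t *\<^sub>R v)) (at 0)"
      by (auto intro!: derivative_eq_intros)
    ultimately have \<gamma>': "(\<gamma> has_derivative (\<lambda>t. t *\<^sub>R v)) (at 0)"
      unfolding \<gamma>_def using has_derivative_compose[of "\<lambda>t. \<Phi> p + t *\<^sub>R v" _ 0 UNIV g id] by simp
    have f\<gamma>: "((\<lambda>t. f (\<gamma> t)) has_derivative (\<lambda>t. dir_deriv (t *\<^sub>R v) f p)) (at 0)"
      using has_derivative_compose[OF \<gamma>', of f] f(1) \<gamma>0 by (simp add: frechet_derivative_works)
    have "\<forall>\<^sub>F t in nhds 0. \<Phi> p + t *\<^sub>R v \<in> V"
    proof -
      have "((\<lambda>t. \<Phi> p + t *\<^sub>R v) \<longlongrightarrow> \<Phi> p + 0 *\<^sub>R v) (nhds 0)"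
        by (intro tendsto_intros filterlim_ident)
      then show ?thesis using G(4,5) topological_tendstoD by fastforce
    qed
    moreover have "\<forall>\<^sub>F t in nhds 0. \<gamma> t \<in> M \<longrightarrow> f (\<gamma> t) = 0"
    proof -
      have "isCont \<gamma> 0" using \<gamma>' has_derivative_continuous by blast
      then have "(\<gamma> \<longlongrightarrow> p) (nhds 0)"
        using \<gamma>0 by (simp add: isCont_def tendsto_nhds_iff)
      then have "filterlim \<gamma> (nhds p) (nhds 0)" .
      then show ?thesis
        using f(2) unfolding vanishes_on_def filterlim_iff by blast
    qed
    ultimately have "\<forall>\<^sub>F t in nhds 0. f (\<gamma> t) = 0"
    proof eventually_elim
      case (elim t)
      have \<gamma>U: "\<gamma> t \<in> U" using elim(1) G(2,7) unfolding \<gamma>_def by blast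
      have "r i (\<gamma> t) = 0" if "i \<in> E" for i
      proof -
        have "r i (\<gamma> t) = L i (\<Phi> p + t *\<^sub>R v)"
          using L\<Phi>[OF that, of "\<gamma> t"] G(9)[OF elim(1)] by (simp add: \<gamma>_def)
        also have "\<dots> = r i p + t * L i v"
          by (simp add: linear_add[OF L_lin] linear_scale[OF L_lin] that L\<Phi>)
        also have "\<dots> = 0"
          using v[OF that] U(2,4) pM that by (auto simp: L_def)
        finally show ?thesis .
      qed
      then have "\<gamma> t \<in> M" using \<gamma>U U(4) by blast
      then show ?case using elim(2) by blast
    qed
    then have "dir_deriv 1 (\<lambda>t. f (\<gamma> t)) 0 = dir_deriv 1 (\<lambda>t::real. 0 :: complex) 0"
      by (rule dir_deriv_cong)
    then show ?thesis
      using dir_deriv_eqI[OF f\<gamma>, of 1] by simp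
  qed
qed

text \<open>
  Lagrange multipliers: the differential of \<open>f\<close> vanishes on the common kernel of those of the \<open>r i\<close>.
  The multipliers are the derivatives of \<open>f\<close> along vectors dual to these, so they are real if \<open>f\<close> is.
\<close>

lemma derivative_of_vanishing_function:
  fixes M :: "(complex^'N::finite) set" and f :: "complex^'N \<Rightarrow> complex"
  assumes frame: "defining_frame E r b M p" and f: "f differentiable (at p)" "vanishes_on M p f"
  shows "\<exists>c. (\<forall>v. dir_deriv v f p = (\<Sum>i\<in>E. c i * of_real (dir_deriv v (r i) p))) \<and>
    ((\<forall>\<^sub>F z in nhds p. Im (f z) = 0) \<longrightarrow> (\<forall>i. Im (c i) = 0))"
proof -
  have rd: "r i differentiable (at p)" if "i \<in> E" for i
    using frame that smooth_on_differentiable unfolding defining_frame_def by blast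
  from defining_frame_dual_vectors[OF frame] obtain u where
    u: "\<forall>i\<in>E. \<forall>j. dir_deriv (u j) (r i) p = (if i = j then 1 else 0)" ..
  have lin: "linear (\<lambda>v. dir_deriv v (r i) p)" if "i \<in> E" for i
    by (rule linear_frechet_derivative[OF rd[OF that]])
  have linf: "linear (\<lambda>v. dir_deriv v f p)" by (rule linear_frechet_derivative[OF f(1)])
  define c where "c i = dir_deriv (u i) f p" for i
  have "dir_deriv v f p = (\<Sum>i\<in>E. c i * of_real (dir_deriv v (r i) p))" for v
  proof -
    define w where "w = v - (\<Sum>i\<in>E. dir_deriv v (r i) p *\<^sub>R u i)"
    have "dir_deriv w (r i) p = 0" if "i \<in> E" for i
    proof -
      have "dir_deriv w (r i) p = dir_deriv v (r i) p - (\<Sum>j\<in>E. dir_deriv v (r j) p * dir_deriv (u j) (r i) p)"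
        unfolding w_def by (simp add: linear_diff[OF lin] linear_sum[OF lin] linear_scale[OF lin] that)
      also have "(\<Sum>j\<in>E. dir_deriv v (r j) p * dir_deriv (u j) (r i) p) = (\<Sum>j\<in>E. if i = j then dir_deriv v (r j) p else 0)"
        using bspec[OF u that] by (intro sum.cong) auto
      finally show ?thesis using that by simp
    qed
    then have "dir_deriv w f p = 0"
      by (rule derivative_along_tangent_vector[OF frame f])
    then have "dir_deriv v f p = (\<Sum>i\<in>E. dir_deriv v (r i) p *\<^sub>R c i)"
      unfolding w_def by (simp add: linear_diff[OF linf] linear_sum[OF linf] linear_scale[OF linf] c_def)
    then show ?thesis by (simp add: scaleR_conv_of_real mult.commute)
  qed
  moreover have "Im (c i) = 0" if "\<forall>\<^sub>F z in nhds p. Im (f z) = 0" for i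
    using dir_deriv_bounded_linear[OF bounded_linear_Im f(1), of "u i"] dir_deriv_cong[OF that, of "u i"]
    by (simp add: c_def)
  ultimately show ?thesis by (intro exI[of _ c]) blast
qed

section \<open>Maps between generic submanifolds\<close>

lemma smooth_near_of_real: "smooth_near p r \<Longrightarrow> smooth_near p (\<lambda>z. complex_of_real (r z))"
  by (rule smooth_near_bounded_linear[OF bounded_linear_of_real])

lemma defining_frame_smooth: "defining_frame E r b M p \<Longrightarrow> i \<in> E \<Longrightarrow> smooth_near p (r i)"
  unfolding defining_frame_def smooth_near_def by blast

lemma smooth_near_dZ: "smooth_near p f \<Longrightarrow> smooth_near p (dZ k f)"
  using smooth_near_wirtinger[of p f "(k, True)"] by (simp add: dZ_wirtinger[abs_def])

lemma smooth_near_grad_Z: "smooth_near p r \<Longrightarrow> smooth_near p (\<lambda>z. grad_Z r z $ k)"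
  using smooth_near_dZ[OF smooth_near_of_real, of p r k] by (simp add: grad_Z_def)

lemma defining_frame_smooth_frame:
  assumes "defining_frame E r b M p"
  shows "smooth_near p (\<lambda>z. frame E r b z $ i $ k)"
  using smooth_near_grad_Z[OF defining_frame_smooth[OF assms]]
  by (cases "i \<in> E") (auto simp: frame_def)

lemma eventually_nonzero:
  fixes f :: "'a::real_normed_vector \<Rightarrow> complex"
  assumes "smooth_near p f" "f p \<noteq> 0"
  shows "\<forall>\<^sub>F z in nhds p. f z \<noteq> 0"
  using tendsto_imp_eventually_ne[OF smooth_near_continuous[OF assms(1), unfolded isCont_def] assms(2)]
    assms(2) unfolding eventually_nhds_conv_at by blast

lemma defining_frame_eventually:
  assumes "defining_frame E r b M p"
  shows "\<forall>\<^sub>F z in nhds p. z \<in> M \<longrightarrow> defining_frame E r b M z"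
proof -
  from assms obtain U where U: "open U \<and> p \<in> U \<and> (\<forall>i\<in>E. smooth_on U (r i)) \<and>
      M \<inter> U = {z\<in>U. \<forall>i\<in>E. r i z = 0}"
    unfolding defining_frame_def by (elim exE conjE) (rule that, intro conjI)
  have "\<forall>\<^sub>F z in nhds p. z \<in> U"
    using U by (intro eventually_nhds_in_open) auto
  moreover have "\<forall>\<^sub>F z in nhds p. det (frame E r b z) \<noteq> 0"
    by (rule eventually_nonzero[OF smooth_near_det[OF defining_frame_smooth_frame[OF assms]]])
      (use assms in \<open>simp add: defining_frame_def\<close>)
  ultimately show ?thesis
  proof eventually_elim
    case (elim z)
    then show ?case unfolding defining_frame_def using U by blast
  qed
qed

lemma vanishes_on_eventually:
  "vanishes_on M p f \<Longrightarrow> \<forall>\<^sub>F z in nhds p. vanishes_on M z f"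
  unfolding vanishes_on_def by (simp add: eventually_eventually)

lemma wirtinger_linear_combination:
  assumes "\<And>v. dir_deriv v f p = (\<Sum>i\<in>E. c i * of_real (dir_deriv v (r i) p))"
    and "\<And>i. i \<in> E \<Longrightarrow> r i differentiable (at p)"
  shows "wirtinger \<kappa> f p = (\<Sum>i\<in>E. c i * wirtinger \<kappa> (\<lambda>z. complex_of_real (r i z)) p)"
proof -
  have R: "dir_deriv v (\<lambda>z. complex_of_real (r i z)) p = of_real (dir_deriv v (r i) p)" if "i \<in> E" for i v
    by (rule dir_deriv_bounded_linear[OF bounded_linear_of_real assms(2)[OF that]])
  have "wirtinger \<kappa> f p = (\<Sum>i\<in>E. c i * ((of_real (dir_deriv (axis (fst \<kappa>) 1) (r i) p)
      + (if snd \<kappa> then - \<i> else \<i>) * of_real (dir_deriv (axis (fst \<kappa>) \<i>) (r i) p)) / 2))"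
    unfolding wirtinger_def assms(1)
    by (simp add: sum_distrib_left sum.distrib[symmetric] sum_divide_distrib algebra_simps)
  also have "\<dots> = (\<Sum>i\<in>E. c i * wirtinger \<kappa> (\<lambda>z. complex_of_real (r i z)) p)"
    by (intro sum.cong refl) (simp only: wirtinger_def R)
  finally show ?thesis .
qed

lemma tangent_field_frame:
  assumes frame: "defining_frame E r b M p" and X: "smooth_near p X"
    and tangent: "\<forall>\<^sub>F z in nhds p. z \<in> M \<longrightarrow> (\<forall>i\<in>E. vector_apply (X z) (\<lambda>z. complex_of_real (r i z)) z = 0)"
  shows "tangent_field M p X"
proof -
  have "vanishes_on M p (field_apply X f)" if f: "smooth_near p f" "vanishes_on M p f" for f
    unfolding vanishes_on_def
    using defining_frame_eventually[OF frame] tangent smooth_near_eventually[OF f(1)] vanishes_on_eventually[OF f(2)]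
  proof eventually_elim
    case (elim z)
    show ?case
    proof
      assume z: "z \<in> M"
      then have fr: "defining_frame E r b M z" using elim(1) by blast
      from derivative_of_vanishing_function[OF fr smooth_near_differentiable[OF elim(3)] elim(4)]
      obtain c where c: "(\<forall>v. dir_deriv v f z = (\<Sum>i\<in>E. c i * of_real (dir_deriv v (r i) z))) \<and>
        ((\<forall>\<^sub>F y in nhds z. Im (f y) = 0) \<longrightarrow> (\<forall>i. Im (c i) = 0))" ..
      have w: "wirtinger \<kappa> f z = (\<Sum>i\<in>E. c i * wirtinger \<kappa> (\<lambda>z. complex_of_real (r i z)) z)" for \<kappa>
        by (rule wirtinger_linear_combination)
          (use c smooth_near_differentiable[OF defining_frame_smooth[OF fr]] in blast)+
      have "field_apply X f z = (\<Sum>\<kappa>\<in>UNIV. \<Sum>i\<in>E. coord (X z) \<kappa> * (c i * wirtinger \<kappa> (\<lambda>z. complex_of_real (r i z)) z))"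
        unfolding field_apply_def vector_apply_coord w sum_distrib_left ..
      also have "\<dots> = (\<Sum>i\<in>E. c i * vector_apply (X z) (\<lambda>z. complex_of_real (r i z)) z)"
        unfolding vector_apply_coord sum_distrib_left by (subst sum.swap) (simp only: mult_ac)
      also have "\<dots> = 0" using elim(2) z by simp
      finally show "field_apply X f z = 0" .
    qed
  qed
  then show ?thesis
    unfolding tangent_field_def using smooth_near_imp_field[OF X] by blast
qed

lemma vector_apply_real:
  assumes "r differentiable (at p)"
  shows "vector_apply \<xi> (\<lambda>z. complex_of_real (r z)) p =
    (\<Sum>k\<in>UNIV. fst \<xi> $ k * grad_Z r p $ k + snd \<xi> $ k * cnj (grad_Z r p $ k))"
  unfolding vector_apply_def dZbar_real[OF assms] by (simp add: grad_Z_def)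

lemma vector_apply_cconj_real:
  assumes "r differentiable (at p)"
  shows "vector_apply (cconj \<xi>) (\<lambda>z. complex_of_real (r z)) p = cnj (vector_apply \<xi> (\<lambda>z. complex_of_real (r z)) p)"
  unfolding vector_apply_real[OF assms] by (simp add: cconj_def add.commute)

lemma dZ_cnj:
  assumes "f differentiable (at p)"
  shows "dZ k (\<lambda>z. cnj (f z)) p = cnj (dZbar k f p)"
  unfolding dZ_def dZbar_def dir_deriv_bounded_linear[OF bounded_linear_cnj assms] by simp

lemma cnj_det: "cnj (det (A :: complex^'N::finite^'N)) = det (\<chi> i j. cnj (A $ i $ j))"
  unfolding det_def by simp

lemma smooth_near_vec:
  fixes F :: "'a::real_normed_vector \<Rightarrow> complex^'N::finite"
  assumes "\<And>i. smooth_near p (\<lambda>z. F z $ i)"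
  shows "smooth_near p F"
proof -
  have "smooth_near p (\<lambda>z. \<Sum>i\<in>UNIV. axis i (F z $ i))"
    by (intro smooth_near_sum smooth_near_bounded_linear[OF bounded_linear_axis] assms finite)
  then show ?thesis by (simp only: sum_axis)
qed

lemma grad_Z_chain_rule:
  fixes H :: "complex^'N::finite \<Rightarrow> complex^'N"
  assumes "holo_map U H" "z \<in> U" "r differentiable (at (H z))"
  shows "dZ k (\<lambda>z. complex_of_real (r (H z))) z = (\<Sum>l\<in>UNIV. grad_Z r (H z) $ l * cjac H z $ l $ k)"
proof -
  let ?R = "\<lambda>z. complex_of_real (r z)" and ?h = "cjac H z"
  have R: "?R differentiable (at (H z))"
    by (rule differentiableI[OF bounded_linear.has_derivative[OF bounded_linear_of_real
            assms(3)[unfolded frechet_derivative_works]]])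
  have D: "dir_deriv v (\<lambda>z. ?R (H z)) z = dir_deriv (?h *v v) ?R (H z)" for v
    by (rule dir_deriv_eqI[OF has_derivative_compose[OF holo_map_has_derivative[OF assms(1,2)]
            R[unfolded frechet_derivative_works]]])
  have "(?h *v axis k c) $ l = c * ?h $ l $ k" for c l
    by (simp add: matrix_vector_mult_def axis_def mult_delta_right)
  then have E: "dir_deriv (axis k c) (\<lambda>z. ?R (H z)) z
      = (\<Sum>l\<in>UNIV. c * ?h $ l $ k * dZ l ?R (H z) + cnj (c * ?h $ l $ k) * dZbar l ?R (H z))" for c
    unfolding D dir_deriv_wirtinger[OF R] by simp
  show ?thesis
    unfolding dZ_def[of k] E grad_Z_def
    by (simp add: sum_distrib_left sum_subtractf[symmetric] sum_divide_distrib algebra_simps)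
qed

lemma row_eq_nth: "row i A = A $ i"
  by (simp add: row_def vec_eq_iff)

text \<open>
  In this locale \<open>B\<close> is the frame of \<open>M\<close>, \<open>B'\<close> is the frame of \<open>M'\<close> pulled back by \<open>H\<close>, and the rows of \<open>Q\<close> with
  index in \<open>E\<close> are the gradients of the defining functions of \<open>M'\<close> composed with \<open>H\<close>. By Cramer's rule
  \<open>A z i k\<close> is the coefficient of row \<open>k\<close> of \<open>B z\<close> in row \<open>i\<close> of \<open>Q z\<close>. The matrix \<open>T\<close> is the transpose of
  the \<open>E \<times> E\<close> block of \<open>A\<close>, filled up by the identity, so that \<open>a\<close> is the determinant of that block.
\<close>

locale cr_map =
  fixes M M' :: "(complex^'N::finite) set" and p :: "complex^'N" and H :: "complex^'N \<Rightarrow> complex^'N"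
    and E :: "'N set" and r r' :: "'N \<Rightarrow> complex^'N \<Rightarrow> real" and b b' :: "'N \<Rightarrow> complex^'N"
    and U :: "(complex^'N) set"
  assumes frame: "defining_frame E r b M p" and frame': "defining_frame E r' b' M' (H p)"
    and U: "open U" "p \<in> U" and holo: "holo_map U H"
    and maps: "\<forall>\<^sub>F z in nhds p. z \<in> M \<longrightarrow> H z \<in> M'"
begin

definition B where "B z = frame E r b z"
definition B' where "B' z = frame E r' b' (H z)"
definition Q where "Q z = B' z ** cjac H z"
definition A where "A z i k = det (\<chi> j. if j = k then Q z $ i else B z $ j) * inverse (det (B z))"
definition T where "T z = (\<chi> k i. if i \<in> E \<and> k \<in> E then A z i k else if i = k then 1 else 0)"
definition a where "a z = det (T z)"
abbreviation "J z \<equiv> det (cjac H z)"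

lemma smooth_cjac: "smooth_near p (\<lambda>z. cjac H z $ i $ k)"
  by (rule holo_on_smooth_near[OF U(1) holo_on_cjac[OF U(1) holo] U(2)])

lemma smooth_H: "smooth_near p H"
  using holo by (intro smooth_near_vec holo_on_smooth_near[OF U(1) _ U(2)]) (auto simp: holo_map_def)

lemma smooth_B: "smooth_near p (\<lambda>z. B z $ i $ k)"
  unfolding B_def by (rule defining_frame_smooth_frame[OF frame])

lemma smooth_B': "smooth_near p (\<lambda>z. B' z $ i $ k)"
  unfolding B'_def by (rule smooth_near_compose[OF smooth_H defining_frame_smooth_frame[OF frame']])

lemma smooth_Q: "smooth_near p (\<lambda>z. Q z $ i $ k)"
  unfolding Q_def matrix_matrix_mult_def
  by (simp only: vec_lambda_beta) (intro smooth_near_sum smooth_near_mult smooth_B' smooth_cjac finite)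

lemma det_B: "det (B p) \<noteq> 0" and det_B': "det (B' p) \<noteq> 0"
  using frame frame' by (simp_all add: defining_frame_def B_def B'_def)

lemma smooth_A: "smooth_near p (\<lambda>z. A z i k)"
proof -
  have "smooth_near p (\<lambda>z. (\<chi> j. if j = k then Q z $ i else B z $ j) $ j $ l)" for j l
    using smooth_Q smooth_B by (cases "j = k") simp_all
  then show ?thesis
    unfolding A_def
    by (intro smooth_near_mult smooth_near_det smooth_near_inverse smooth_B det_B)
qed

lemma smooth_T: "smooth_near p (\<lambda>z. T z $ k $ i)"
proof (cases "i \<in> E \<and> k \<in> E")
  case True
  then show ?thesis by (simp add: T_def smooth_A)
next
  case False
  show ?thesis by (simp only: T_def vec_lambda_beta False if_False smooth_near_const)
qed

lemma smooth_a: "smooth_near p a"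
proof -
  have "smooth_near p (\<lambda>z. det (T z))" by (rule smooth_near_det[OF smooth_T])
  then show ?thesis by (simp add: a_def[abs_def])
qed

lemma smooth_J: "smooth_near p (\<lambda>z. J z)"
  by (intro smooth_near_det smooth_cjac)

text \<open>
  The Lagrange multipliers for the defining functions of \<open>M'\<close> composed with \<open>H\<close>, which are real-valued
  and vanish on \<open>M\<close>.
\<close>

lemma Q_expansion:
  "\<forall>\<^sub>F z in nhds p. z \<in> M \<longrightarrow> (\<forall>i\<in>E. Q z $ i = (\<Sum>k\<in>E. A z i k *s B z $ k) \<and> (\<forall>k\<in>E. Im (A z i k) = 0))"
proof -
  have smooth_r': "smooth_near p (\<lambda>z. complex_of_real (r' i (H z)))" if "i \<in> E" for i
    by (rule smooth_near_compose[OF smooth_H smooth_near_of_real[OF defining_frame_smooth[OF frame' that]]])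
  have ev1: "\<forall>\<^sub>F z in nhds p. z \<in> U" using U by (intro eventually_nhds_in_open)
  have H_lim: "filterlim H (nhds (H p)) (nhds p)"
    using smooth_near_continuous[OF smooth_H] by (simp add: isCont_def tendsto_nhds_iff)
  from defining_frame_eventually[OF frame', THEN eventually_compose_filterlim, OF H_lim]
  have ev2: "\<forall>\<^sub>F z in nhds p. H z \<in> M' \<longrightarrow> defining_frame E r' b' M' (H z)" .
  have ev3: "\<forall>\<^sub>F z in nhds p. \<forall>i\<in>E. smooth_near z (\<lambda>z. complex_of_real (r' i (H z)))"
    by (intro eventually_ball_finite ballI smooth_near_eventually smooth_r' finite)
  have van: "vanishes_on M p (\<lambda>z. complex_of_real (r' i (H z)))" if "i \<in> E" for i
    unfolding vanishes_on_def using maps ev2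
  proof eventually_elim
    case (elim z)
    show ?case
    proof
      assume "z \<in> M"
      then have "H z \<in> M'" "defining_frame E r' b' M' (H z)" using elim by blast+
      then show "complex_of_real (r' i (H z)) = 0"
        using that unfolding defining_frame_def by auto
    qed
  qed
  have ev4: "\<forall>\<^sub>F z in nhds p. \<forall>i\<in>E. vanishes_on M z (\<lambda>z. complex_of_real (r' i (H z)))"
    by (intro eventually_ball_finite ballI vanishes_on_eventually van finite)
  show ?thesis
    using defining_frame_eventually[OF frame] ev1 ev2 ev3 ev4 maps
  proof eventually_elim
    case (elim z)
    show ?case
    proof (intro impI ballI)
      fix i assume z: "z \<in> M" and i: "i \<in> E"
      have fr: "defining_frame E r b M z" and fr': "defining_frame E r' b' M' (H z)"
        using elim z by blast+
      have det: "det (B z) \<noteq> 0" using fr by (simp add: defining_frame_def B_def)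
      let ?f = "\<lambda>z. complex_of_real (r' i (H z))"
      from derivative_of_vanishing_function[OF fr smooth_near_differentiable[OF elim(4)[rule_format, OF i]] elim(5)[rule_format, OF i]]
      obtain c where c: "(\<forall>v. dir_deriv v ?f z = (\<Sum>k\<in>E. c k * of_real (dir_deriv v (r k) z))) \<and>
        ((\<forall>\<^sub>F y in nhds z. Im (?f y) = 0) \<longrightarrow> (\<forall>k. Im (c k) = 0))" ..
      have real: "Im (c k) = 0" for k using c by simp
      have w: "wirtinger \<kappa> ?f z = (\<Sum>k\<in>E. c k * wirtinger \<kappa> (\<lambda>z. complex_of_real (r k z)) z)" for \<kappa>
        by (rule wirtinger_linear_combination)
          (use c smooth_near_differentiable[OF defining_frame_smooth[OF fr]] in blast)+
      have Qi: "Q z $ i $ k = dZ k ?f z" for k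
        using i grad_Z_chain_rule[OF holo elim(2) smooth_near_differentiable[OF defining_frame_smooth[OF fr' i]]]
        by (simp add: Q_def B'_def frame_def matrix_matrix_mult_def)
      define x where "x = (\<chi> k. if k \<in> E then c k else 0)"
      have Qsum: "Q z $ i = (\<Sum>k\<in>E. c k *s B z $ k)"
        by (simp add: vec_eq_iff Qi dZ_wirtinger w B_def frame_def grad_Z_def)
      also have "\<dots> = (\<Sum>k\<in>E. x $ k *s row k (B z))"
        by (intro sum.cong) (simp_all add: x_def row_def)
      also have "\<dots> = (\<Sum>k\<in>UNIV. x $ k *s row k (B z))"
        by (rule sum.mono_neutral_left) (simp_all add: x_def)
      finally have Qx: "Q z $ i = (\<Sum>k\<in>UNIV. x $ k *s row k (B z))" .
      have "det (\<chi> j. if j = k then Q z $ i else row j (B z)) = x $ k * det (B z)" for k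
        unfolding Qx by (rule cramer_lemma_transpose)
      then have "det (\<chi> j. if j = k then Q z $ i else B z $ j) = x $ k * det (B z)" for k
        by (simp only: row_eq_nth)
      then have A: "A z i k = c k" if "k \<in> E" for k
        using det that by (simp add: A_def x_def)
      show "Q z $ i = (\<Sum>k\<in>E. A z i k *s B z $ k) \<and> (\<forall>k\<in>E. Im (A z i k) = 0)"
        using Qsum A real by simp
    qed
  qed
qed

lemma a_real: "\<forall>\<^sub>F z in nhds p. z \<in> M \<longrightarrow> cnj (a z) = a z"
  using Q_expansion
proof eventually_elim
  case (elim z)
  show ?case
  proof
    assume "z \<in> M"
    then have "\<forall>i\<in>E. \<forall>k\<in>E. cnj (A z i k) = A z i k"
      using elim by (simp add: complex_eq_iff)
    then have "(\<chi> k i. cnj (T z $ k $ i)) = T z"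
      by (simp add: vec_eq_iff T_def)
    then show "cnj (a z) = a z" by (simp add: a_def cnj_det)
  qed
qed

text \<open>
  On \<open>M\<close> the matrix \<open>Q\<close> is the product of the completed block of \<open>A\<close> with a matrix \<open>Q\<^sub>1\<close> whose rows with
  index in \<open>E\<close> are those of \<open>B\<close>. Geometrically, \<open>H\<^sub>Z\<close> maps the complex tangent space of \<open>M\<close> to that of \<open>M'\<close>,
  and \<open>a\<close> is the determinant of the induced map in the transversal directions.
\<close>

definition Q\<^sub>1 where "Q\<^sub>1 z = (\<chi> i. if i \<in> E then B z $ i else Q z $ i)"

lemma jacobian_factorization:
  "\<forall>\<^sub>F z in nhds p. z \<in> M \<longrightarrow> det (B' z) * J z = a z * det (Q\<^sub>1 z)"
  using Q_expansion
proof eventually_elim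
  case (elim z)
  show ?case
  proof
    assume z: "z \<in> M"
    have "Q z $ i $ l = (transpose (T z) ** Q\<^sub>1 z) $ i $ l" for i l
    proof (cases "i \<in> E")
      case True
      have "(transpose (T z) ** Q\<^sub>1 z) $ i $ l = (\<Sum>k\<in>UNIV. T z $ k $ i * Q\<^sub>1 z $ k $ l)"
        by (simp add: matrix_matrix_mult_def transpose_def)
      also have "\<dots> = (\<Sum>k\<in>UNIV. if k \<in> E then A z i k * B z $ k $ l else 0)"
        using True by (intro sum.cong) (auto simp: T_def Q\<^sub>1_def)
      also have "\<dots> = (\<Sum>k\<in>E. A z i k * B z $ k $ l)"
        by (simp add: sum.If_cases)
      also have "\<dots> = Q z $ i $ l"
        using elim z True by simp
      finally show ?thesis by simp
    next
      case False
      have "(transpose (T z) ** Q\<^sub>1 z) $ i $ l = (\<Sum>k\<in>UNIV. if i = k then Q z $ k $ l else 0)"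
        unfolding matrix_matrix_mult_def transpose_def vec_lambda_beta
        using False by (intro sum.cong) (auto simp: T_def Q\<^sub>1_def)
      then show ?thesis by simp
    qed
    then have "Q z = transpose (T z) ** Q\<^sub>1 z" by (simp add: vec_eq_iff)
    then have "det (Q z) = a z * det (Q\<^sub>1 z)" by (simp add: det_mul a_def)
    then show "det (B' z) * J z = a z * det (Q\<^sub>1 z)" by (simp add: Q_def det_mul)
  qed
qed

lemma smooth_Q\<^sub>1: "smooth_near p (\<lambda>z. det (Q\<^sub>1 z))"
proof -
  have "smooth_near p (\<lambda>z. Q\<^sub>1 z $ i $ k)" for i k
    using smooth_B smooth_Q by (cases "i \<in> E") (simp_all add: Q\<^sub>1_def)
  then show ?thesis by (rule smooth_near_det)
qed

text \<open>
  Along \<open>M\<close>, some multiple of \<open>F\<close> by a power of \<open>a\<close> is a combination of the rows of the complex Jacobian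
  matrix of \<open>H\<close> with smooth coefficients.
\<close>

definition in_row_module :: "(complex^'N \<Rightarrow> complex^'N) \<Rightarrow> bool" where
  "in_row_module F \<longleftrightarrow> (\<forall>k. smooth_near p (\<lambda>z. F z $ k)) \<and> (\<exists>m S. (\<forall>l. smooth_near p (\<lambda>z. S z $ l)) \<and>
     (\<forall>\<^sub>F z in nhds p. z \<in> M \<longrightarrow> a z ^ m *s F z = S z v* cjac H z))"

lemma det_replaced_row_linear:
  fixes v :: "'N \<Rightarrow> complex^'N"
  shows "(\<Sum>l\<in>UNIV. c l * det (\<chi> k. if k = j then v l else A0 $ k)) =
    det (\<chi> k. if k = j then (\<Sum>l\<in>UNIV. c l *s v l) else A0 $ k :: complex^'N^'N)"
proof -
  have "det (\<chi> k. if k = j then (\<Sum>l\<in>UNIV. c l *s v l) else A0 $ k)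
      = (\<Sum>l\<in>UNIV. det (\<chi> k. if k = j then c l *s v l else A0 $ k))"
    by (rule det_linear_row_sum[where k = j and S = UNIV and a = "\<lambda>i l. c l *s v l" and c = "\<lambda>k. A0 $ k", OF finite])
  then show ?thesis by (simp only: det_row_mul)
qed

text \<open>
  Solving the relation between the rows of \<open>Q\<close> and \<open>B\<close> for a gradient costs the determinant \<open>a\<close>. Cramer's
  rule replaces the row \<open>j\<close> of \<open>T\<close> by a column of \<open>Q\<close>; the latter is a combination of columns of \<open>B'\<close> with
  entries of the Jacobian matrix as coefficients, and these come out of the determinant by
  linearity.
\<close>

lemma row_module_gradient:
  assumes j: "j \<in> E"
  shows "in_row_module (grad_Z (r j))"
proof -
  define S where "S z = (\<chi> l. det (\<chi> k. if k = j then (\<chi> i. if i \<in> E then B' z $ i $ l else 0) else T z $ k))" for z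
  have "smooth_near p (\<lambda>z. (\<chi> k. if k = j then (\<chi> i. if i \<in> E then B' z $ i $ l else 0) else T z $ k) $ k $ i)" for k i l
    using smooth_T smooth_B' by (cases "k = j"; cases "i \<in> E") simp_all
  then have "smooth_near p (\<lambda>z. det (\<chi> k. if k = j then (\<chi> i. if i \<in> E then B' z $ i $ l else 0) else T z $ k))" for l
    by (rule smooth_near_det)
  then have S: "smooth_near p (\<lambda>z. S z $ l)" for l
    by (simp only: S_def vec_lambda_beta)
  have "\<forall>\<^sub>F z in nhds p. z \<in> M \<longrightarrow> a z ^ 1 *s grad_Z (r j) z = S z v* cjac H z"
    using Q_expansion
  proof eventually_elim
    case (elim z)
    have "a z * grad_Z (r j) z $ c = (S z v* cjac H z) $ c" if z: "z \<in> M" for c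
    proof -
      define x where "x = (\<chi> k. if k \<in> E then B z $ k $ c else 0)"
      define q where "q = (\<chi> i. if i \<in> E then Q z $ i $ c else 0)"
      have "(\<Sum>k\<in>UNIV. x $ k *s row k (T z)) $ i = q $ i" for i
      proof -
        have "(\<Sum>k\<in>UNIV. x $ k *s row k (T z)) $ i = (\<Sum>k\<in>UNIV. x $ k * T z $ k $ i)"
          by (simp add: row_def)
        also have "\<dots> = (\<Sum>k\<in>UNIV. if k \<in> E then (if i \<in> E then A z i k * B z $ k $ c else 0) else 0)"
          by (intro sum.cong) (auto simp: x_def T_def)
        also have "\<dots> = (\<Sum>k\<in>E. if i \<in> E then A z i k * B z $ k $ c else 0)"
          by (simp add: sum.If_cases)
        also have "\<dots> = q $ i"
          using elim z by (simp add: q_def)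
        finally show ?thesis .
      qed
      then have xq: "(\<Sum>k\<in>UNIV. x $ k *s row k (T z)) = q" by (simp add: vec_eq_iff)
      have q: "q = (\<Sum>l\<in>UNIV. cjac H z $ l $ c *s (\<chi> i. if i \<in> E then B' z $ i $ l else 0))"
        by (simp add: vec_eq_iff q_def Q_def matrix_matrix_mult_def mult.commute)
      have "(S z v* cjac H z) $ c = (\<Sum>l\<in>UNIV. cjac H z $ l $ c *
          det (\<chi> k. if k = j then (\<chi> i. if i \<in> E then B' z $ i $ l else 0) else T z $ k))"
        by (simp add: S_def vector_matrix_mult_def mult.commute)
      also have "\<dots> = det (\<chi> k. if k = j then q else T z $ k)"
        unfolding q by (rule det_replaced_row_linear)
      also have "\<dots> = det (\<chi> k. if k = j then q else row k (T z))"
        by (simp only: row_eq_nth)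
      also have "\<dots> = x $ j * a z"
        using cramer_lemma_transpose[of j x "T z"] by (simp only: xq a_def)
      also have "\<dots> = a z * grad_Z (r j) z $ c"
        using j by (simp add: x_def B_def frame_def)
      finally show ?thesis by simp
    qed
    then show ?case by (simp add: vec_eq_iff)
  qed
  then show ?thesis
    unfolding in_row_module_def using S smooth_near_grad_Z[OF defining_frame_smooth[OF frame j]] by blast
qed

lemma holo_annihilated:
  assumes X: "\<forall>\<^sub>F z in nhds p. z \<in> M \<longrightarrow> fst (X z) = 0" and f: "holo_on U f"
  shows "vanishes_on M p (field_apply X f)"
  unfolding vanishes_on_def using X eventually_nhds_in_open[OF U]
  by eventually_elim (use f in \<open>auto simp: field_apply_def vector_apply_def holo_on_def\<close>)

lemma cnj_holo_annihilated:
  assumes X: "\<forall>\<^sub>F z in nhds p. z \<in> M \<longrightarrow> snd (X z) = 0" and f: "holo_on U f"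
  shows "vanishes_on M p (field_apply X (\<lambda>z. cnj (f z)))"
  unfolding vanishes_on_def using X eventually_nhds_in_open[OF U]
  by eventually_elim (use f in \<open>auto simp: field_apply_def vector_apply_def holo_on_def dZ_cnj\<close>)

lemma power_rule:
  assumes "f differentiable (at z)"
  shows "f z * vector_apply \<xi> (\<lambda>z. f z ^ m) z = of_nat m * f z ^ m * vector_apply \<xi> f z"
proof (cases m)
  case (Suc n)
  show ?thesis unfolding Suc vector_apply_power[OF assms] by simp
qed simp

text \<open>
  Differentiating \<open>a\<^sup>m F = S H\<^sub>Z\<close> along a field that annihilates \<open>H\<^sub>Z\<close> and multiplying by \<open>a\<close> gives
  \<open>a\<^bsup>m+1\<^esup> X F = (a X S - m (X a) S) H\<^sub>Z\<close>.
\<close>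

lemma row_module_field_apply:
  assumes F: "in_row_module F" and X: "tangent_field M p X" and X01: "\<forall>\<^sub>F z in nhds p. z \<in> M \<longrightarrow> fst (X z) = 0"
  shows "in_row_module (field_apply_vec X F)"
proof -
  have Fs: "smooth_near p (\<lambda>z. F z $ k)" for k using F by (simp add: in_row_module_def)
  from F obtain m S where S: "\<And>l. smooth_near p (\<lambda>z. S z $ l)"
    and eq: "\<forall>\<^sub>F z in nhds p. z \<in> M \<longrightarrow> a z ^ m *s F z = S z v* cjac H z"
    unfolding in_row_module_def by (elim conjE exE) (rule that, auto)
  have Xs: "smooth_field_near p X" using X by (simp add: tangent_field_def)
  have ak: "smooth_near p (\<lambda>z. a z ^ m)" by (intro smooth_near_power smooth_a)
  let ?h = "cjac H"
  define S' where "S' z = (\<chi> l. a z * field_apply X (\<lambda>z. S z $ l) z - of_nat m * field_apply X a z * S z $ l)" for z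
  have S': "smooth_near p (\<lambda>z. S' z $ l)" for l
    unfolding S'_def vec_lambda_beta
    by (intro smooth_near_diff smooth_near_mult smooth_near_const smooth_near_field_apply Xs smooth_a S)
  have main: "\<forall>\<^sub>F z in nhds p. z \<in> M \<longrightarrow> a z ^ Suc m * field_apply X (\<lambda>z. F z $ k) z = (S' z v* ?h z) $ k" for k
  proof -
    let ?g = "\<lambda>z. a z ^ m * F z $ k + (\<Sum>l\<in>UNIV. (- S z $ l) * ?h z $ l $ k)"
    have "vanishes_on M p ?g"
      unfolding vanishes_on_def using eq
    proof (rule eventually_mono, intro impI)
      fix z assume "z \<in> M \<longrightarrow> a z ^ m *s F z = S z v* ?h z" "z \<in> M"
      then have "(a z ^ m *s F z) $ k = (S z v* ?h z) $ k" by simp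
      then show "?g z = 0"
        by (simp add: vector_matrix_mult_def sum_negf mult.commute)
    qed
    moreover have "smooth_near p ?g"
      by (intro smooth_near_add smooth_near_mult smooth_near_sum smooth_near_minus ak Fs S smooth_cjac finite)
    ultimately have van: "vanishes_on M p (field_apply X ?g)"
      using X unfolding tangent_field_def by blast
    have hol: "\<forall>\<^sub>F z in nhds p. \<forall>l. z \<in> M \<longrightarrow> field_apply X (\<lambda>z. ?h z $ l $ k) z = 0"
      using holo_annihilated[OF X01 holo_on_cjac[OF U(1) holo]] unfolding vanishes_on_def
      by (rule eventually_all_finite)
    have sm: "\<forall>\<^sub>F z in nhds p. \<forall>l. smooth_near z (\<lambda>z. S z $ l) \<and> smooth_near z (\<lambda>z. ?h z $ l $ k)"
      by (intro eventually_all_finite eventually_conj smooth_near_eventually S smooth_cjac)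
    show ?thesis
      using van[unfolded vanishes_on_def] hol sm eq smooth_near_eventually[OF smooth_a] smooth_near_eventually[OF Fs[of k]]
    proof eventually_elim
      case (elim z)
      show ?case
      proof
        assume z: "z \<in> M"
        let ?V = "\<lambda>f. vector_apply (X z) f z"
        have da: "a differentiable (at z)" and dF: "(\<lambda>z. F z $ k) differentiable (at z)"
          and dS: "(\<lambda>z. - S z $ l) differentiable (at z)" and dh: "(\<lambda>z. ?h z $ l $ k) differentiable (at z)" for l
          using elim(3,5,6) by (auto intro!: smooth_near_differentiable smooth_near_minus)
        have dam: "(\<lambda>z. a z ^ m) differentiable (at z)"
          by (rule smooth_near_differentiable[OF smooth_near_power[OF elim(5)]])
        have Vh: "?V (\<lambda>z. ?h z $ l $ k) = 0" for l
          using elim(2) z by (simp add: field_apply_def)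
        have VS: "?V (\<lambda>z. - S z $ l) = - ?V (\<lambda>z. S z $ l)" for l
        proof -
          have "(\<lambda>z. S z $ l) differentiable (at z)"
            using elim(3) by (auto intro!: smooth_near_differentiable)
          then have "?V (\<lambda>z. (- 1) * S z $ l) = (- 1) * ?V (\<lambda>z. S z $ l) + ?V (\<lambda>z. - 1) * S z $ l"
            by (intro vector_apply_mult differentiable_const)
          then show ?thesis by simp
        qed
        have "0 = ?V ?g" using elim(1) z by (simp add: field_apply_def)
        also have "?V ?g = ?V (\<lambda>z. a z ^ m * F z $ k) + ?V (\<lambda>z. \<Sum>l\<in>UNIV. (- S z $ l) * ?h z $ l $ k)"
          by (intro vector_apply_add differentiable_mult dam dF differentiable_sum ballI dS dh finite)
        also have "?V (\<lambda>z. a z ^ m * F z $ k) = a z ^ m * ?V (\<lambda>z. F z $ k) + ?V (\<lambda>z. a z ^ m) * F z $ k"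
          by (rule vector_apply_mult[OF dam dF])
        also have "?V (\<lambda>z. \<Sum>l\<in>UNIV. (- S z $ l) * ?h z $ l $ k) = (\<Sum>l\<in>UNIV. ?V (\<lambda>z. (- S z $ l) * ?h z $ l $ k))"
          by (intro vector_apply_sum finite differentiable_mult dS dh)
        also have "\<dots> = (\<Sum>l\<in>UNIV. - ?V (\<lambda>z. S z $ l) * ?h z $ l $ k)"
          by (intro sum.cong refl) (simp only: vector_apply_mult[OF dS dh] Vh VS, simp)
        finally have solved: "a z ^ m * ?V (\<lambda>z. F z $ k)
            = (\<Sum>l\<in>UNIV. ?V (\<lambda>z. S z $ l) * ?h z $ l $ k) - ?V (\<lambda>z. a z ^ m) * F z $ k"
          by (simp add: sum_negf algebra_simps)
        have "a z ^ Suc m * ?V (\<lambda>z. F z $ k) = a z * (a z ^ m * ?V (\<lambda>z. F z $ k))"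
          by simp
        also have "\<dots> = a z * (\<Sum>l\<in>UNIV. ?V (\<lambda>z. S z $ l) * ?h z $ l $ k) - (a z * ?V (\<lambda>z. a z ^ m)) * F z $ k"
          unfolding solved by (simp only: right_diff_distrib mult.assoc)
        also have "(a z * ?V (\<lambda>z. a z ^ m)) * F z $ k = of_nat m * ?V a * (a z ^ m *s F z) $ k"
          by (simp add: power_rule[OF da])
        also have "(a z ^ m *s F z) $ k = (\<Sum>l\<in>UNIV. S z $ l * ?h z $ l $ k)"
          using elim(4) z by (simp add: vector_matrix_mult_def mult.commute)
        also have "a z * (\<Sum>l\<in>UNIV. ?V (\<lambda>z. S z $ l) * ?h z $ l $ k) - of_nat m * ?V a * (\<Sum>l\<in>UNIV. S z $ l * ?h z $ l $ k)
            = (S' z v* ?h z) $ k"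
          by (simp add: S'_def vector_matrix_mult_def field_apply_def sum_distrib_left sum_subtractf[symmetric] algebra_simps)
        finally show "a z ^ Suc m * field_apply X (\<lambda>z. F z $ k) z = (S' z v* ?h z) $ k"
          by (simp add: field_apply_def)
      qed
    qed
  qed
  have "\<forall>\<^sub>F z in nhds p. \<forall>k. z \<in> M \<longrightarrow> a z ^ Suc m * field_apply X (\<lambda>z. F z $ k) z = (S' z v* ?h z) $ k"
    by (rule eventually_all_finite[OF main])
  then have "\<forall>\<^sub>F z in nhds p. z \<in> M \<longrightarrow> a z ^ Suc m *s field_apply_vec X F z = S' z v* ?h z"
    by (rule eventually_mono) (simp add: vec_eq_iff field_apply_vec_def del: power_Suc)
  moreover have "smooth_near p (\<lambda>z. field_apply_vec X F z $ k)" for k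
    unfolding field_apply_vec_def vec_lambda_beta by (intro smooth_near_field_apply Xs Fs)
  ultimately show ?thesis unfolding in_row_module_def using S' by blast
qed

end

lemma spanning_set_matrix:
  fixes S :: "(complex^'N::finite) set"
  assumes "vec.span S = UNIV"
  shows "\<exists>g :: 'N \<Rightarrow> complex^'N. (\<forall>i. g i \<in> S) \<and> det (\<chi> i. g i) \<noteq> 0"
proof -
  obtain T where T: "T \<subseteq> S" "vec.independent T" "S \<subseteq> vec.span T"
    by (rule vec.maximal_independent_subset)
  have finT: "finite T" using T(2) by (rule vec.finiteI_independent)
  have span: "vec.span T = UNIV"
    using vec.span_mono[OF T(3)] unfolding assms vec.span_span by (rule top_unique[THEN iffD1])
  have "card T = vec.dim (UNIV :: (complex^'N) set)"
    by (rule vec.basis_card_eq_dim) (use T(2) span in auto)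
  then have "card (UNIV :: 'N set) = card T" by (simp only: vec_dim_card)
  from finite_same_card_bij[OF finite finT this]
  obtain g where g: "bij_betw g (UNIV :: 'N set) T" ..
  have "rows (\<chi> i. g i) = T"
    using g by (auto simp: rows_def row_eq_nth bij_betw_def)
  then have "\<exists>B. B ** (\<chi> i. g i) = mat 1"
    using span by (simp only: matrix_left_invertible_span_rows_gen)
  then have "det (\<chi> i. g i) \<noteq> 0"
    by (simp only: invertible_det_nz[symmetric] invertible_left_inverse)
  moreover have "g i \<in> S" for i using g T(1) by (auto simp: bij_betw_def)
  ultimately show ?thesis by (intro exI[of _ g]) blast
qed

lemma (in germ_prime) same_radical:
  assumes a: "smooth_near p a" and J: "smooth_near p J"
    and s: "smooth_near p u\<^sub>1" "smooth_near p c" "smooth_near p u\<^sub>2" "smooth_near p s"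
    and units: "u\<^sub>1 p \<noteq> 0" "u\<^sub>2 p \<noteq> 0"
    and 1: "\<forall>\<^sub>F z in nhds p. z \<in> M \<longrightarrow> u\<^sub>1 z * J z = a z * c z"
    and 2: "\<forall>\<^sub>F z in nhds p. z \<in> M \<longrightarrow> a z ^ m * u\<^sub>2 z = s z * J z"
  shows "J \<in> P \<longleftrightarrow> a \<in> P"
proof
  assume "J \<in> P"
  then have "(\<lambda>z. s z * J z) \<in> P" using s(4) by (rule mult_left)
  then have "(\<lambda>z. u\<^sub>2 z * a z ^ m) \<in> P"
    by (rule eq_on, intro smooth_near_mult smooth_near_power s a)
      (use 2 in \<open>auto elim!: eventually_mono simp: mult.commute\<close>)
  then have "(\<lambda>z. a z ^ m) \<in> P"
    by (rule cancel_unit[OF _ s(3) units(2) smooth_near_power[OF a]])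
  then show "a \<in> P" using a by (rule power)
next
  assume "a \<in> P"
  then have "(\<lambda>z. a z * c z) \<in> P" using s(2) by (rule mult)
  then have "(\<lambda>z. u\<^sub>1 z * J z) \<in> P"
    by (rule eq_on, intro smooth_near_mult s J) (use 1 in \<open>auto elim!: eventually_mono\<close>)
  then show "J \<in> P"
    by (rule cancel_unit[OF _ s(1) units(1) J])
qed

context cr_map
begin

lemma row_module_iterated_apply:
  assumes X: "\<And>i. i < n \<Longrightarrow> tangent_field M p (L i)"
    "\<And>i. i < n \<Longrightarrow> \<forall>\<^sub>F z in nhds p. z \<in> M \<longrightarrow> fst (L i z) = 0"
    and F: "in_row_module F"
  shows "in_row_module (iterated_apply n L \<alpha> F)"
proof -
  have pow: "in_row_module ((field_apply_vec (L i) ^^ m) F)" if "i < n" "in_row_module F" for i m F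
    by (induction m) (use that row_module_field_apply X in auto)
  have "in_row_module (foldr (\<lambda>i. field_apply_vec (L i) ^^ \<alpha> i) xs F)" if "set xs \<subseteq> {..<n}" for xs
    using that by (induction xs) (auto intro: pow F)
  then show ?thesis unfolding iterated_apply_def by (simp add: subset_iff)
qed

text \<open>
  Multiplying by further powers of \<open>a\<close>, all rows \<open>F i\<close> satisfy a relation with the same exponent; the
  determinant of this matrix relation is the claim, with the unit \<open>u = det F\<close>.
\<close>

lemma jacobian_divides_power:
  assumes in_row_module: "\<And>i :: 'N. in_row_module (F i)" and det: "det (\<chi> i. F i p) \<noteq> 0"
  shows "\<exists>m u s. smooth_near p u \<and> smooth_near p s \<and> u p \<noteq> 0 \<and>
    (\<forall>\<^sub>F z in nhds p. z \<in> M \<longrightarrow> a z ^ m * u z = s z * J z)"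
proof -
  have "\<forall>i. \<exists>m S. (\<forall>l. smooth_near p (\<lambda>z. S z $ l)) \<and>
     (\<forall>\<^sub>F z in nhds p. z \<in> M \<longrightarrow> a z ^ m *s F i z = S z v* cjac H z)"
    using in_row_module by (simp add: in_row_module_def)
  from choice[OF this] obtain m where "\<forall>i. \<exists>S. (\<forall>l. smooth_near p (\<lambda>z. S z $ l)) \<and>
     (\<forall>\<^sub>F z in nhds p. z \<in> M \<longrightarrow> a z ^ m i *s F i z = S z v* cjac H z)" ..
  from choice[OF this] obtain S where S: "\<forall>i. (\<forall>l. smooth_near p (\<lambda>z. S i z $ l)) \<and>
     (\<forall>\<^sub>F z in nhds p. z \<in> M \<longrightarrow> a z ^ m i *s F i z = S i z v* cjac H z)" ..
  define m\<^sub>0 where "m\<^sub>0 = (\<Sum>i\<in>UNIV. m i)"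
  have m: "m i \<le> m\<^sub>0" for i unfolding m\<^sub>0_def by (rule member_le_sum) auto
  define S' where "S' z = (\<chi> i. a z ^ (m\<^sub>0 - m i) *s S i z)" for z
  define Fm where "Fm z = (\<chi> i. F i z)" for z
  have "\<forall>\<^sub>F z in nhds p. \<forall>i. z \<in> M \<longrightarrow> a z ^ m i *s F i z = S i z v* cjac H z"
    using S by (intro eventually_all_finite) blast
  then have eq: "\<forall>\<^sub>F z in nhds p. z \<in> M \<longrightarrow> a z ^ (m\<^sub>0 * CARD('N)) * det (Fm z) = det (S' z) * J z"
  proof (rule eventually_mono, intro impI)
    fix z assume *: "\<forall>i. z \<in> M \<longrightarrow> a z ^ m i *s F i z = S i z v* cjac H z" and z: "z \<in> M"
    have "(\<chi> i. a z ^ m\<^sub>0 *s F i z) $ i $ k = (S' z ** cjac H z) $ i $ k" for i k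
    proof -
      have "a z ^ m\<^sub>0 * F i z $ k = a z ^ (m\<^sub>0 - m i) * (a z ^ m i *s F i z) $ k"
        using m[of i] by (simp add: mult.assoc[symmetric] power_add[symmetric])
      also have "\<dots> = a z ^ (m\<^sub>0 - m i) * (\<Sum>l\<in>UNIV. S i z $ l * cjac H z $ l $ k)"
        using * z by (simp add: vector_matrix_mult_def mult.commute)
      also have "\<dots> = (S' z ** cjac H z) $ i $ k"
        by (simp add: S'_def matrix_matrix_mult_def sum_distrib_left mult.assoc)
      finally show ?thesis by simp
    qed
    then have "(\<chi> i. a z ^ m\<^sub>0 *s F i z) = S' z ** cjac H z"
      by (simp only: vec_eq_iff simp_thms)
    then have "det (\<chi> i. a z ^ m\<^sub>0 *s F i z) = det (S' z) * J z"
      by (simp only: det_mul)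
    then show "a z ^ (m\<^sub>0 * CARD('N)) * det (Fm z) = det (S' z) * J z"
      by (simp add: det_rows_mul Fm_def power_mult)
  qed
  have "smooth_near p (\<lambda>z. Fm z $ i $ k)" for i k
    using in_row_module[of i] by (simp add: Fm_def in_row_module_def)
  then have "smooth_near p (\<lambda>z. det (Fm z))" by (rule smooth_near_det)
  moreover have "smooth_near p (\<lambda>z. S' z $ i $ k)" for i k
  proof -
    have "smooth_near p (\<lambda>z. a z ^ (m\<^sub>0 - m i) * S i z $ k)"
      using S by (intro smooth_near_mult smooth_near_power smooth_a) blast
    then show ?thesis by (simp add: S'_def)
  qed
  then have "smooth_near p (\<lambda>z. det (S' z))" by (rule smooth_near_det)
  moreover have "det (Fm p) \<noteq> 0" using det by (simp add: Fm_def)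
  ultimately show ?thesis using eq
    by (intro exI[of _ "m\<^sub>0 * CARD('N)"] exI[of _ "\<lambda>z. det (Fm z)"] exI[of _ "\<lambda>z. det (S' z)"] conjI)
qed

lemma jacobian_mem_iff_cnj:
  assumes in_row_module: "\<And>i :: 'N. in_row_module (F i)" and det: "det (\<chi> i. F i p) \<noteq> 0"
    and P: "germ_prime M p P"
  shows "(\<lambda>z. J z) \<in> P \<longleftrightarrow> (\<lambda>z. cnj (J z)) \<in> P"
proof -
  interpret germ_prime M p P by (rule P)
  from jacobian_divides_power[OF in_row_module det] obtain m u s where us: "smooth_near p u" "smooth_near p s" "u p \<noteq> 0"
    and eq2: "\<forall>\<^sub>F z in nhds p. z \<in> M \<longrightarrow> a z ^ m * u z = s z * J z"
    by (elim exE conjE) (rule that)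
  have sB': "smooth_near p (\<lambda>z. det (B' z))" by (intro smooth_near_det smooth_B')
  have "(\<lambda>z. J z) \<in> P \<longleftrightarrow> a \<in> P"
    by (rule same_radical[OF smooth_a smooth_J sB' smooth_Q\<^sub>1 us(1,2) det_B' us(3) jacobian_factorization eq2])
  moreover have "(\<lambda>z. cnj (J z)) \<in> P \<longleftrightarrow> a \<in> P"
  proof (rule same_radical[OF smooth_a smooth_near_cnj[OF smooth_J] smooth_near_cnj[OF sB']
        smooth_near_cnj[OF smooth_Q\<^sub>1] smooth_near_cnj[OF us(1)] smooth_near_cnj[OF us(2)]])
    show "cnj (det (B' p)) \<noteq> 0" "cnj (u p) \<noteq> 0" using det_B' us(3) by simp_all
    show "\<forall>\<^sub>F z in nhds p. z \<in> M \<longrightarrow> cnj (det (B' z)) * cnj (J z) = a z * cnj (det (Q\<^sub>1 z))"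
      using jacobian_factorization a_real
      by eventually_elim (metis complex_cnj_mult)
    show "\<forall>\<^sub>F z in nhds p. z \<in> M \<longrightarrow> a z ^ m * cnj (u z) = cnj (s z) * cnj (J z)"
      using eq2 a_real
      by eventually_elim (metis complex_cnj_mult complex_cnj_power)
  qed
  ultimately show ?thesis by blast
qed

end

text \<open>
  Genericity: the (0,1) part must solve a linear system whose matrix consists of the conjugate
  gradients of the defining functions, and these are linearly independent.
\<close>

lemma tangent_vector_with_given_10_part:
  fixes M :: "(complex^'N::finite) set"
  assumes frame: "defining_frame E r b M p"
  shows "\<exists>\<xi>. fst \<xi> = v \<and> (\<forall>i\<in>E. vector_apply \<xi> (\<lambda>z. complex_of_real (r i z)) p = 0)"
proof -
  let ?B = "frame E r b p"
  have "det ?B \<noteq> 0" using frame by (simp add: defining_frame_def)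
  then obtain C where C: "?B ** C = mat 1"
    using invertible_det_nz invertible_right_inverse by blast
  define y where "y = (\<chi> i. - cnj ((?B *v v) $ i))"
  define w where "w = (\<chi> k. cnj ((C *v y) $ k))"
  have "?B *v (C *v y) = y" by (simp add: matrix_vector_mul_assoc C)
  then have Bw: "(\<Sum>k\<in>UNIV. ?B $ i $ k * (C *v y) $ k) = y $ i" for i
    by (simp add: vec_eq_iff matrix_vector_mult_def)
  have "vector_apply (v, w) (\<lambda>z. complex_of_real (r i z)) p = 0" if i: "i \<in> E" for i
  proof -
    have "(\<Sum>k\<in>UNIV. w $ k * cnj (grad_Z (r i) p $ k)) = cnj (\<Sum>k\<in>UNIV. ?B $ i $ k * (C *v y) $ k)"
      using i by (simp add: w_def frame_def mult.commute)
    also have "\<dots> = - (?B *v v) $ i" unfolding Bw by (simp add: y_def)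
    also have "(?B *v v) $ i = (\<Sum>k\<in>UNIV. v $ k * grad_Z (r i) p $ k)"
      using i by (simp add: matrix_vector_mult_def frame_def mult.commute)
    finally show ?thesis
      by (simp add: vector_apply_real[OF smooth_near_differentiable[OF defining_frame_smooth[OF frame i]]] sum.distrib)
  qed
  then show ?thesis by (intro exI[of _ "(v, w)"]) simp
qed

section \<open>Finite maps of finitely nondegenerate submanifolds of finite type\<close>

theorem theorem1p2:
  fixes M M' :: "(complex^'N::finite) set"
    and p0 :: "complex^'N"
    and d :: nat
    and \<rho> :: "nat \<Rightarrow> complex^'N \<Rightarrow> real"
    and H :: "complex^'N \<Rightarrow> complex^'N"
  assumes M_generic: "generic_defining_function d \<rho> M p0"
    and M_finite_type: "finite_type_at d \<rho> M p0"
    and M_nondegenerate: "finitely_nondegenerate_at d \<rho> M p0"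
    and M'_generic: "generic_submanifold_at d M' (H p0)"
    and H_holomorphic: "holomorphic_map_near p0 H"
    and H_finite: "finite_map_at p0 H"
    and H_maps: "\<forall>\<^sub>F p in nhds p0. p \<in> M \<longrightarrow> H p \<in> M'"
  shows "local_biholomorphism_at p0 H"
proof -
  \<comment> \<open>One injection \<open>e\<close> serves both submanifolds, which makes \<open>A\<close> a square block.\<close>
  have "card {..<d} \<le> card (UNIV :: 'N set)"
    using generic_codimension_le[OF M_generic] by simp
  then obtain e :: "nat \<Rightarrow> 'N" where e: "inj_on e {..<d}"
    using inj_on_iff_card_le[of "{..<d}" "UNIV :: 'N set"] by auto
  let ?E = "e ` {..<d}"
  define r where "r = (\<lambda>i. \<rho> (the_inv_into {..<d} e i))"
  from generic_defining_frame[OF M_generic e] obtain b where frame: "defining_frame ?E r b M p0"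
    unfolding r_def ..
  from M'_generic obtain \<rho>' where "generic_defining_function d \<rho>' M' (H p0)"
    unfolding generic_submanifold_at_def ..
  from generic_defining_frame[OF this e] obtain b' where
    frame': "defining_frame ?E (\<lambda>i. \<rho>' (the_inv_into {..<d} e i)) b' M' (H p0)" ..
  from H_holomorphic obtain U where H_near: "open U" "p0 \<in> U" "holo_map U H"
    unfolding holomorphic_map_near_def holomorphic_map_on_iff by blast
  interpret cr_map M M' p0 H ?E r "\<lambda>i. \<rho>' (the_inv_into {..<d} e i)" b b' U
    by unfold_locales (fact frame frame' H_near H_maps)+
  have re: "r (e j) = \<rho> j" if "j < d" for j
    using the_inv_into_f_f[OF e] that by (simp add: r_def)
  have pM: "p0 \<in> M" using frame by (simp add: defining_frame_def)
  have tangent_iff: "\<xi> \<in> complex_tangent_space d \<rho> z \<longleftrightarrow>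
      (\<forall>i\<in>?E. vector_apply \<xi> (\<lambda>z. complex_of_real (r i z)) z = 0)" for \<xi> z
    by (auto simp: complex_tangent_space_def re)
  let ?T01 = "smooth_sections M (T01 d \<rho>) p0" and ?T10 = "smooth_sections M (T10 d \<rho>) p0"
  have T01: "tangent_field M p0 X" "\<forall>\<^sub>F z in nhds p0. z \<in> M \<longrightarrow> fst (X z) = 0" if X: "X \<in> ?T01" for X
  proof -
    have Xs: "smooth_near p0 X" and ev: "\<forall>\<^sub>F z in nhds p0. z \<in> M \<longrightarrow> X z \<in> T01 d \<rho> z"
      using X by (auto simp: smooth_sections_def)
    show "tangent_field M p0 X"
      by (rule tangent_field_frame[OF frame Xs], rule eventually_mono[OF ev])
        (simp add: T01_def tangent_iff)
    show "\<forall>\<^sub>F z in nhds p0. z \<in> M \<longrightarrow> fst (X z) = 0"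
      by (rule eventually_mono[OF ev]) (simp add: T01_def)
  qed
  have T10: "tangent_field M p0 X" "\<forall>\<^sub>F z in nhds p0. z \<in> M \<longrightarrow> snd (X z) = 0" if X: "X \<in> ?T10" for X
  proof -
    have Xs: "smooth_near p0 X" and ev: "\<forall>\<^sub>F z in nhds p0. z \<in> M \<longrightarrow> X z \<in> T10 d \<rho> z"
      using X by (auto simp: smooth_sections_def)
    have diff: "\<forall>\<^sub>F z in nhds p0. \<forall>i\<in>?E. smooth_near z (r i)"
      by (intro eventually_ball_finite ballI smooth_near_eventually defining_frame_smooth[OF frame] finite)
    show "tangent_field M p0 X"
    proof (rule tangent_field_frame[OF frame Xs])
      show "\<forall>\<^sub>F z in nhds p0. z \<in> M \<longrightarrow> (\<forall>i\<in>?E. vector_apply (X z) (\<lambda>z. complex_of_real (r i z)) z = 0)"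
        using ev diff
      proof (eventually_elim, intro impI ballI)
        fix z i assume *: "z \<in> M \<longrightarrow> X z \<in> T10 d \<rho> z" "\<forall>i\<in>?E. smooth_near z (r i)" "z \<in> M" "i \<in> ?E"
        then obtain \<xi> where \<xi>: "X z = cconj \<xi>" "\<xi> \<in> T01 d \<rho> z"
          unfolding T10_def by blast
        have "vector_apply \<xi> (\<lambda>z. complex_of_real (r i z)) z = 0"
          using IntD1[OF \<xi>(2)[unfolded T01_def]] *(4) tangent_iff by blast
        then show "vector_apply (X z) (\<lambda>z. complex_of_real (r i z)) z = 0"
          unfolding \<xi>(1) vector_apply_cconj_real[OF smooth_near_differentiable[OF bspec[OF *(2,4)]]]
          by simp
      qed
    qed
    show "\<forall>\<^sub>F z in nhds p0. z \<in> M \<longrightarrow> snd (X z) = 0"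
      by (rule eventually_mono[OF ev]) (auto simp: T10_def T01_def cconj_def vec_eq_iff)
  qed
  let ?G = "?T10 \<union> ?T01"
  have G: "tangent_field M p0 X" if "X \<in> ?G" for X using that T10 T01 by blast
  from M_nondegenerate obtain L where L: "\<forall>i<CARD('N) - d. L i \<in> ?T01"
    and span: "vec.span {iterated_apply (CARD('N) - d) L \<alpha> (grad_Z (\<rho> j)) p0 | j \<alpha>. j < d} = UNIV"
    unfolding finitely_nondegenerate_at_def basis_of_sections_def by (elim exE conjE) (rule that)
  from spanning_set_matrix[OF span] obtain g :: "'N \<Rightarrow> complex^'N"
    where "(\<forall>i. g i \<in> {iterated_apply (CARD('N) - d) L \<alpha> (grad_Z (\<rho> j)) p0 | j \<alpha>. j < d}) \<and> det (\<chi> i. g i) \<noteq> 0" ..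
  then have g: "\<forall>i. \<exists>F. in_row_module F \<and> g i = F p0" and det_g: "det (\<chi> i. g i) \<noteq> 0"
  proof -
    assume *: "(\<forall>i. g i \<in> {iterated_apply (CARD('N) - d) L \<alpha> (grad_Z (\<rho> j)) p0 | j \<alpha>. j < d}) \<and> det (\<chi> i. g i) \<noteq> 0"
    show "\<forall>i. \<exists>F. in_row_module F \<and> g i = F p0"
    proof
      fix i
      obtain j \<alpha> where j: "j < d" "g i = iterated_apply (CARD('N) - d) L \<alpha> (grad_Z (\<rho> j)) p0"
        using * by blast
      have "in_row_module (grad_Z (\<rho> j))" using row_module_gradient[of "e j"] j(1) re by simp
      then have "in_row_module (iterated_apply (CARD('N) - d) L \<alpha> (grad_Z (\<rho> j)))"
        by (intro row_module_iterated_apply T01) (use L in blast)+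
      then show "\<exists>F. in_row_module F \<and> g i = F p0" using j(2) by blast
    qed
    show "det (\<chi> i. g i) \<noteq> 0" using * by blast
  qed
  from choice[OF g] obtain F where F: "\<forall>i. in_row_module (F i) \<and> g i = F i p0" ..
  have equiv: "(\<lambda>z. J z) \<in> P \<longleftrightarrow> (\<lambda>z. cnj (J z)) \<in> P" if "germ_prime M p0 P" for P
    by (rule jacobian_mem_iff_cnj[of F, OF _ _ that]) (use F det_g in simp_all)
  have holJ: "holo_on U (\<lambda>z. J z)"
    by (intro holo_on_det holo_on_cjac H_near(1,3))
  have "J p0 \<noteq> 0"
  proof
    assume J0: "J p0 = 0"
    have flat: "(\<lambda>z. J z) \<in> flat_germs p0 ?G"
    proof (rule flat_germs_mem[OF pM G smooth_J J0 _ equiv])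
      fix X assume "X \<in> ?G"
      then show "vanishes_on M p0 (field_apply X (\<lambda>z. J z)) \<or> vanishes_on M p0 (field_apply X (\<lambda>z. cnj (J z)))"
        using holo_annihilated[OF T01(2) holJ] cnj_holo_annihilated[OF T10(2) holJ] by blast
    qed
    have "\<forall>k. \<exists>Y. Y \<in> generated_lie_algebra ?G \<and> fst (Y p0) = axis k 1"
    proof
      fix k :: 'N
      obtain \<xi> where \<xi>: "fst \<xi> = axis k 1" "\<xi> \<in> complex_tangent_space d \<rho> p0"
        using tangent_vector_with_given_10_part[OF frame, of "axis k 1"] tangent_iff by blast
      then have "\<xi> \<in> (\<lambda>X. X p0) ` generated_lie_algebra ?G"
        using M_finite_type by (simp add: finite_type_at_def)
      then show "\<exists>Y. Y \<in> generated_lie_algebra ?G \<and> fst (Y p0) = axis k 1"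
        using \<xi>(1) by auto
    qed
    from choice[OF this] obtain Y where Y: "\<forall>k. Y k \<in> generated_lie_algebra ?G \<and> fst (Y k p0) = axis k 1" ..
    have "\<forall>\<^sub>F z in nhds p0. J z = 0"
      by (rule holomorphic_flat_germ_zero[OF pM G _ _ flat H_near(1,2) holJ, of Y]) (use Y in simp_all)
    then show False
      using isolated_fibre_imp_jacobian_nonzero[OF H_near finite_map_isolated_fibre[OF H_finite]] by blast
  qed
  then show ?thesis
    by (rule local_biholomorphism_atI[OF H_near])
qed

end
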